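(* Consider the half-duplex single-relay fading channel described in the context, and for $0\le r\le 1$ let $d^*(r)$ be the optimal diversity gain over all single-relay amplify-and-forward (AF) protocols at multiplexing gain $r$. Then the nonorthogonal amplify-and-forward (NAF) protocol (with a suitable repetition gain $b$ satisfying its energy constraint) achieves the optimal diversity-multiplexing tradeoff within the class of AF single-relay protocols: for every $0\le r\le1$ the diversity gain it achieves at multiplexing gain $r$ equals $d^*(r)$, and $$d^*(r)=(1-r)+(1-2r)^+ ,$$ where $(x)^+=\max\{x,0\}$.
   Context: Channel. All channels are flat, Rayleigh-fading and quasi-static: the channel gains $g_1$ (source-destination), $g_2$ (relay-destination) and $h$ (source-relay) are mutually independent zero-mean unit-variance circularly-symmetric complex Gaussian random variables, constant over a codeword (which spans a whole coherence interval). Noises are zero-mean, mutually independent, circularly-symmetric white complex Gaussian, of variance $\sigma_w^2$ at the relay and $\sigma_v^2$ at the destination, with $\sigma_v^2/\sigma_w^2$ a fixed constant. Each node has one antenna and may use average energy at most $E$ per transmitted symbol; $\rho=E/\sigma_v^2$ is the signal-to-noise ratio (SNR). Channel gains are known only at receiving nodes (the relay knows $h$; the destination knows all gains and the protocol parameters); there is no feedback to transmitters. Half-duplex: a node cannot transmit and receive at the same time. Single-relay AF protocol. The relay may only process its observations linearly. Such a protocol with codeword length $l$ is described by an integer $l'\le l$ and matrices $A_1\in\mathbb{C}^{l'\times l'}$, $A_2\in\mathbb{C}^{(l-l')\times(l-l')}$ (both diagonal) and $B\in\mathbb{C}^{(l-l')\times l'}$, through $$\mathbf{y}=\begin{bmatrix}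 g_1A_1&0\\ g_2hBA_1& g_1A_2\end{bmatrix}\mathbf{x}+\begin{bmatrix}0\\ g_2B\end{bmatrix}\mathbf{w}+\mathbf{v},$$ where $\mathbf{x}\in\mathbb{C}^l$ is the vector of source symbols (average energy constraint $E$ per symbol, also after multiplication by $A_1,A_2$), $\mathbf{w}\in\mathbb{C}^{l'}$ the relay noise, $\mathbf{v}\in\mathbb{C}^l$ the destination noise, and $\mathbf{y}\in\mathbb{C}^l$ the destination observation. The relay listens during the first $l'$ symbols and, during the remaining $l-l'$ symbols, transmits linear combinations of its observations with coefficients $B=[b_{ji}]$, subject to the average energy constraint, which for independent source symbols of energy $E$ and $A_1=\mathrm{diag}(a_1,\dots,a_{l'})$ reads $$|h|^2E\sum_{i=1}^{l'}|b_{ji}|^2|a_i|^2+\sigma_w^2\sum_{i=1}^{l'}|b_{ji}|^2\le E,\quad j=1,\dots,l-l'.$$ NAF protocol. The codeword (even length $l$) is divided into cooperation frames of two consecutive symbol-intervals. The source transmits a new symbol in every symbol-interval, and in the second symbol-interval of each frame the relay repeats the noisy signal it observed in the first one, scaled by a repetition gain $b$ with $|b|\le\sqrt{E/(|h|^2E+\sigma_w^2)}$. In frame $k$ the destination receives $$y_{1,k}=g_1x_{1,k}+v_{1,k},\qquad y_{2,k}=g_1x_{2,k}+g_2b(hx_{1,k}+w_{1,k})+v_{2,k}.$$ (Up to reordering of symbols, this is the AF protocol with $l'=l/2$, $A_1=A_2=I_{l/2}$, $B=bI_{l/2}$.) The source uses random Gaussian code-books with asymptotically large code-length $l$, and the destination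 uses maximum-likelihood (ML) decoding. Diversity and multiplexing. For a family of codes indexed by $\rho$, with rate $R(\rho)$ bits per channel use and ML error probability $P_E(\rho)$ at the destination (averaged over the fading and, for random code-books, over the code ensemble), the multiplexing gain is $r=\lim_{\rho\to\infty}R(\rho)/\log\rho$ and the diversity gain is $d=-\lim_{\rho\to\infty}\log P_E(\rho)/\log\rho$. The optimal diversity gain $d^*(r)$ is the supremum of the diversity gains achievable at multiplexing gain $r$ by AF protocols. *)

theory Defs
  imports "HOL-Probability.Probability"
begin

text \<open>
  Vectors in \<open>C^n\<close> are functions \<open>nat \<Rightarrow> complex\<close> of which only the entries \<open>i < n\<close> matter;
  all indices start at 0. The variances of the noises at destination and relay are called
  \<open>sv2\<close> and \<open>sw2\<close>.
\<close>

definition cgauss_density :: "real \<Rightarrow> complex \<Rightarrow> real" where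
  "cgauss_density s z = exp (- (cmod z)\<^sup>2 / s) / (pi * s)"

text \<open>Zero mean, variance \<open>s\<close> (that is, \<open>s/2\<close> per real dimension).\<close>

definition cgauss :: "real \<Rightarrow> complex measure" where
  "cgauss s = density lborel (\<lambda>z. ennreal (cgauss_density s z))"

definition cgauss_vec :: "nat \<Rightarrow> real \<Rightarrow> (nat \<Rightarrow> complex) measure" where
  "cgauss_vec n s = PiM {..<n} (\<lambda>_. cgauss s)"

text \<open>A codebook maps a message \<open>m < M\<close> to its codeword; a random codebook is a probability
  measure on the following space (a deterministic one is a point mass).\<close>

type_synonym codebook = "nat \<Rightarrow> nat \<Rightarrow> complex"

definition codebook_space :: "nat \<Rightarrow> nat \<Rightarrow> codebook measure" where
  "codebook_space M l = PiM {..<M} (\<lambda>_. PiM {..<l} (\<lambda>_. borel))"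

definition code_ensemble :: "nat \<Rightarrow> nat \<Rightarrow> codebook measure \<Rightarrow> bool" where
  "code_ensemble M l Q \<longleftrightarrow> prob_space Q \<and> sets Q = sets (codebook_space M l)"

definition gaussian_ensemble :: "nat \<Rightarrow> nat \<Rightarrow> real \<Rightarrow> codebook measure" where
  "gaussian_ensemble M l E = PiM {..<M} (\<lambda>_. cgauss_vec l E)"

text \<open>
  For fixed channel gains, a relaying scheme of codeword length \<open>l\<close> with \<open>n\<close> relay noise samples
  is a map \<open>F\<close> such that the destination observes \<open>y i = F x w i + v i\<close> for \<open>i < l\<close>.
\<close>

type_synonym scheme = "(nat \<Rightarrow> complex) \<Rightarrow> (nat \<Rightarrow> complex) \<Rightarrow> nat \<Rightarrow> complex"

text \<open>The density of the observation at \<open>y\<close> when \<open>x\<close> is sent: given \<open>w\<close> it is a product of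
  Gaussian densities, and \<open>w\<close>, being unknown to the destination, is averaged out.\<close>

definition likelihood ::
    "real \<Rightarrow> real \<Rightarrow> nat \<Rightarrow> nat \<Rightarrow> scheme \<Rightarrow> (nat \<Rightarrow> complex) \<Rightarrow> (nat \<Rightarrow> complex) \<Rightarrow> real" where
  "likelihood sv2 sw2 l n F x y =
     (\<integral>w. (\<Prod>i<l. cgauss_density sv2 (y i - F x w i)) \<partial>cgauss_vec n sw2)"

text \<open>Ties are broken in favour of the smallest message; the error probability averaged over
  equiprobable messages does not depend on the choice.\<close>

definition ml_decode ::
    "real \<Rightarrow> real \<Rightarrow> nat \<Rightarrow> nat \<Rightarrow> scheme \<Rightarrow> nat \<Rightarrow> codebook \<Rightarrow> (nat \<Rightarrow> complex) \<Rightarrow> nat" where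
  "ml_decode sv2 sw2 l n F M c y =
     (LEAST m. m < M \<and>
        (\<forall>m'<M. likelihood sv2 sw2 l n F (c m') y \<le> likelihood sv2 sw2 l n F (c m) y))"

definition ml_error ::
    "real \<Rightarrow> real \<Rightarrow> nat \<Rightarrow> nat \<Rightarrow> scheme \<Rightarrow> nat \<Rightarrow> codebook \<Rightarrow> real" where
  "ml_error sv2 sw2 l n F M c =
     (\<Sum>m<M. measure (cgauss_vec n sw2 \<Otimes>\<^sub>M cgauss_vec l sv2)
        {(w, v) \<in> space (cgauss_vec n sw2 \<Otimes>\<^sub>M cgauss_vec l sv2).
           ml_decode sv2 sw2 l n F M c (\<lambda>i. F (c m) w i + v i) \<noteq> m}) / real M"

text \<open>Average over the fading (\<open>g1\<close>: source-destination, \<open>g2\<close>: relay-destination,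
  \<open>h\<close>: source-relay) and over the code ensemble \<open>Q\<close>.\<close>

definition error_probability ::
    "real \<Rightarrow> real \<Rightarrow> nat \<Rightarrow> nat \<Rightarrow> (complex \<Rightarrow> complex \<Rightarrow> complex \<Rightarrow> scheme) \<Rightarrow> nat \<Rightarrow>
     codebook measure \<Rightarrow> real" where
  "error_probability sv2 sw2 l n F M Q =
     (\<integral>c. (\<integral>(g1, g2, h). ml_error sv2 sw2 l n (F g1 g2 h) M c
              \<partial>(cgauss 1 \<Otimes>\<^sub>M cgauss 1 \<Otimes>\<^sub>M cgauss 1)) \<partial>Q)"

text \<open>
  A family of codes has one fixed codeword length \<open>l\<close>; at signal-to-noise ratio \<open>\<rho>\<close> it has
  \<open>M \<rho>\<close> messages. The rate has to be positive: a single codeword is never decoded wrongly,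
  so it would have infinite diversity gain at multiplexing gain 0.
\<close>

definition rate :: "nat \<Rightarrow> nat \<Rightarrow> real" where
  "rate l M = log 2 (real M) / real l"

definition has_multiplexing_gain :: "nat \<Rightarrow> (real \<Rightarrow> nat) \<Rightarrow> real \<Rightarrow> bool" where
  "has_multiplexing_gain l M r \<longleftrightarrow>
     (\<forall>\<rho>>0. rate l (M \<rho>) > 0) \<and> ((\<lambda>\<rho>. rate l (M \<rho>) / log 2 \<rho>) \<longlongrightarrow> r) at_top"

definition has_diversity_gain :: "(real \<Rightarrow> real) \<Rightarrow> ereal \<Rightarrow> bool" where
  "has_diversity_gain PE d \<longleftrightarrow>
     ((\<lambda>\<rho>. if PE \<rho> = 0 then \<infinity> else ereal (- log 2 (PE \<rho>) / log 2 \<rho>)) \<longlongrightarrow> d) at_top"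

text \<open>
  \<open>listen\<close> is the number of symbols during which the relay listens; \<open>matA1\<close> and \<open>matA2\<close> hold the
  entries of the diagonal matrices. The relay knows \<open>h\<close>, so \<open>matB\<close> may depend on it; the source
  knows no channel gain.
\<close>

record af_protocol =
  listen :: nat
  matA1 :: "nat \<Rightarrow> complex"
  matA2 :: "nat \<Rightarrow> complex"
  matB :: "complex \<Rightarrow> nat \<Rightarrow> nat \<Rightarrow> complex"

definition af_scheme :: "af_protocol \<Rightarrow> complex \<Rightarrow> complex \<Rightarrow> complex \<Rightarrow> scheme" where
  "af_scheme p g1 g2 h x w i =
     (if i < listen p then g1 * matA1 p i * x i
      else let j = i - listen p in
        g2 * h * (\<Sum>k<listen p. matB p h j k * matA1 p k * x k) + g1 * matA2 p j * x i
        + g2 * (\<Sum>k<listen p. matB p h j k * w k))"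

text \<open>The mean of \<open>|f x|\<^sup>2\<close> over equiprobable messages and the code ensemble.\<close>

definition mean_energy ::
    "nat \<Rightarrow> codebook measure \<Rightarrow> ((nat \<Rightarrow> complex) \<Rightarrow> complex) \<Rightarrow> ennreal" where
  "mean_energy M Q f = (\<Sum>m<M. \<integral>\<^sup>+c. ennreal ((cmod (f (c m)))\<^sup>2) \<partial>Q) / of_nat M"

text \<open>
  The last condition bounds the energy of every symbol sent by the relay, a combination of its
  observations \<open>h * matA1 p k * x k + w k\<close> in which the noise is zero-mean, white and independent
  of \<open>x\<close>. For independent zero-mean source symbols of energy \<open>E\<close> its left-hand side is
  \<open>|h|\<^sup>2 E (\<Sum>k. |matB p h j k|\<^sup>2 |matA1 p k|\<^sup>2) + sw2 (\<Sum>k. |matB p h j k|\<^sup>2)\<close>.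
\<close>

definition af_admissible ::
    "real \<Rightarrow> real \<Rightarrow> nat \<Rightarrow> af_protocol \<Rightarrow> nat \<Rightarrow> codebook measure \<Rightarrow> bool" where
  "af_admissible E sw2 l p M Q \<longleftrightarrow>
     listen p \<le> l \<and>
     (\<forall>j<l - listen p. \<forall>k<listen p. (\<lambda>h. matB p h j k) \<in> borel_measurable borel) \<and>
     (\<forall>i<l. mean_energy M Q (\<lambda>x. x i) \<le> ennreal E) \<and>
     (\<forall>i<listen p. mean_energy M Q (\<lambda>x. matA1 p i * x i) \<le> ennreal E) \<and>
     (\<forall>j<l - listen p. mean_energy M Q (\<lambda>x. matA2 p j * x (listen p + j)) \<le> ennreal E) \<and>
     (\<forall>h. \<forall>j<l - listen p.
        mean_energy M Q (\<lambda>x. \<Sum>k<listen p. matB p h j k * (h * matA1 p k * x k))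
        + ennreal (sw2 * (\<Sum>k<listen p. (cmod (matB p h j k))\<^sup>2)) \<le> ennreal E)"

text \<open>The energy \<open>E\<close> and the noise variances are functions of the signal-to-noise ratio \<open>\<rho>\<close>;
  so are the protocol, the number of messages and the code ensemble.\<close>

definition af_achieves ::
    "(real \<Rightarrow> real) \<Rightarrow> (real \<Rightarrow> real) \<Rightarrow> (real \<Rightarrow> real) \<Rightarrow> real \<Rightarrow> ereal \<Rightarrow> bool" where
  "af_achieves E sv2 sw2 r d \<longleftrightarrow>
     (\<exists>l p M Q. l > 0 \<and>
        (\<forall>\<rho>>0. code_ensemble (M \<rho>) l (Q \<rho>) \<and>
               af_admissible (E \<rho>) (sw2 \<rho>) l (p \<rho>) (M \<rho>) (Q \<rho>)) \<and>
        has_multiplexing_gain l M r \<and>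
        has_diversity_gain
          (\<lambda>\<rho>. error_probability (sv2 \<rho>) (sw2 \<rho>) l (listen (p \<rho>)) (af_scheme (p \<rho>))
                  (M \<rho>) (Q \<rho>)) d)"

definition af_optimal_diversity ::
    "(real \<Rightarrow> real) \<Rightarrow> (real \<Rightarrow> real) \<Rightarrow> (real \<Rightarrow> real) \<Rightarrow> real \<Rightarrow> ereal" where
  "af_optimal_diversity E sv2 sw2 r = Sup {d. af_achieves E sv2 sw2 r d}"

text \<open>Frame \<open>k\<close> consists of the symbols \<open>2 * k\<close> and \<open>2 * k + 1\<close>, and \<open>w k\<close> is the relay noise
  in its first symbol.\<close>

definition naf_scheme ::
    "(complex \<Rightarrow> complex) \<Rightarrow> complex \<Rightarrow> complex \<Rightarrow> complex \<Rightarrow> scheme" where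
  "naf_scheme b g1 g2 h x w i =
     (if even i then g1 * x i
      else g1 * x i + g2 * b h * (h * x (i - 1) + w (i div 2)))"

definition naf_gain_admissible :: "real \<Rightarrow> real \<Rightarrow> (complex \<Rightarrow> complex) \<Rightarrow> bool" where
  "naf_gain_admissible E sw2 b \<longleftrightarrow>
     b \<in> borel_measurable borel \<and> (\<forall>h. cmod (b h) \<le> sqrt (E / ((cmod h)\<^sup>2 * E + sw2)))"

text \<open>With Gaussian codebooks, all sufficiently large codeword lengths give diversity gain \<open>d\<close>,
  whatever the numbers of messages that realise the multiplexing gain \<open>r\<close>.\<close>

definition naf_diversity_gain ::
    "(real \<Rightarrow> real) \<Rightarrow> (real \<Rightarrow> real) \<Rightarrow> (real \<Rightarrow> real) \<Rightarrow> (real \<Rightarrow> complex \<Rightarrow> complex) \<Rightarrow>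
     real \<Rightarrow> ereal \<Rightarrow> bool" where
  "naf_diversity_gain E sv2 sw2 b r d \<longleftrightarrow>
     (\<forall>\<^sub>F l in sequentially. even l \<longrightarrow>
        (\<forall>M. has_multiplexing_gain l M r \<longrightarrow>
           has_diversity_gain
             (\<lambda>\<rho>. error_probability (sv2 \<rho>) (sw2 \<rho>) l (l div 2) (naf_scheme (b \<rho>))
                     (M \<rho>) (gaussian_ensemble (M \<rho>) l (E \<rho>))) d))"

end

theory Submission
  imports Defs "HOL-Real_Asymp.Real_Asymp"
begin

text \<open>
  Converse. Give the relay noise to the destination. For every density \<open>q\<close> and constant \<open>K\<close>, the
  probability of correct decoding is at most the probability that the likelihood exceeds \<open>K exp a q\<close>, plus
  \<open>K exp a / M\<close>. If \<open>\<rho> |g\<^sub>1|\<^sup>2 \<le> X\<close> and \<open>\<rho> |g\<^sub>2|\<^sup>2 \<le> X\<^sup>2\<close>, a suitable Gaussian mixture \<open>q\<close>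
  dominates all likelihoods up to a factor \<open>K\<close> of order \<open>X ^ l\<close>: a symbol heard directly is worth
  \<open>X\<close>, and whatever the relay adds in one of its symbols costs the source another symbol. With \<open>X\<close>
  slightly below \<open>\<rho> powr r\<close> the decoder fails, and these gains have probability
  \<open>\<rho> powr - ((1 - r) + max (1 - 2 r) 0)\<close> up to \<open>\<rho> powr \<epsilon>\<close>.

  Achievability. For Gaussian codebooks the union bound gives a conditional error probability of
  at most \<open>2 M min (P\<^sub>1 ^ - l) (P\<^sub>2 ^ - (l / 2))\<close>, where \<open>P\<^sub>1\<close> is of order \<open>1 + \<rho> |g\<^sub>1|\<^sup>2\<close> and
  \<open>P\<^sub>2\<close> of order \<open>1 + \<rho> |g\<^sub>2 b h|\<^sup>2\<close>. Since \<open>min 1 t \<le> t powr \<theta>\<close>, it is at most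
  \<open>(2 M) powr (1 / l) / P\<^sub>1\<close> and at most \<open>(2 M) powr (3 / l) / (P\<^sub>1 P\<^sub>2)\<close>. The expectations of
  \<open>1 / P\<^sub>1\<close> and \<open>1 / P\<^sub>2\<close> are of order \<open>1 / \<rho>\<close>, which gives the exponents \<open>1 - r\<close> and \<open>2 - 3 r\<close>.
\<close>

section \<open>Circularly-symmetric complex Gaussians\<close>

text \<open>The block length is fixed while \<rho> grows, and a competing AF code may be any
  ensemble, even a deterministic codebook, subject to mean energy constraints only. So the converse
  compares densities pointwise instead of using mutual information, and the energy constraints enter
  through Markov's inequality for the exponent.

  The tradeoff is max (1 - r, 2 - 3 r), so two linear exponents suffice. The powers 1 / l and 3 / l
  = 1 / l + 2 / l bring P1 and P2 to power one. Higher powers of 1 / (1 + \<rho> |g|^2) gain nothing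
  under Rayleigh fading, since |g|^2 < 1 / \<rho> already has probability of order 1 / \<rho>. At
  power one the expectation carries a logarithm, avoided by giving away a factor
  \<open>\<rho> powr e\<close>. Both P1 and P2 contain the relay noise forwarded through g2, so they
  are dependent; they are majorised by products of functions of single gains before averaging.

  The NAF protocol is brought into the same linear form as a general AF protocol, so the converse
  applies to it too and its diversity gain is an exact limit.\<close>

lemma borel_measurable_cgauss_density [measurable]: "cgauss_density s \<in> borel_measurable borel"
  unfolding cgauss_density_def by measurable

lemma cgauss_density_nonneg [simp]: "s > 0 \<Longrightarrow> cgauss_density s z \<ge> 0"
  by (simp add: cgauss_density_def)

lemma sets_cgauss [simp, measurable_cong]: "sets (cgauss s) = sets borel"
  by (simp add: cgauss_def)

lemma space_cgauss [simp]: "space (cgauss s) = UNIV"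
  by (simp add: cgauss_def)

lemma nn_integral_cgauss:
  "f \<in> borel_measurable borel \<Longrightarrow>
    (\<integral>\<^sup>+z. f z \<partial>cgauss s) = (\<integral>\<^sup>+z. ennreal (cgauss_density s z) * f z \<partial>lborel)"
  unfolding cgauss_def by (subst nn_integral_density) auto

text \<open>Polar coordinates without a Jacobian: the disc |z|^2 <= t has area pi t, linear in t,
  and half-lines determine a measure on the reals.\<close>

lemma distr_cmod_square:
  "distr lborel borel (\<lambda>z::complex. (cmod z)\<^sup>2) =
    density lborel (\<lambda>t. ennreal (pi * indicator {0..} t))" (is "?L = ?R")
proof (rule measure_eqI_generator_eq[where E = "range atMost" and \<Omega> = UNIV and A = "\<lambda>n. {..real n}"])
  show "Int_stable (range (atMost :: real \<Rightarrow> _))"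
    by (auto simp: Int_stable_def)
  have disc: "{z::complex. (cmod z)\<^sup>2 \<le> t} = cball 0 (sqrt t)" for t
    by (auto simp: real_le_rsqrt intro: sqrt_ge_absD)
  have L: "emeasure ?L {..t} = ennreal (pi * max 0 t)" for t
  proof (cases "t \<ge> 0")
    case True
    have "emeasure ?L {..t} = emeasure lborel {z::complex. (cmod z)\<^sup>2 \<le> t}"
      by (subst emeasure_distr) (auto intro!: arg_cong2[where f=emeasure])
    also have "\<dots> = ennreal (pi * t)"
      unfolding disc using True by (subst emeasure_cball) (auto simp: unit_ball_vol_2)
    finally show ?thesis using True by (simp add: max_def)
  next
    case False
    have "{z::complex. (cmod z)\<^sup>2 \<le> t} = {}"
      using False by (auto simp: not_le intro: less_le_trans)
    then have "emeasure ?L {..t} = 0"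
      by (subst emeasure_distr) (auto simp: vimage_def)
    then show ?thesis using False by (simp add: max_def)
  qed
  have R: "emeasure ?R {..t} = ennreal (pi * max 0 t)" for t
  proof -
    have "emeasure ?R {..t} = (\<integral>\<^sup>+x. ennreal pi * indicator {0..t} x \<partial>lborel)"
      by (subst emeasure_density) (auto intro!: nn_integral_cong simp: indicator_def)
    also have "\<dots> = ennreal (pi * max 0 t)"
      by (subst nn_integral_cmult_indicator) (auto simp: max_def ennreal_mult' emeasure_lborel_Icc_eq)
    finally show ?thesis .
  qed
  show "emeasure ?L X = emeasure ?R X" if "X \<in> range atMost" for X
    using that L R by auto
  show "sets ?L = sigma_sets UNIV (range atMost)" "sets ?R = sigma_sets UNIV (range atMost)"
    by (auto simp: borel_eq_atMost)
  show "(\<Union>i. {..real i}) = UNIV"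
    using real_arch_simple by auto
  show "emeasure ?L {..real i} \<noteq> \<infinity>" for i by (simp add: L)
qed auto

text \<open>For a circular Gaussian of variance \<open>s\<close>, |z|^2 is exponentially distributed
  with mean \<open>s\<close>; every rotation-invariant average below is reduced to this.\<close>

lemma nn_integral_cgauss_radial:
  assumes [measurable]: "f \<in> borel_measurable borel" and s: "s > 0"
  shows "(\<integral>\<^sup>+z. f ((cmod z)\<^sup>2) \<partial>cgauss s) =
    (\<integral>\<^sup>+t. ennreal (exp (- t / s) / s * indicator {0..} t) * f t \<partial>lborel)"
proof -
  have "(\<integral>\<^sup>+z. f ((cmod z)\<^sup>2) \<partial>cgauss s) =
      (\<integral>\<^sup>+z. ennreal (exp (- ((cmod z)\<^sup>2) / s) / (pi * s)) * f ((cmod z)\<^sup>2) \<partial>lborel)"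
    by (subst nn_integral_cgauss) (auto simp: cgauss_density_def)
  also have "\<dots> = (\<integral>\<^sup>+t. ennreal (exp (- t / s) / (pi * s)) * f t \<partial>distr lborel borel (\<lambda>z::complex. (cmod z)\<^sup>2))"
    by (subst nn_integral_distr) auto
  also have "\<dots> = (\<integral>\<^sup>+t. ennreal (pi * indicator {0..} t) * (ennreal (exp (- t / s) / (pi * s)) * f t) \<partial>lborel)"
    unfolding distr_cmod_square by (subst nn_integral_density) auto
  also have "\<dots> = (\<integral>\<^sup>+t. ennreal (exp (- t / s) / s * indicator {0..} t) * f t \<partial>lborel)"
  proof (rule nn_integral_cong)
    fix t
    have "ennreal (pi * indicator {0..} t) * ennreal (exp (- t / s) / (pi * s)) =
        ennreal (exp (- t / s) / s * indicator {0..} t)"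
      using s by (subst ennreal_mult'[symmetric]) (auto simp: field_simps indicator_def)
    then show "ennreal (pi * indicator {0..} t) * (ennreal (exp (- t / s) / (pi * s)) * f t) =
        ennreal (exp (- t / s) / s * indicator {0..} t) * f t"
      by (simp add: mult.assoc[symmetric])
  qed
  finally show ?thesis .
qed

lemma prob_space_cgauss: "s > 0 \<Longrightarrow> prob_space (cgauss s)"
proof
  assume s: "s > 0"
  have "emeasure (cgauss s) (space (cgauss s)) = (\<integral>\<^sup>+z. 1 \<partial>cgauss s)" by simp
  also have "\<dots> = (\<integral>\<^sup>+t. ennreal (exp (- t / s) / s * indicator {0..} t) * 1 \<partial>lborel)"
    using s by (subst nn_integral_cgauss_radial[where f="\<lambda>_. 1", symmetric]) auto
  also have "\<dots> = (\<integral>\<^sup>+t. exponential_density (1 / s) t \<partial>lborel)"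
    by (intro nn_integral_cong) (auto simp: exponential_density_def)
  also have "\<dots> = 1"
    using prob_space.emeasure_space_1[OF prob_space_exponential_density[of "1/s"]] s
    by (simp add: emeasure_density)
  finally show "emeasure (cgauss s) (space (cgauss s)) = 1" .
qed

lemma nn_integral_cgauss_cmod_square:
  assumes s: "s > 0"
  shows "(\<integral>\<^sup>+z. ennreal ((cmod z)\<^sup>2) \<partial>cgauss s) = ennreal s"
proof -
  have "(\<integral>\<^sup>+z. ennreal ((cmod z)\<^sup>2) \<partial>cgauss s) =
      (\<integral>\<^sup>+t. ennreal (exp (- t / s) / s * indicator {0..} t) * ennreal t \<partial>lborel)"
    using s by (subst nn_integral_cgauss_radial) auto
  also have "\<dots> = ennreal \<bar>s\<bar> * (\<integral>\<^sup>+t. ennreal (exp (- (0 + s * t) / s) / s * indicator {0..} (0 + s * t)) * ennreal (0 + s * t) \<partial>lborel)"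
    using s by (subst nn_integral_real_affine[where c = s and t = 0]) auto
  also have "\<dots> = ennreal s * (\<integral>\<^sup>+t. ennreal (t ^ 1 * exp (- t)) * indicator {0..} t \<partial>lborel)"
  proof -
    have "ennreal (exp (- (0 + s * t) / s) / s * indicator {0..} (0 + s * t)) * ennreal (0 + s * t) =
        ennreal (t ^ 1 * exp (- t)) * indicator {0..} t" for t
    proof (cases "t \<ge> 0")
      case True
      then have "exp (- (0 + s * t) / s) / s * (0 + s * t) = t ^ 1 * exp (- t)" using s by simp
      then show ?thesis using True s by (simp add: ennreal_mult'[symmetric] del: power_one_right)
    next
      case False
      then have "s * t < 0" using s by (simp add: mult_pos_neg)
      then show ?thesis using False by simp
    qed
    then show ?thesis using s by simp
  qed
  also have "\<dots> = ennreal s"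
    by (subst nn_intergal_power_times_exp_Ici) simp
  finally show ?thesis .
qed

text \<open>On [0, 1] the exponential density is at least exp (-1). This linear lower bound for the
  probability of a weak gain is what produces the powers of \<rho> in the converse.\<close>

lemma cgauss_disc_ge:
  assumes a: "0 \<le> a" "a \<le> 1"
  shows "measure (cgauss 1) {z. (cmod z)\<^sup>2 \<le> a} \<ge> exp (-1) * a"
proof -
  interpret prob_space "cgauss 1" by (rule prob_space_cgauss) simp
  have "ennreal (exp (-1) * a) = (\<integral>\<^sup>+t. ennreal (exp (-1)) * indicator {0..a} t \<partial>lborel)"
    using a by (subst nn_integral_cmult_indicator) (auto simp: ennreal_mult')
  also have "\<dots> \<le> (\<integral>\<^sup>+t. ennreal (exp (- t / 1) / 1 * indicator {0..} t) * indicator {..a} t \<partial>lborel)"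
    using a by (intro nn_integral_mono) (auto simp: indicator_def)
  also have "\<dots> = (\<integral>\<^sup>+z. indicator {..a} ((cmod z)\<^sup>2) \<partial>cgauss 1)"
    by (subst nn_integral_cgauss_radial) auto
  also have "\<dots> = (\<integral>\<^sup>+z. indicator {z. (cmod z)\<^sup>2 \<le> a} z \<partial>cgauss 1)"
    by (intro nn_integral_cong) (auto simp: indicator_def)
  also have "\<dots> = emeasure (cgauss 1) {z. (cmod z)\<^sup>2 \<le> a}"
    by (subst nn_integral_indicator) auto
  finally show ?thesis
    by (simp add: emeasure_eq_measure)
qed

lemma nn_integral_cgauss_density_shift:
  assumes s: "s > 0"
  shows "(\<integral>\<^sup>+z. ennreal (cgauss_density s (z - \<mu>)) \<partial>lborel) = 1"
proof -
  have "(\<integral>\<^sup>+z. ennreal (cgauss_density s (z - \<mu>)) \<partial>lborel) =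
      (\<integral>\<^sup>+z. ennreal (cgauss_density s z) \<partial>distr lborel borel (\<lambda>z. - \<mu> + z))"
    by (subst nn_integral_distr) (auto simp: add.commute)
  also have "\<dots> = (\<integral>\<^sup>+z. 1 \<partial>cgauss s)"
    by (subst lborel_distr_plus, subst nn_integral_cgauss) auto
  also have "\<dots> = 1"
    using prob_space.emeasure_space_1[OF prob_space_cgauss[OF s]] by simp
  finally show ?thesis .
qed

text \<open>Re (a z) is a real centred Gaussian of variance |a|^2 s / 2, whence the 4. The proof
  completes the square, which shifts the mean by \<open>s / 2\<close> times the conjugate of
  \<open>a\<close>.\<close>

lemma cgauss_mgf:
  assumes s: "s > 0"
  shows "(\<integral>\<^sup>+z. ennreal (exp (Re (a * z))) \<partial>cgauss s) = ennreal (exp ((cmod a)\<^sup>2 * s / 4))"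
proof -
  have "cgauss_density s z * exp (Re (a * z)) =
      exp ((cmod a)\<^sup>2 * s / 4) * cgauss_density s (z - of_real (s / 2) * cnj a)" for z
  proof -
    have "(cmod (z - of_real (s / 2) * cnj a))\<^sup>2 = (cmod z)\<^sup>2 - s * Re (a * z) + s * s * (cmod a)\<^sup>2 / 4"
    proof -
      have "(cmod (z - w))\<^sup>2 = (cmod z)\<^sup>2 - 2 * Re (z * cnj w) + (cmod w)\<^sup>2" for w
        by (simp only: cmod_power2 minus_complex.sel times_complex.sel cnj.sel) algebra
      from this[of "of_real (s / 2) * cnj a"] show ?thesis
        using s by (simp add: norm_mult power_mult_distrib power2_eq_square algebra_simps diff_divide_distrib)
    qed
    moreover have "- A / s + R = B * s / 4 + - Q / s" if "Q = A - s * R + s * s * B / 4" for A B Q R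
      unfolding that using s by (simp add: field_simps)
    ultimately have "- (cmod z)\<^sup>2 / s + Re (a * z) = (cmod a)\<^sup>2 * s / 4 + - (cmod (z - of_real (s / 2) * cnj a))\<^sup>2 / s"
      by blast
    then show ?thesis by (simp add: cgauss_density_def exp_add[symmetric])
  qed
  then have "(\<integral>\<^sup>+z. ennreal (exp (Re (a * z))) \<partial>cgauss s) =
     (\<integral>\<^sup>+z. ennreal (exp ((cmod a)\<^sup>2 * s / 4)) * ennreal (cgauss_density s (z - of_real (s / 2) * cnj a)) \<partial>lborel)"
    using s by (subst nn_integral_cgauss) (auto simp: ennreal_mult'[symmetric])
  also have "\<dots> = ennreal (exp ((cmod a)\<^sup>2 * s / 4))"
    using s by (subst nn_integral_cmult) (auto simp: nn_integral_cgauss_density_shift)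
  finally show ?thesis .
qed

text \<open>Completing the square leaves a further factor exp (- c |\<beta>|^2 / D), which is
  dropped: the bound has to be uniform in \<beta>, because \<beta> will stand for the other symbols
  and the competing codeword.\<close>

lemma cgauss_exp_square_le:
  assumes E: "E > 0" and c: "c \<ge> 0"
  shows "(\<integral>\<^sup>+z. ennreal (exp (- c * (cmod (\<alpha> * z + \<beta>))\<^sup>2)) \<partial>cgauss E) \<le>
    ennreal (1 / (1 + c * (cmod \<alpha>)\<^sup>2 * E))"
proof -
  define D where "D = 1 + c * (cmod \<alpha>)\<^sup>2 * E"
  have D: "D \<ge> 1" unfolding D_def using E c by simp
  \<comment> \<open>Variance and mean of the Gaussian left after completing the square; the inverse
    variance is 1 / E + c |\<alpha>|^2.\<close>
  define s where "s = E / D"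
  have s: "s > 0" using E D by (simp add: s_def)
  define \<mu> where "\<mu> = - of_real (s * c) * cnj \<alpha> * \<beta>"
  have le: "cgauss_density E z * exp (- c * (cmod (\<alpha> * z + \<beta>))\<^sup>2) \<le> 1 / D * cgauss_density s (z - \<mu>)" for z
  proof -
    have eq: "(cmod z)\<^sup>2 / E + c * (cmod (\<alpha> * z + \<beta>))\<^sup>2 =
        (cmod (z - \<mu>))\<^sup>2 / s + c * (cmod \<beta>)\<^sup>2 * (1 / D)"
    proof -
      have 1: "(cmod (z - \<mu>))\<^sup>2 = (cmod z)\<^sup>2 + 2 * (s * c) * Re (\<alpha> * z * cnj \<beta>) + (s * c)\<^sup>2 * (cmod \<alpha>)\<^sup>2 * (cmod \<beta>)\<^sup>2"
        unfolding \<mu>_def by (simp add: cmod_power2) algebra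
      have 2: "(cmod (\<alpha> * z + \<beta>))\<^sup>2 = (cmod \<alpha>)\<^sup>2 * (cmod z)\<^sup>2 + 2 * Re (\<alpha> * z * cnj \<beta>) + (cmod \<beta>)\<^sup>2"
        by (simp add: cmod_power2) algebra
      have 3: "s * D = E" using D by (simp add: s_def)
      have 4: "(cmod z)\<^sup>2 / E = (cmod z)\<^sup>2 / s - (cmod z)\<^sup>2 * c * (cmod \<alpha>)\<^sup>2"
        using E D by (simp add: s_def field_simps) (simp add: D_def field_simps)
      have 5: "s * c * (cmod \<alpha>)\<^sup>2 = 1 - 1 / D"
        using D E by (simp add: s_def field_simps) (simp add: D_def field_simps)
      have "(cmod (z - \<mu>))\<^sup>2 / s = (cmod z)\<^sup>2 / s + 2 * c * Re (\<alpha> * z * cnj \<beta>) + c * (cmod \<beta>)\<^sup>2 * (s * c * (cmod \<alpha>)\<^sup>2)"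
        unfolding 1 using s by (simp add: field_simps power2_eq_square)
      then show ?thesis unfolding 2 4 5 by (simp add: algebra_simps)
    qed
    have "cgauss_density E z * exp (- c * (cmod (\<alpha> * z + \<beta>))\<^sup>2) =
        exp (- ((cmod z)\<^sup>2 / E + c * (cmod (\<alpha> * z + \<beta>))\<^sup>2)) / (pi * E)"
      by (simp add: cgauss_density_def exp_add[symmetric] algebra_simps)
    also have "\<dots> \<le> exp (- ((cmod (z - \<mu>))\<^sup>2 / s)) / (pi * E)"
      unfolding eq using E c D by (intro divide_right_mono) auto
    also have "\<dots> = 1 / D * cgauss_density s (z - \<mu>)"
      using D E by (simp add: cgauss_density_def s_def)
    finally show ?thesis .
  qed
  have "(\<integral>\<^sup>+z. ennreal (exp (- c * (cmod (\<alpha> * z + \<beta>))\<^sup>2)) \<partial>cgauss E) =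
      (\<integral>\<^sup>+z. ennreal (cgauss_density E z * exp (- c * (cmod (\<alpha> * z + \<beta>))\<^sup>2)) \<partial>lborel)"
    using E by (subst nn_integral_cgauss) (auto simp: ennreal_mult')
  also have "\<dots> \<le> (\<integral>\<^sup>+z. ennreal (1 / D) * ennreal (cgauss_density s (z - \<mu>)) \<partial>lborel)"
    using le D s by (intro nn_integral_mono) (auto simp: ennreal_mult'[symmetric] intro!: ennreal_leI)
  also have "\<dots> = ennreal (1 / D)"
    using s by (subst nn_integral_cmult) (auto simp: nn_integral_cgauss_density_shift)
  finally show ?thesis by (simp add: D_def)
qed

text \<open>A majorant in a single gain. The power \<open>e - 1\<close> comes from the decay in
  \<rho>; the squared polynomial absorbs the amplified relay noise and the reciprocal of the
  repetition gain. At 0 the value must be infinite, because \<open>0 powr x = 0\<close> would make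
  the later error bounds false at a vanishing gain.\<close>

definition cgauss_weight :: "real \<Rightarrow> real \<Rightarrow> complex \<Rightarrow> ennreal" where
  "cgauss_weight e c z =
     (if z = 0 then \<infinity> else ennreal ((1 + c * (cmod z)\<^sup>2)\<^sup>2 * ((cmod z)\<^sup>2) powr (e - 1)))"

lemma borel_measurable_cgauss_weight [measurable]: "cgauss_weight e c \<in> borel_measurable borel"
  unfolding cgauss_weight_def by measurable

text \<open>In the variable t = |z|^2 only Gamma integrals remain; \<open>e > 0\<close> makes the
  singularity of t^(e - 1) at 0 integrable.\<close>

lemma nn_integral_cgauss_weight_finite:
  assumes e: "e > 0" and c: "c \<ge> 0"
  shows "(\<integral>\<^sup>+z. cgauss_weight e c z \<partial>cgauss 1) < \<infinity>"
proof -
  let ?g = "\<lambda>t::real. if t = 0 then \<infinity> else ennreal ((1 + c * t)\<^sup>2 * t powr (e - 1))"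
  let ?G = "\<lambda>x t. ennreal (indicator {0..} t * t powr (x - 1) / exp t)"
  have "(\<integral>\<^sup>+z. cgauss_weight e c z \<partial>cgauss 1) = (\<integral>\<^sup>+z. ?g ((cmod z)\<^sup>2) \<partial>cgauss 1)"
    by (simp add: cgauss_weight_def)
  also have "\<dots> = (\<integral>\<^sup>+t. ennreal (exp (- t / 1) / 1 * indicator {0..} t) * ?g t \<partial>lborel)"
    by (subst nn_integral_cgauss_radial) auto
  also have "\<dots> \<le> (\<integral>\<^sup>+t. 2 * ?G e t + ennreal (2 * c\<^sup>2) * ?G (e + 2) t \<partial>lborel)"
  \<comment> \<open>The point t = 0, where the weight is infinite, is a null set.\<close>
  proof (rule nn_integral_mono_AE)
    show "AE t in lborel. ennreal (exp (- t / 1) / 1 * indicator {0..} t) * ?g t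
        \<le> 2 * ?G e t + ennreal (2 * c\<^sup>2) * ?G (e + 2) t"
      using AE_lborel_singleton[of "0::real"]
    proof eventually_elim
      case (elim t)
      show ?case
      proof (cases "t > 0")
        case True
        have "(1 + c * t)\<^sup>2 \<le> 2 + 2 * c\<^sup>2 * t\<^sup>2"
          using sum_squares_bound[of 1 "c * t"] by (simp add: power2_sum power_mult_distrib)
        then have "exp (- t) * ((1 + c * t)\<^sup>2 * t powr (e - 1)) \<le> exp (- t) * ((2 + 2 * c\<^sup>2 * t\<^sup>2) * t powr (e - 1))"
          by (intro mult_left_mono mult_right_mono) auto
        also have "\<dots> = 2 * (t powr (e - 1) / exp t) + 2 * c\<^sup>2 * (t powr (e + 2 - 1) / exp t)"
        proof -
          have "t powr (e + 2 - 1) = t\<^sup>2 * t powr (e - 1)"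
            using True by (simp add: powr_add[symmetric] powr_numeral[symmetric] add_ac del: powr_numeral)
          then show ?thesis by (simp add: exp_minus field_simps)
        qed
        finally have *: "exp (- t) * ((1 + c * t)\<^sup>2 * t powr (e - 1)) \<le> \<dots>" .
        have "ennreal (exp (- t / 1) / 1 * indicator {0..} t) * ?g t =
           ennreal (exp (- t) * ((1 + c * t)\<^sup>2 * t powr (e - 1)))"
          using True by (simp add: ennreal_mult')
        also have "\<dots> \<le> ennreal (2 * (t powr (e - 1) / exp t) + 2 * c\<^sup>2 * (t powr (e + 2 - 1) / exp t))"
          using * by (rule ennreal_leI)
        also have "\<dots> = 2 * ?G e t + ennreal (2 * c\<^sup>2) * ?G (e + 2) t"
        proof -
          have "ennreal (2 * A + 2 * c\<^sup>2 * B) = 2 * ennreal A + ennreal (2 * c\<^sup>2) * ennreal B"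
            if "A \<ge> 0" "B \<ge> 0" for A B :: real
            using that by (simp add: ennreal_plus ennreal_mult' ennreal_mult'' mult.assoc)
          from this[of "t powr (e - 1) / exp t" "t powr (e + 2 - 1) / exp t"] show ?thesis
            using True by (simp only: indicator_simps atLeast_iff less_imp_le) simp
        qed
        finally show ?thesis .
      qed (use elim in auto)
    qed
  qed
  also have "\<dots> = 2 * ennreal (Gamma e) + ennreal (2 * c\<^sup>2) * ennreal (Gamma (e + 2))"
    using e by (subst nn_integral_add)
      (auto simp: nn_integral_cmult Gamma_conv_nn_integral_real)
  also have "\<dots> < \<infinity>"
    by (simp add: ennreal_mult_less_top ennreal_numeral_less_top)
  finally show ?thesis .
qed

definition weight_integral :: "real \<Rightarrow> real \<Rightarrow> real" where
  "weight_integral e c = enn2real (\<integral>\<^sup>+z. cgauss_weight e c z \<partial>cgauss 1)"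

section \<open>Products of Gaussians and measurability\<close>

lemma product_sigma_finite_lborel: "product_sigma_finite (\<lambda>_. lborel :: complex measure)"
  by standard

lemma product_prob_space_cgauss: "s > 0 \<Longrightarrow> product_prob_space (\<lambda>_. cgauss s)"
  by (intro product_prob_spaceI prob_space_cgauss)

lemma product_sigma_finite_cgauss: "s > 0 \<Longrightarrow> product_sigma_finite (\<lambda>_. cgauss s)"
  using product_prob_space_cgauss product_prob_space.axioms(1) by blast

lemma prob_space_PiM_cgauss: "s > 0 \<Longrightarrow> prob_space (PiM I (\<lambda>_. cgauss s))"
  by (intro prob_space_PiM prob_space_cgauss)

lemma prob_space_cgauss_vec: "s > 0 \<Longrightarrow> prob_space (cgauss_vec n s)"
  unfolding cgauss_vec_def by (rule prob_space_PiM_cgauss)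

lemma sets_cgauss_vec [simp, measurable_cong]:
  "sets (cgauss_vec n s) = sets (PiM {..<n} (\<lambda>_. borel))"
  unfolding cgauss_vec_def by (intro sets_PiM_cong) auto

lemma PiM_cgauss_eq_density:
  assumes I: "finite I" and s: "s > 0"
  shows "PiM I (\<lambda>_. cgauss s) =
    density (PiM I (\<lambda>_. lborel)) (\<lambda>v. \<Prod>i\<in>I. ennreal (cgauss_density s (v i)))" (is "_ = ?R")
proof (rule sym, rule product_sigma_finite.PiM_eqI[OF product_sigma_finite_cgauss[OF s] I])
  show "sets ?R = sets (PiM I (\<lambda>_. cgauss s))"
    by (auto intro!: sets_PiM_cong)
next
  fix A assume A: "\<And>i. i \<in> I \<Longrightarrow> A i \<in> sets (cgauss s)"
  then have A': "i \<in> I \<Longrightarrow> A i \<in> sets borel" for i by simp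
  have "emeasure ?R (Pi\<^sub>E I A) =
      (\<integral>\<^sup>+v. (\<Prod>i\<in>I. ennreal (cgauss_density s (v i))) * indicator (Pi\<^sub>E I A) v \<partial>PiM I (\<lambda>_. lborel))"
    using A' I by (subst emeasure_density) (auto intro!: sets_PiM_I_finite)
  also have "\<dots> = (\<integral>\<^sup>+v. (\<Prod>i\<in>I. ennreal (cgauss_density s (v i)) * indicator (A i) (v i)) \<partial>PiM I (\<lambda>_. lborel))"
  proof (rule nn_integral_cong)
    fix v assume v: "v \<in> space (PiM I (\<lambda>_. lborel :: complex measure))"
    have "indicator (Pi\<^sub>E I A) v = (\<Prod>i\<in>I. indicator (A i) (v i) :: ennreal)"
    proof (cases "v \<in> Pi\<^sub>E I A")
      case True
      then show ?thesis by (auto simp: indicator_def PiE_iff intro!: prod.neutral[symmetric])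
    next
      case False
      then obtain i where "i \<in> I" "v i \<notin> A i" using v by (auto simp: space_PiM PiE_iff)
      then show ?thesis using False I by (auto intro!: bexI[of _ i])
    qed
    then show "(\<Prod>i\<in>I. ennreal (cgauss_density s (v i))) * indicator (Pi\<^sub>E I A) v =
        (\<Prod>i\<in>I. ennreal (cgauss_density s (v i)) * indicator (A i) (v i))"
      by (simp add: prod.distrib)
  qed
  also have "\<dots> = (\<Prod>i\<in>I. \<integral>\<^sup>+z. ennreal (cgauss_density s z) * indicator (A i) z \<partial>lborel)"
    using I A' by (subst product_sigma_finite.product_nn_integral_prod[OF product_sigma_finite_lborel]) auto
  also have "\<dots> = (\<Prod>i\<in>I. emeasure (cgauss s) (A i))"
    using A' by (intro prod.cong refl) (auto simp: cgauss_def emeasure_density)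
  finally show "emeasure ?R (Pi\<^sub>E I A) = (\<Prod>i\<in>I. emeasure (cgauss s) (A i))" .
qed

lemma nn_integral_PiM_cgauss:
  assumes I: "finite I" and s: "s > 0" and f: "f \<in> borel_measurable (PiM I (\<lambda>_. borel))"
  shows "(\<integral>\<^sup>+v. f v \<partial>PiM I (\<lambda>_. cgauss s)) =
    (\<integral>\<^sup>+v. (\<Prod>i\<in>I. ennreal (cgauss_density s (v i))) * f v \<partial>PiM I (\<lambda>_. lborel))"
proof -
  have [measurable]: "f \<in> borel_measurable (PiM I (\<lambda>_. lborel))"
    using f by (simp cong: measurable_cong_sets sets_PiM_cong)
  show ?thesis
    unfolding PiM_cgauss_eq_density[OF I s] by (subst nn_integral_density) auto
qed

text \<open>Translation invariance, used to pass from the noise \<open>v\<close> to the observation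
  \<open>\<mu> + v\<close>.\<close>

lemma nn_integral_PiM_lborel_shift:
  fixes \<mu> :: "'i \<Rightarrow> complex"
  assumes I: "finite I" and f: "f \<in> borel_measurable (PiM I (\<lambda>_. borel))"
  shows "(\<integral>\<^sup>+v. f (\<lambda>i\<in>I. \<mu> i + v i) \<partial>PiM I (\<lambda>_. lborel)) = (\<integral>\<^sup>+v. f v \<partial>PiM I (\<lambda>_. lborel))"
proof -
  let ?L = "PiM I (\<lambda>_. lborel :: complex measure)"
  let ?T = "\<lambda>v. \<lambda>i\<in>I. \<mu> i + v i"
  have T [measurable]: "?T \<in> ?L \<rightarrow>\<^sub>M ?L"
    by (rule measurable_restrict) auto
  have eq: "distr ?L ?L ?T = ?L"
  proof (rule product_sigma_finite.PiM_eqI[OF product_sigma_finite_lborel I])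
    fix A :: "'i \<Rightarrow> complex set" assume A: "\<And>i. i \<in> I \<Longrightarrow> A i \<in> sets lborel"
    have "emeasure (distr ?L ?L ?T) (Pi\<^sub>E I A) = emeasure ?L (?T -` Pi\<^sub>E I A \<inter> space ?L)"
      using A I by (subst emeasure_distr) (auto intro!: sets_PiM_I_finite)
    also have "?T -` Pi\<^sub>E I A \<inter> space ?L = (\<Pi>\<^sub>E i\<in>I. (\<lambda>z. \<mu> i + z) -` A i)"
      by (auto simp: space_PiM PiE_iff)
    also have "emeasure ?L \<dots> = (\<Prod>i\<in>I. emeasure lborel ((\<lambda>z. \<mu> i + z) -` A i))"
      using A I by (subst product_sigma_finite.emeasure_PiM[OF product_sigma_finite_lborel])
        (auto intro!: measurable_sets_borel[of _ borel])
    also have "\<dots> = (\<Prod>i\<in>I. emeasure lborel (A i))"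
    proof (intro prod.cong refl)
      fix i assume "i \<in> I"
      with A have "A i \<in> sets borel" by simp
      then have "emeasure (distr lborel borel ((+) (\<mu> i))) (A i) = emeasure lborel ((\<lambda>z. \<mu> i + z) -` A i)"
        by (subst emeasure_distr) auto
      then show "emeasure lborel ((\<lambda>z. \<mu> i + z) -` A i) = emeasure lborel (A i)"
        by (simp add: lborel_distr_plus)
    qed
    finally show "emeasure (distr ?L ?L ?T) (Pi\<^sub>E I A) = (\<Prod>i\<in>I. emeasure lborel (A i))" .
  qed simp
  have [measurable]: "f \<in> borel_measurable ?L"
    using f by (simp cong: measurable_cong_sets sets_PiM_cong)
  have "(\<integral>\<^sup>+v. f (?T v) \<partial>?L) = (\<integral>\<^sup>+v. f v \<partial>distr ?L ?L ?T)"
    by (subst nn_integral_distr) auto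
  then show ?thesis by (simp add: eq)
qed

lemma nn_integral_PiM_component_cgauss:
  assumes "i \<in> I" "s > 0" and [measurable]: "f \<in> borel_measurable borel"
  shows "(\<integral>\<^sup>+v. f (v i) \<partial>PiM I (\<lambda>_. cgauss s)) = (\<integral>\<^sup>+z. f z \<partial>cgauss s)"
proof -
  have "(\<integral>\<^sup>+z. f z \<partial>distr (PiM I (\<lambda>_. cgauss s)) (cgauss s) (\<lambda>v. v i)) = (\<integral>\<^sup>+v. f (v i) \<partial>PiM I (\<lambda>_. cgauss s))"
    using assms(1) by (subst nn_integral_distr) auto
  then show ?thesis
    using assms by (subst (asm) distr_PiM_component) (auto intro: prob_space_cgauss)
qed

text \<open>Measurability cannot be neglected: the Bochner integral in \<open>error_probability\<close> is 0 for a
  non-measurable integrand, which would count as infinite diversity.\<close>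

definition measurable_scheme :: "nat \<Rightarrow> nat \<Rightarrow> (complex \<Rightarrow> complex \<Rightarrow> complex \<Rightarrow> scheme) \<Rightarrow> bool" where
  "measurable_scheme l n F \<longleftrightarrow> (\<forall>i<l. (\<lambda>((g1, g2, h), x, w). F g1 g2 h x w i) \<in> borel_measurable
     ((borel \<Otimes>\<^sub>M borel \<Otimes>\<^sub>M borel) \<Otimes>\<^sub>M (PiM {..<l} (\<lambda>_. borel) \<Otimes>\<^sub>M PiM {..<n} (\<lambda>_. borel))))"

abbreviation gain_space :: "(complex \<times> complex \<times> complex) measure" where
  "gain_space \<equiv> borel \<Otimes>\<^sub>M borel \<Otimes>\<^sub>M borel"

abbreviation gains :: "(complex \<times> complex \<times> complex) measure" where
  "gains \<equiv> cgauss 1 \<Otimes>\<^sub>M cgauss 1 \<Otimes>\<^sub>M cgauss 1"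

abbreviation at_gains :: "(complex \<Rightarrow> complex \<Rightarrow> complex \<Rightarrow> scheme) \<Rightarrow> complex \<times> complex \<times> complex \<Rightarrow> scheme" where
  "at_gains F g \<equiv> F (fst g) (fst (snd g)) (snd (snd g))"

section \<open>Measurability of likelihoods and of the decoder\<close>

lemma measurable_scheme_compose:
  assumes F: "measurable_scheme l n F" and i: "i < l"
    and g: "g \<in> N \<rightarrow>\<^sub>M gain_space" and x: "x \<in> N \<rightarrow>\<^sub>M PiM {..<l} (\<lambda>_. borel)"
    and w: "w \<in> N \<rightarrow>\<^sub>M PiM {..<n} (\<lambda>_. borel)"
  shows "(\<lambda>\<omega>. at_gains F (g \<omega>) (x \<omega>) (w \<omega>) i) \<in> borel_measurable N"
proof -
  have "(\<lambda>\<omega>. (\<lambda>((g1, g2, h), x, w). F g1 g2 h x w i) (g \<omega>, x \<omega>, w \<omega>)) \<in> borel_measurable N"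
    using F i by (intro measurable_compose[OF _ F[unfolded measurable_scheme_def, rule_format, OF i]] measurable_Pair g x w)
  then show ?thesis by (simp add: case_prod_beta)
qed

lemma borel_measurable_likelihood:
  assumes F: "measurable_scheme l n F" and s: "sw2 > 0"
    and g [measurable]: "g \<in> N \<rightarrow>\<^sub>M gain_space" and x [measurable]: "x \<in> N \<rightarrow>\<^sub>M PiM {..<l} (\<lambda>_. borel)"
    and y [measurable]: "\<And>i. i < l \<Longrightarrow> (\<lambda>\<omega>. y \<omega> i) \<in> borel_measurable N"
  shows "(\<lambda>\<omega>. likelihood sv2 sw2 l n (at_gains F (g \<omega>)) (x \<omega>) (y \<omega>)) \<in> borel_measurable N"
proof -
  interpret prob_space "cgauss_vec n sw2" using s by (rule prob_space_cgauss_vec)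
  have [measurable]: "(\<lambda>\<omega>. at_gains F (g (fst \<omega>)) (x (fst \<omega>)) (snd \<omega>) i)
      \<in> borel_measurable (N \<Otimes>\<^sub>M cgauss_vec n sw2)" if "i < l" for i
    by (intro measurable_scheme_compose[OF F that]) auto
  have "(\<lambda>\<omega>. \<Prod>i<l. cgauss_density sv2 (y (fst \<omega>) i - at_gains F (g (fst \<omega>)) (x (fst \<omega>)) (snd \<omega>) i))
      \<in> borel_measurable (N \<Otimes>\<^sub>M cgauss_vec n sw2)"
  proof (intro borel_measurable_prod measurable_compose[OF _ borel_measurable_cgauss_density] borel_measurable_diff)
    show "(\<lambda>\<omega>. y (fst \<omega>) i) \<in> borel_measurable (N \<Otimes>\<^sub>M cgauss_vec n sw2)" if "i \<in> {..<l}" for i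
      using that by (intro measurable_compose[OF measurable_fst y]) auto
  qed auto
  then show ?thesis
    unfolding likelihood_def by (intro borel_measurable_lebesgue_integral) (simp add: case_prod_beta)
qed

lemma measurable_codeword:
  "m < M \<Longrightarrow> (\<lambda>c. c m) \<in> codebook_space M l \<rightarrow>\<^sub>M PiM {..<l} (\<lambda>_. borel)"
  unfolding codebook_space_def by (rule measurable_component_singleton) simp

lemma measurable_ml_decode:
  assumes F: "measurable_scheme l n F" and s: "sw2 > 0"
    and g: "g \<in> N \<rightarrow>\<^sub>M gain_space" and c: "c \<in> N \<rightarrow>\<^sub>M codebook_space M l"
    and y: "\<And>i. i < l \<Longrightarrow> (\<lambda>\<omega>. y \<omega> i) \<in> borel_measurable N"
  shows "(\<lambda>\<omega>. ml_decode sv2 sw2 l n (at_gains F (g \<omega>)) M (c \<omega>) (y \<omega>)) \<in> N \<rightarrow>\<^sub>M count_space UNIV"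
  unfolding ml_decode_def
proof (rule measurable_Least)
  fix m
  have L: "(\<lambda>\<omega>. likelihood sv2 sw2 l n (at_gains F (g \<omega>)) (c \<omega> k) (y \<omega>)) \<in> borel_measurable N"
    if "k < M" for k
    using that by (intro borel_measurable_likelihood F s g y measurable_compose[OF c measurable_codeword])
  show "Measurable.pred N (\<lambda>\<omega>. m < M \<and> (\<forall>m'<M. likelihood sv2 sw2 l n (at_gains F (g \<omega>)) (c \<omega> m') (y \<omega>)
      \<le> likelihood sv2 sw2 l n (at_gains F (g \<omega>)) (c \<omega> m) (y \<omega>)))"
  proof (cases "m < M")
    case True
    have "{\<omega> \<in> space N. \<forall>m'\<in>{..<M}. likelihood sv2 sw2 l n (at_gains F (g \<omega>)) (c \<omega> m') (y \<omega>)
      \<le> likelihood sv2 sw2 l n (at_gains F (g \<omega>)) (c \<omega> m) (y \<omega>)} \<in> sets N"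
    proof (rule sets.sets_Collect_finite_All)
      show "{\<omega> \<in> space N. likelihood sv2 sw2 l n (at_gains F (g \<omega>)) (c \<omega> k) (y \<omega>)
          \<le> likelihood sv2 sw2 l n (at_gains F (g \<omega>)) (c \<omega> m) (y \<omega>)} \<in> sets N" if "k \<in> {..<M}" for k
        by (rule borel_measurable_le[OF L L]) (use that True in simp_all)
    qed simp
    then show ?thesis using True unfolding pred_def Ball_def lessThan_iff by (simp only: simp_thms)
  qed simp
qed

text \<open>Allows an observation to be replaced by its restriction to \<open>{..<l}\<close>; only
  restricted functions are points of the product space.\<close>

lemma ml_decode_cong:
  assumes "\<And>i. i < l \<Longrightarrow> y i = y' i"
  shows "ml_decode sv2 sw2 l n F M c y = ml_decode sv2 sw2 l n F M c y'"
proof -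
  have "likelihood sv2 sw2 l n F x y = likelihood sv2 sw2 l n F x y'" for x
    unfolding likelihood_def using assms by (intro Bochner_Integration.integral_cong refl prod.cong) auto
  then show ?thesis unfolding ml_decode_def by simp
qed

lemma ml_decode_less: "M > 0 \<Longrightarrow> ml_decode sv2 sw2 l n F M c y < M"
  and likelihood_le_ml_decode: "m < M \<Longrightarrow>
    likelihood sv2 sw2 l n F (c m) y \<le> likelihood sv2 sw2 l n F (c (ml_decode sv2 sw2 l n F M c y)) y"
proof -
  let ?L = "\<lambda>m. likelihood sv2 sw2 l n F (c m) y"
  have *: "ml_decode sv2 sw2 l n F M c y < M \<and> (\<forall>m'<M. ?L m' \<le> ?L (ml_decode sv2 sw2 l n F M c y))"
    if "M > 0"
  proof -
    have "finite (?L ` {..<M})" "?L ` {..<M} \<noteq> {}" using that by auto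
    from Max_in[OF this] obtain m where "m < M" "?L m = Max (?L ` {..<M})" by auto
    then have "m < M \<and> (\<forall>m'<M. ?L m' \<le> ?L m)" by simp
    then show ?thesis unfolding ml_decode_def by (rule LeastI)
  qed
  show "M > 0 \<Longrightarrow> ml_decode sv2 sw2 l n F M c y < M" using * by blast
  show "m < M \<Longrightarrow> ?L m \<le> ?L (ml_decode sv2 sw2 l n F M c y)" using * by fastforce
qed

text \<open>The probability, when message \<open>m\<close> is sent, that the decoded message lies in
  \<open>A\<close>. It is an iterated integral with the relay noise outside, so that one can argue
  for each fixed \<open>w\<close>.\<close>

definition decides :: "real \<Rightarrow> real \<Rightarrow> nat \<Rightarrow> nat \<Rightarrow> scheme \<Rightarrow> nat \<Rightarrow> codebook \<Rightarrow> nat \<Rightarrow> nat set \<Rightarrow> ennreal" where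
  "decides sv2 sw2 l n F M c m A =
     (\<integral>\<^sup>+w. (\<integral>\<^sup>+v. indicator A (ml_decode sv2 sw2 l n F M c (\<lambda>i. F (c m) w i + v i))
        \<partial>cgauss_vec l sv2) \<partial>cgauss_vec n sw2)"

lemma measurable_ml_decode_observation:
  assumes F: "measurable_scheme l n F" and s: "sw2 > 0" and m: "m < M"
  shows "(\<lambda>((c, g), w, v). ml_decode sv2 sw2 l n (at_gains F g) M c (\<lambda>i. at_gains F g (c m) w i + v i))
    \<in> ((codebook_space M l \<Otimes>\<^sub>M gain_space) \<Otimes>\<^sub>M (PiM {..<n} (\<lambda>_. borel) \<Otimes>\<^sub>M PiM {..<l} (\<lambda>_. borel)))
      \<rightarrow>\<^sub>M count_space UNIV"
proof -
  let ?N = "(codebook_space M l \<Otimes>\<^sub>M gain_space) \<Otimes>\<^sub>M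
    ((PiM {..<n} (\<lambda>_. borel) :: (nat \<Rightarrow> complex) measure) \<Otimes>\<^sub>M (PiM {..<l} (\<lambda>_. borel) :: (nat \<Rightarrow> complex) measure))"
  have 1: "(\<lambda>\<omega>. at_gains F (snd (fst \<omega>)) (fst (fst \<omega>) m) (fst (snd \<omega>)) i) \<in> borel_measurable ?N" if "i < l" for i
    by (rule measurable_scheme_compose[OF F that]) (auto intro!: measurable_compose[OF _ measurable_codeword[OF m]])
  have 2: "(\<lambda>\<omega>. snd (snd \<omega>) i) \<in> borel_measurable ?N" if "i < l" for i
  proof -
    have "(\<lambda>\<omega>. snd (snd \<omega>)) \<in> ?N \<rightarrow>\<^sub>M PiM {..<l} (\<lambda>_. borel)" by measurable
    from measurable_compose[OF this measurable_component_singleton[of i]] that show ?thesis by simp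
  qed
  have "(\<lambda>\<omega>. ml_decode sv2 sw2 l n (at_gains F (snd (fst \<omega>))) M (fst (fst \<omega>))
      (\<lambda>i. at_gains F (snd (fst \<omega>)) (fst (fst \<omega>) m) (fst (snd \<omega>)) i + snd (snd \<omega>) i)) \<in> ?N \<rightarrow>\<^sub>M count_space UNIV"
    by (rule measurable_ml_decode[OF F s]) (auto intro!: borel_measurable_add 1 2)
  then show ?thesis by (simp add: case_prod_beta')
qed

lemma prob_space_noise:
  assumes "sv2 > 0" "sw2 > 0"
  shows "prob_space (cgauss_vec n sw2 \<Otimes>\<^sub>M cgauss_vec l sv2)"
  using assms by (intro prob_space_pair prob_space_cgauss_vec)

lemma prob_space_gains: "prob_space gains"
  by (intro prob_space_pair prob_space_cgauss) auto

lemma sets_gains [measurable_cong]: "sets gains = sets gain_space"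
  by (intro sets_pair_measure_cong) auto

lemma measurable_ml_decode_fixed:
  assumes F: "measurable_scheme l n F" and s: "sw2 > 0" and m: "m < M"
    and c: "c \<in> space (codebook_space M l)"
  shows "(\<lambda>(w, v). ml_decode sv2 sw2 l n (at_gains F g) M c (\<lambda>i. at_gains F g (c m) w i + v i))
    \<in> (PiM {..<n} (\<lambda>_. borel) \<Otimes>\<^sub>M PiM {..<l} (\<lambda>_. borel)) \<rightarrow>\<^sub>M count_space UNIV"
proof -
  have "(\<lambda>\<omega>. ((c, g), \<omega>)) \<in> (PiM {..<n} (\<lambda>_. borel) \<Otimes>\<^sub>M PiM {..<l} (\<lambda>_. borel)) \<rightarrow>\<^sub>M
     ((codebook_space M l \<Otimes>\<^sub>M gain_space) \<Otimes>\<^sub>M (PiM {..<n} (\<lambda>_. borel) \<Otimes>\<^sub>M PiM {..<l} (\<lambda>_. borel)))"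
    using c by (intro measurable_Pair measurable_const measurable_ident_sets)
      (auto simp: space_pair_measure)
  from measurable_compose[OF this measurable_ml_decode_observation[OF F s m]]
  show ?thesis by (simp add: case_prod_beta')
qed

lemma emeasure_decides:
  assumes F: "measurable_scheme l n F" and s: "sv2 > 0" "sw2 > 0" and m: "m < M"
    and c: "c \<in> space (codebook_space M l)"
  shows "emeasure (cgauss_vec n sw2 \<Otimes>\<^sub>M cgauss_vec l sv2)
      {(w, v) \<in> space (cgauss_vec n sw2 \<Otimes>\<^sub>M cgauss_vec l sv2).
         ml_decode sv2 sw2 l n (at_gains F g) M c (\<lambda>i. at_gains F g (c m) w i + v i) \<in> A} =
    decides sv2 sw2 l n (at_gains F g) M c m A" (is "emeasure ?N ?S = _")
proof -
  interpret V: prob_space "cgauss_vec l sv2" using s by (intro prob_space_cgauss_vec)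
  let ?d = "\<lambda>(w, v). ml_decode sv2 sw2 l n (at_gains F g) M c (\<lambda>i. at_gains F g (c m) w i + v i)"
  have [measurable]: "?d \<in> ?N \<rightarrow>\<^sub>M count_space UNIV"
    using measurable_ml_decode_fixed[OF F s(2) m c]
    by (simp cong: measurable_cong_sets sets_pair_measure_cong)
  have S: "?S = ?d -` A \<inter> space ?N" by auto
  have [measurable]: "?S \<in> sets ?N" unfolding S by measurable
  have ind: "(\<lambda>\<omega>. indicator A (?d \<omega>) :: ennreal) \<in> borel_measurable ?N"
    by (rule measurable_compose[of ?d _ "count_space UNIV"]) auto
  have "emeasure ?N ?S = (\<integral>\<^sup>+\<omega>. indicator ?S \<omega> \<partial>?N)"
    by (rule nn_integral_indicator[symmetric]) fact
  also have "\<dots> = (\<integral>\<^sup>+\<omega>. indicator A (?d \<omega>) \<partial>?N)"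
    by (intro nn_integral_cong) (auto simp: indicator_def)
  also have "\<dots> = (\<integral>\<^sup>+w. (\<integral>\<^sup>+v. indicator A (?d (w, v)) \<partial>cgauss_vec l sv2) \<partial>cgauss_vec n sw2)"
    by (rule V.nn_integral_fst[OF ind, symmetric])
  finally show ?thesis by (simp add: decides_def)
qed

lemma decides_complement:
  assumes F: "measurable_scheme l n F" and s: "sv2 > 0" "sw2 > 0" and m: "m < M"
    and c: "c \<in> space (codebook_space M l)"
  shows "measure (cgauss_vec n sw2 \<Otimes>\<^sub>M cgauss_vec l sv2)
        {(w, v) \<in> space (cgauss_vec n sw2 \<Otimes>\<^sub>M cgauss_vec l sv2).
           ml_decode sv2 sw2 l n (at_gains F g) M c (\<lambda>i. at_gains F g (c m) w i + v i) \<noteq> m} =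
      enn2real (decides sv2 sw2 l n (at_gains F g) M c m (- {m}))"
    and "decides sv2 sw2 l n (at_gains F g) M c m {m} + decides sv2 sw2 l n (at_gains F g) M c m (- {m}) = 1"
proof -
  let ?N = "cgauss_vec n sw2 \<Otimes>\<^sub>M cgauss_vec l sv2"
  let ?d = "\<lambda>(w, v). ml_decode sv2 sw2 l n (at_gains F g) M c (\<lambda>i. at_gains F g (c m) w i + v i)"
  interpret prob_space ?N by (rule prob_space_noise[OF s])
  note e = emeasure_decides[OF F s m c, of g]
  show "measure ?N {(w, v) \<in> space ?N.
           ml_decode sv2 sw2 l n (at_gains F g) M c (\<lambda>i. at_gains F g (c m) w i + v i) \<noteq> m} =
      enn2real (decides sv2 sw2 l n (at_gains F g) M c m (- {m}))"
    using e[of "- {m}"] by (simp add: measure_def)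
  have d [measurable]: "?d \<in> ?N \<rightarrow>\<^sub>M count_space UNIV"
    using measurable_ml_decode_fixed[OF F s(2) m c]
    by (simp cong: measurable_cong_sets sets_pair_measure_cong)
  have S: "{(w, v) \<in> space ?N. ml_decode sv2 sw2 l n (at_gains F g) M c (\<lambda>i. at_gains F g (c m) w i + v i) \<in> A} =
      ?d -` A \<inter> space ?N" for A by auto
  have sets: "?d -` B \<inter> space ?N \<in> sets ?N" for B
    by (rule measurable_sets[OF d]) simp
  have "emeasure ?N (?d -` {m} \<inter> space ?N) + emeasure ?N (?d -` (- {m}) \<inter> space ?N) =
      emeasure ?N ((?d -` {m} \<inter> space ?N) \<union> (?d -` (- {m}) \<inter> space ?N))"
    by (rule plus_emeasure[OF sets sets]) auto
  also have "(?d -` {m} \<inter> space ?N) \<union> (?d -` (- {m}) \<inter> space ?N) = space ?N" by auto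
  finally show "decides sv2 sw2 l n (at_gains F g) M c m {m} + decides sv2 sw2 l n (at_gains F g) M c m (- {m}) = 1"
    using e[of "{m}"] e[of "- {m}"] unfolding S by (simp add: emeasure_space_1)
qed

lemma ml_error_nonneg: "0 \<le> ml_error sv2 sw2 l n F M c"
  unfolding ml_error_def by (intro divide_nonneg_nonneg sum_nonneg) auto

lemma ml_error_le_1:
  assumes s: "sv2 > 0" "sw2 > 0"
  shows "ml_error sv2 sw2 l n F M c \<le> 1"
proof -
  interpret prob_space "cgauss_vec n sw2 \<Otimes>\<^sub>M cgauss_vec l sv2" by (rule prob_space_noise[OF s])
  show ?thesis
    unfolding ml_error_def
    by (cases "M = 0") (auto simp: divide_le_eq_1 intro!: order_trans[OF sum_bounded_above[where K = 1]])
qed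

lemma borel_measurable_ml_error:
  assumes F: "measurable_scheme l n F" and s: "sv2 > 0" "sw2 > 0"
  shows "(\<lambda>(c, g). ml_error sv2 sw2 l n (at_gains F g) M c) \<in> borel_measurable (codebook_space M l \<Otimes>\<^sub>M gain_space)"
proof -
  let ?N = "cgauss_vec n sw2 \<Otimes>\<^sub>M cgauss_vec l sv2"
  interpret prob_space ?N by (rule prob_space_noise[OF s])
  have "(\<lambda>x. measure ?N {(w, v) \<in> space ?N.
           ml_decode sv2 sw2 l n (at_gains F (snd x)) M (fst x) (\<lambda>i. at_gains F (snd x) (fst x m) w i + v i) \<noteq> m})
      \<in> borel_measurable (codebook_space M l \<Otimes>\<^sub>M gain_space)" if m: "m < M" for m
  proof (rule measurable_measure)
    let ?d = "\<lambda>((c, g), w, v). ml_decode sv2 sw2 l n (at_gains F g) M c (\<lambda>i. at_gains F g (c m) w i + v i)"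
    let ?X = "(codebook_space M l \<Otimes>\<^sub>M gain_space) \<Otimes>\<^sub>M ?N"
    have d: "?d \<in> ?X \<rightarrow>\<^sub>M count_space UNIV"
      using measurable_ml_decode_observation[OF F s(2) m]
      by (simp cong: measurable_cong_sets sets_pair_measure_cong)
    have "{x \<in> space ?X. snd x \<in> {(w, v) \<in> space ?N.
           ml_decode sv2 sw2 l n (at_gains F (snd (fst x))) M (fst (fst x)) (\<lambda>i. at_gains F (snd (fst x)) (fst (fst x) m) w i + v i) \<noteq> m}}
       = ?d -` (- {m}) \<inter> space ?X"
      by (auto simp: space_pair_measure)
    also have "\<dots> \<in> sets ?X" by (rule measurable_sets[OF d]) auto
    finally show "{x \<in> space ?X. snd x \<in> {(w, v) \<in> space ?N.
           ml_decode sv2 sw2 l n (at_gains F (snd (fst x))) M (fst (fst x)) (\<lambda>i. at_gains F (snd (fst x)) (fst (fst x) m) w i + v i) \<noteq> m}}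
        \<in> sets ?X" .
  qed auto
  then show ?thesis
    unfolding ml_error_def by (auto simp: case_prod_beta intro!: borel_measurable_divide borel_measurable_sum)
qed

text \<open>Both halves of the proof argue channel by channel, so the ensemble average is taken
  inside, for fixed gains. \<open>error_probability\<close> has the opposite order; the exchange is
  Fubini for a measurable function with values in [0, 1].\<close>

definition conditional_error ::
    "real \<Rightarrow> real \<Rightarrow> nat \<Rightarrow> nat \<Rightarrow> scheme \<Rightarrow> nat \<Rightarrow> codebook measure \<Rightarrow> real" where
  "conditional_error sv2 sw2 l n F M Q = (\<integral>c. ml_error sv2 sw2 l n F M c \<partial>Q)"

lemma
  assumes F: "measurable_scheme l n F" and s: "sv2 > 0" "sw2 > 0" and Q: "code_ensemble M l Q"
  shows borel_measurable_conditional_error: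
      "(\<lambda>g. conditional_error sv2 sw2 l n (at_gains F g) M Q) \<in> borel_measurable gain_space" (is ?th1)
    and error_probability_eq: "error_probability sv2 sw2 l n F M Q =
      (\<integral>g. conditional_error sv2 sw2 l n (at_gains F g) M Q \<partial>gains)" (is ?th2)
proof -
  interpret Q: prob_space Q using Q by (simp add: code_ensemble_def)
  interpret G: prob_space gains by (rule prob_space_gains)
  interpret P: pair_sigma_finite Q gains ..
  interpret QG: prob_space "Q \<Otimes>\<^sub>M gains" by (intro prob_space_pair Q.prob_space_axioms G.prob_space_axioms)
  have [measurable_cong]: "sets Q = sets (codebook_space M l)" using Q by (simp add: code_ensemble_def)
  note [measurable] = borel_measurable_ml_error[OF F s, of M]
  have "(\<lambda>(g, c). (\<lambda>(c, g). ml_error sv2 sw2 l n (at_gains F g) M c) (c, g)) \<in> borel_measurable (gain_space \<Otimes>\<^sub>M Q)"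
    by measurable
  then show ?th1
    unfolding conditional_error_def by (intro Q.borel_measurable_lebesgue_integral) (simp add: case_prod_beta)
  have m: "(\<lambda>(c, g). ml_error sv2 sw2 l n (at_gains F g) M c) \<in> borel_measurable (Q \<Otimes>\<^sub>M gains)"
    by measurable
  have "integrable (Q \<Otimes>\<^sub>M gains) (\<lambda>(c, g). ml_error sv2 sw2 l n (at_gains F g) M c)"
    using m by (rule QG.integrable_const_bound[where B = 1, rotated])
      (auto simp: ml_error_nonneg ml_error_le_1[OF s])
  from P.Fubini_integral[OF this]
  show ?th2
    by (simp add: error_probability_def conditional_error_def case_prod_beta')
qed

text \<open>The first equation serves the union bound of the achievability part, the second the
  converse, which bounds the probability of success from above.\<close>

lemma
  assumes F: "measurable_scheme l n F" and s: "sv2 > 0" "sw2 > 0" and Q: "code_ensemble M l Q"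
    and M: "M > 0"
  shows ennreal_conditional_error: "ennreal (conditional_error sv2 sw2 l n (at_gains F g) M Q) =
      (\<integral>\<^sup>+c. (\<Sum>m<M. decides sv2 sw2 l n (at_gains F g) M c m (- {m})) / of_nat M \<partial>Q)" (is ?th1)
    and ennreal_conditional_success: "ennreal (1 - conditional_error sv2 sw2 l n (at_gains F g) M Q) =
      (\<integral>\<^sup>+c. (\<Sum>m<M. decides sv2 sw2 l n (at_gains F g) M c m {m}) / of_nat M \<partial>Q)" (is ?th2)
    and conditional_error_nonneg: "0 \<le> conditional_error sv2 sw2 l n (at_gains F g) M Q" (is ?th3)
    and conditional_error_le_1: "conditional_error sv2 sw2 l n (at_gains F g) M Q \<le> 1" (is ?th4)
proof -
  interpret Q: prob_space Q using Q by (simp add: code_ensemble_def)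
  have setsQ [measurable_cong]: "sets Q = sets (codebook_space M l)" using Q by (simp add: code_ensemble_def)
  have spQ: "space Q = space (codebook_space M l)" by (rule sets_eq_imp_space_eq[OF setsQ])
  let ?e = "\<lambda>c. ml_error sv2 sw2 l n (at_gains F g) M c"
  have "(\<lambda>c. (\<lambda>(c, g). ml_error sv2 sw2 l n (at_gains F g) M c) (c, g)) \<in> borel_measurable Q"
    by (rule measurable_compose[OF _ borel_measurable_ml_error[OF F s]])
       (intro measurable_Pair measurable_ident_sets setsQ measurable_const, simp add: space_pair_measure)
  then have e: "?e \<in> borel_measurable Q" by simp
  have int: "integrable Q ?e"
    using e by (rule Q.integrable_const_bound[where B = 1, rotated])
      (auto simp: ml_error_nonneg ml_error_le_1[OF s])
  let ?d = "\<lambda>c m. decides sv2 sw2 l n (at_gains F g) M c m (- {m})"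
  let ?d' = "\<lambda>c m. decides sv2 sw2 l n (at_gains F g) M c m {m}"
  have d: "ennreal (enn2real (?d c m)) = ?d c m" "ennreal (1 - enn2real (?d c m)) = ?d' c m"
       "enn2real (?d c m) \<le> 1"
    if c: "c \<in> space Q" and m: "m < M" for c m
  proof -
    have 1: "?d' c m + ?d c m = 1" using decides_complement(2)[OF F s m] c spQ by simp
    then have "?d c m \<le> 1" by (metis add.commute le_iff_add)
    then show 2: "ennreal (enn2real (?d c m)) = ?d c m" by (metis ennreal_enn2real ennreal_one_less_top order_le_less_trans)
    show 3: "enn2real (?d c m) \<le> 1" using \<open>?d c m \<le> 1\<close> by (simp add: enn2real_leI)
    have "ennreal (1 - enn2real (?d c m)) + ?d c m = 1"
      by (subst 2[symmetric], subst ennreal_plus[symmetric]) (use 3 in auto)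
    then show "ennreal (1 - enn2real (?d c m)) = ?d' c m"
      using 1 2 by (metis ennreal_add_diff_cancel_right ennreal_neq_top)
  qed
  have e_eq: "?e c = (\<Sum>m<M. enn2real (?d c m)) / real M" if "c \<in> space Q" for c
    unfolding ml_error_def using decides_complement(1)[OF F s] that spQ by simp
  have "ennreal (?e c) = (\<Sum>m<M. ?d c m) / of_nat M" if "c \<in> space Q" for c
    unfolding e_eq[OF that] using M
    by (subst divide_ennreal[symmetric])
       (auto simp: sum_nonneg sum_ennreal[symmetric] d(1)[OF that] ennreal_of_nat_eq_real_of_nat)
  then show ?th1
    unfolding conditional_error_def
    by (subst nn_integral_eq_integral[OF int, symmetric]) (auto simp: ml_error_nonneg cong: nn_integral_cong)
  have "ennreal (1 - ?e c) = (\<Sum>m<M. ?d' c m) / of_nat M" if "c \<in> space Q" for c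
  proof -
    have eq: "1 - ?e c = (\<Sum>m<M. 1 - enn2real (?d c m)) / real M"
      unfolding e_eq[OF that] using M by (simp add: sum_subtractf field_simps)
    have sum: "ennreal (\<Sum>m<M. 1 - enn2real (?d c m)) = (\<Sum>m<M. ?d' c m)"
      using d[OF that] by (subst sum_ennreal[symmetric]) auto
    have "(\<Sum>m<M. 1 - enn2real (?d c m)) \<ge> 0"
      using d[OF that] by (intro sum_nonneg) auto
    then show ?thesis
      unfolding eq sum[symmetric] ennreal_of_nat_eq_real_of_nat
      using M by (intro divide_ennreal[symmetric]) auto
  qed
  moreover have "1 - conditional_error sv2 sw2 l n (at_gains F g) M Q = (\<integral>c. 1 - ?e c \<partial>Q)"
    unfolding conditional_error_def using int by (simp add: Q.prob_space)
  moreover have "integrable Q (\<lambda>c. 1 - ?e c)" using int by simp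
  ultimately show ?th2
    using nn_integral_eq_integral[of Q "\<lambda>c. 1 - ?e c"] ml_error_le_1[OF s]
    by (simp cong: nn_integral_cong)
  show ?th3 unfolding conditional_error_def by (intro integral_nonneg_AE) (simp add: ml_error_nonneg)
  show ?th4
    unfolding conditional_error_def using int ml_error_le_1[OF s]
    by (intro Q.integral_le_const) auto
qed

section \<open>The converse\<close>

lemma nn_integral_cgauss_product_density:
  assumes \<tau>: "\<And>i. i \<in> I \<Longrightarrow> \<tau> i > 0" and I: "finite I"
  shows "(\<integral>\<^sup>+y. (\<Prod>i\<in>I. ennreal (cgauss_density (\<tau> i) (y i - c i))) \<partial>PiM I (\<lambda>_. lborel)) = 1"
proof -
  have "(\<integral>\<^sup>+y. (\<Prod>i\<in>I. ennreal (cgauss_density (\<tau> i) (y i - c i))) \<partial>PiM I (\<lambda>_. lborel)) =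
      (\<Prod>i\<in>I. \<integral>\<^sup>+z. ennreal (cgauss_density (\<tau> i) (z - c i)) \<partial>lborel)"
    by (rule product_sigma_finite.product_nn_integral_prod[OF product_sigma_finite_lborel I]) simp
  also have "\<dots> = 1"
    using \<tau> by (intro prod.neutral) (auto simp: nn_integral_cgauss_density_shift)
  finally show ?thesis .
qed

lemma borel_measurable_PiM_cgauss_density [measurable]:
  "finite I \<Longrightarrow> (\<lambda>y. \<Prod>i\<in>I. ennreal (cgauss_density (\<tau> i) (y i - c i))) \<in> borel_measurable (PiM I (\<lambda>_. borel))"
  by measurable

text \<open>Where \<open>t \<le> a\<close>, the noise density is at most \<open>K * exp a\<close>
  times \<open>q\<close> at the observation. The decision regions are disjoint and \<open>q\<close>
  has mass at most 1, so all messages together contribute at most \<open>K * exp a\<close>, without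
  a factor \<open>M\<close>. Where \<open>t > a\<close>, Markov's inequality is applied to
  \<open>t\<close>. The rule \<open>D\<close> is arbitrary.\<close>

lemma decision_bound:
  fixes \<mu> :: "nat \<Rightarrow> nat \<Rightarrow> complex" and D :: "(nat \<Rightarrow> complex) \<Rightarrow> nat"
  assumes D [measurable]: "D \<in> PiM {..<l} (\<lambda>_. borel) \<rightarrow>\<^sub>M count_space UNIV"
    and q [measurable]: "q \<in> borel_measurable (PiM {..<l} (\<lambda>_. borel))"
    and q1: "(\<integral>\<^sup>+y. q y \<partial>PiM {..<l} (\<lambda>_. lborel)) \<le> 1"
    and t [measurable]: "\<And>m. m < M \<Longrightarrow> t m \<in> borel_measurable (PiM {..<l} (\<lambda>_. borel))"
    and t0: "\<And>m v. t m v \<ge> 0" and s: "s > 0" and K: "K \<ge> 0" and a: "a > 0"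
    and bound: "\<And>m v. m < M \<Longrightarrow> (\<Prod>i<l. ennreal (cgauss_density s (v i))) \<le>
        ennreal (K * exp (t m v)) * q (\<lambda>i\<in>{..<l}. \<mu> m i + v i)"
  shows "(\<Sum>m<M. \<integral>\<^sup>+v. indicator {m} (D (\<lambda>i\<in>{..<l}. \<mu> m i + v i)) \<partial>cgauss_vec l s) \<le>
    (\<Sum>m<M. \<integral>\<^sup>+v. ennreal (t m v / a) \<partial>cgauss_vec l s) + ennreal (K * exp a)"
proof -
  let ?L = "PiM {..<l} (\<lambda>_. lborel :: complex measure)" and ?B = "PiM {..<l} (\<lambda>_. borel :: complex measure)"
  let ?T = "\<lambda>m v. \<lambda>i\<in>{..<l}. \<mu> m i + v i"
  have T [measurable]: "?T m \<in> ?B \<rightarrow>\<^sub>M ?B" for m by (rule measurable_restrict) auto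
  have setsL [measurable_cong]: "sets ?L = sets ?B" by (intro sets_PiM_cong) auto
  have ind [measurable]: "(\<lambda>y. indicator {m} (D y) :: ennreal) \<in> borel_measurable ?B" for m
    by (rule measurable_compose[OF D]) simp
  have each: "(\<integral>\<^sup>+v. indicator {m} (D (?T m v)) \<partial>cgauss_vec l s) \<le>
      (\<integral>\<^sup>+v. ennreal (t m v / a) \<partial>cgauss_vec l s) + ennreal (K * exp a) * (\<integral>\<^sup>+y. q y * indicator {m} (D y) \<partial>?L)"
    if m: "m < M" for m
  proof -
    have [measurable]: "t m \<in> borel_measurable ?B" using t m by blast
    have ind': "(\<lambda>v. indicator {m} (D (?T m v)) :: ennreal) \<in> borel_measurable ?B"
      by (rule measurable_compose[OF T ind])
    note [measurable] = ind'
    have qT [measurable]: "(\<lambda>v. q (?T m v)) \<in> borel_measurable ?B"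
      by (rule measurable_compose[OF T q])
    let ?h = "\<lambda>v. indicator {v. t m v \<le> a} v * indicator {m} (D (?T m v)) :: ennreal"
    have "indicator {v. t m v \<le> a} = (\<lambda>v. if t m v \<le> a then 1 else 0 :: ennreal)"
      by (auto simp: indicator_def fun_eq_iff)
    then have h [measurable]: "?h \<in> borel_measurable ?B" by simp
    have "(\<integral>\<^sup>+v. indicator {m} (D (?T m v)) \<partial>cgauss_vec l s) \<le> (\<integral>\<^sup>+v. ennreal (t m v / a) + ?h v \<partial>cgauss_vec l s)"
    proof (rule nn_integral_mono)
      fix v
      have "1 \<le> ennreal (t m v / a)" if "\<not> t m v \<le> a"
        using that a by (simp add: ennreal_ge_1)
      then show "indicator {m} (D (?T m v)) \<le> ennreal (t m v / a) + ?h v"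
        by (auto simp: indicator_def)
    qed
    also have "\<dots> = (\<integral>\<^sup>+v. ennreal (t m v / a) \<partial>cgauss_vec l s) + (\<integral>\<^sup>+v. ?h v \<partial>cgauss_vec l s)"
      by (rule nn_integral_add) (auto simp: measurable_cong_sets[OF sets_cgauss_vec refl])
    also have "(\<integral>\<^sup>+v. ?h v \<partial>cgauss_vec l s) =
        (\<integral>\<^sup>+v. (\<Prod>i<l. ennreal (cgauss_density s (v i))) * ?h v \<partial>?L)"
      unfolding cgauss_vec_def by (rule nn_integral_PiM_cgauss[OF _ s h]) simp
    also have "\<dots> \<le> (\<integral>\<^sup>+v. ennreal (K * exp a) * (q (?T m v) * indicator {m} (D (?T m v))) \<partial>?L)"
    proof (rule nn_integral_mono)
      fix v
      have "(\<Prod>i<l. ennreal (cgauss_density s (v i))) \<le> ennreal (K * exp a) * q (?T m v)" if "t m v \<le> a"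
        using order_trans[OF bound[OF m, of v] mult_right_mono[OF ennreal_leI]] that K
        by (simp add: mult_left_mono)
      then show "(\<Prod>i<l. ennreal (cgauss_density s (v i))) * ?h v \<le> ennreal (K * exp a) * (q (?T m v) * indicator {m} (D (?T m v)))"
        by (auto simp: indicator_def)
    qed
    also have "\<dots> = ennreal (K * exp a) * (\<integral>\<^sup>+v. q (?T m v) * indicator {m} (D (?T m v)) \<partial>?L)"
      by (rule nn_integral_cmult) measurable
    also have "(\<integral>\<^sup>+v. q (?T m v) * indicator {m} (D (?T m v)) \<partial>?L) = (\<integral>\<^sup>+y. q y * indicator {m} (D y) \<partial>?L)"
      by (rule nn_integral_PiM_lborel_shift) auto
    finally show ?thesis by (blast intro: add_left_mono)
  qed
  have "(\<Sum>m<M. \<integral>\<^sup>+y. q y * indicator {m} (D y) \<partial>?L) = (\<integral>\<^sup>+y. (\<Sum>m<M. q y * indicator {m} (D y)) \<partial>?L)"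
    by (rule nn_integral_sum[symmetric]) measurable
  also have "\<dots> \<le> (\<integral>\<^sup>+y. q y \<partial>?L)"
  proof (rule nn_integral_mono)
    fix y
    \<comment> \<open>At most one \<open>m\<close> equals \<open>D y\<close>.\<close>
    have "(\<Sum>m<M. indicator {m} (D y) :: ennreal) \<le> 1"
      by (subst sum.mono_neutral_cong_right[of "{..<M}" "{..<M} \<inter> {D y}" _ "\<lambda>_. 1"])
         (auto simp: indicator_def Int_insert_right split: if_splits)
    then show "(\<Sum>m<M. q y * indicator {m} (D y)) \<le> q y"
      by (simp add: sum_distrib_left[symmetric] mult_left_le)
  qed
  finally have sum: "(\<Sum>m<M. \<integral>\<^sup>+y. q y * indicator {m} (D y) \<partial>?L) \<le> 1" using q1 by simp
  have "(\<Sum>m<M. \<integral>\<^sup>+v. indicator {m} (D (?T m v)) \<partial>cgauss_vec l s) \<le>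
      (\<Sum>m<M. (\<integral>\<^sup>+v. ennreal (t m v / a) \<partial>cgauss_vec l s) + ennreal (K * exp a) * (\<integral>\<^sup>+y. q y * indicator {m} (D y) \<partial>?L))"
    by (intro sum_mono each) simp
  also have "\<dots> = (\<Sum>m<M. \<integral>\<^sup>+v. ennreal (t m v / a) \<partial>cgauss_vec l s) +
       ennreal (K * exp a) * (\<Sum>m<M. \<integral>\<^sup>+y. q y * indicator {m} (D y) \<partial>?L)"
    by (simp add: sum.distrib sum_distrib_left)
  also have "\<dots> \<le> (\<Sum>m<M. \<integral>\<^sup>+v. ennreal (t m v / a) \<partial>cgauss_vec l s) + ennreal (K * exp a) * 1"
    by (intro add_left_mono mult_left_mono sum) simp
  finally show ?thesis by simp
qed

lemma borel_measurable_norm_square [measurable]: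
  "(\<lambda>v. \<Sum>i<l. (cmod (v i))\<^sup>2) \<in> borel_measurable (PiM {..<l} (\<lambda>_. borel))"
  by measurable

lemma nn_integral_cgauss_vec_norm:
  assumes "s > 0"
  shows "(\<integral>\<^sup>+v. ennreal (\<Sum>i<l. (cmod (v i))\<^sup>2) \<partial>cgauss_vec l s) = ennreal (real l * s)"
proof -
  have m: "(\<lambda>v. ennreal ((cmod (v i))\<^sup>2)) \<in> borel_measurable (cgauss_vec l s)" if "i < l" for i
  proof -
    have "i \<in> {..<l}" using that by simp
    then show ?thesis by measurable
  qed
  have "(\<integral>\<^sup>+v. ennreal (\<Sum>i<l. (cmod (v i))\<^sup>2) \<partial>cgauss_vec l s) =
      (\<integral>\<^sup>+v. (\<Sum>i<l. ennreal ((cmod (v i))\<^sup>2)) \<partial>cgauss_vec l s)"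
    by (subst sum_ennreal) auto
  also have "\<dots> = (\<Sum>i<l. \<integral>\<^sup>+v. ennreal ((cmod (v i))\<^sup>2) \<partial>cgauss_vec l s)"
    using m by (intro nn_integral_sum) auto
  also have "\<dots> = (\<Sum>i<l. ennreal s)"
    using assms unfolding cgauss_vec_def
    by (intro sum.cong refl) (subst nn_integral_PiM_component_cgauss[where f="\<lambda>z. ennreal ((cmod z)\<^sup>2)"],
        auto simp: nn_integral_cgauss_cmod_square)
  also have "\<dots> = ennreal (real l * s)"
    using assms by (subst sum_ennreal) auto
  finally show ?thesis .
qed

text \<open>Giving the relay noise \<open>w\<close> to the destination can only help it, so \<open>q\<close> may depend on \<open>w\<close>.\<close>

lemma conditional_success_le:
  assumes F: "measurable_scheme l n F" and s: "sv2 > 0" "sw2 > 0" and Q: "code_ensemble M l Q"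
    and M: "M > 0"
    and q [measurable]: "\<And>w. q w \<in> borel_measurable (PiM {..<l} (\<lambda>_. borel))"
    and q1: "\<And>w. (\<integral>\<^sup>+y. q w y \<partial>PiM {..<l} (\<lambda>_. lborel)) \<le> 1"
    and \<tau> [measurable]: "\<tau> \<in> borel_measurable (PiM {..<l} (\<lambda>_. borel))" and \<tau>0: "\<And>x. \<tau> x \<ge> 0"
    and \<alpha>: "\<alpha> \<ge> 0" and K: "K \<ge> 0" and a: "a > 0" and C: "C \<ge> 0"
    and bound: "\<And>x w v. (\<Prod>i<l. ennreal (cgauss_density sv2 (v i))) \<le>
      ennreal (K * exp (\<alpha> * (\<Sum>i<l. (cmod (v i))\<^sup>2) / sv2 + \<tau> x)) * q w (\<lambda>i\<in>{..<l}. at_gains F g x w i + v i)"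
    and mean: "(\<Sum>m<M. \<integral>\<^sup>+c. ennreal (\<tau> (c m)) \<partial>Q) / of_nat M \<le> ennreal C"
  shows "1 - conditional_error sv2 sw2 l n (at_gains F g) M Q \<le> (\<alpha> * l + C) / a + K * exp a / M"
proof -
  have setsQ [measurable_cong]: "sets Q = sets (codebook_space M l)" using Q by (simp add: code_ensemble_def)
  have spQ: "space Q = space (codebook_space M l)" by (rule sets_eq_imp_space_eq[OF setsQ])
  interpret Q: prob_space Q using Q by (simp add: code_ensemble_def)
  interpret W: prob_space "cgauss_vec n sw2" using s by (intro prob_space_cgauss_vec)
  interpret V: prob_space "cgauss_vec l sv2" using s by (intro prob_space_cgauss_vec)
  let ?t = "\<lambda>x v. \<alpha> * (\<Sum>i<l. (cmod (v i))\<^sup>2) / sv2 + \<tau> x"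
  \<comment> \<open>The noise has variance \<open>sv2\<close> in each symbol, so its normalised
    squared norm has mean \<open>l\<close>; this is the origin of the term
    \<open>\<alpha> * l\<close>.\<close>
  have t_int: "(\<integral>\<^sup>+v. ennreal (?t x v / a) \<partial>cgauss_vec l sv2) = ennreal (\<alpha> * l / a) + ennreal (\<tau> x) / ennreal a"
    for x
  proof -
    have "(\<integral>\<^sup>+v. ennreal (?t x v / a) \<partial>cgauss_vec l sv2) =
        (\<integral>\<^sup>+v. ennreal (\<alpha> / sv2 / a) * ennreal (\<Sum>i<l. (cmod (v i))\<^sup>2) + ennreal (\<tau> x / a) \<partial>cgauss_vec l sv2)"
      using \<tau>0[of x] \<alpha> s a
      by (intro nn_integral_cong)
         (auto simp: ennreal_plus[symmetric] ennreal_mult[symmetric] sum_nonneg add_divide_distrib simp del: ennreal_plus)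
    also have "\<dots> = ennreal (\<alpha> / sv2 / a) * ennreal (real l * sv2) + ennreal (\<tau> x / a)"
      using s by (subst nn_integral_add) (auto simp: nn_integral_cmult nn_integral_cgauss_vec_norm V.emeasure_space_1)
    also have "\<dots> = ennreal (\<alpha> * l / a) + ennreal (\<tau> x) / ennreal a"
      using s a \<alpha> \<tau>0[of x] by (simp add: ennreal_mult[symmetric] divide_ennreal)
    finally show ?thesis .
  qed
  have step: "(\<Sum>m<M. decides sv2 sw2 l n (at_gains F g) M c m {m}) \<le>
      of_nat M * ennreal (\<alpha> * l / a) + (\<Sum>m<M. ennreal (\<tau> (c m))) / ennreal a + ennreal (K * exp a)"
    if c: "c \<in> space Q" for c
  proof -
    let ?D = "ml_decode sv2 sw2 l n (at_gains F g) M c"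
    let ?f = "\<lambda>m w. \<integral>\<^sup>+v. indicator {m} (?D (\<lambda>i. at_gains F g (c m) w i + v i)) \<partial>cgauss_vec l sv2"
    have D: "?D \<in> PiM {..<l} (\<lambda>_. borel) \<rightarrow>\<^sub>M count_space UNIV"
    proof (rule measurable_ml_decode[OF F s(2)])
      show "(\<lambda>\<omega>. g) \<in> PiM {..<l} (\<lambda>_. borel) \<rightarrow>\<^sub>M gain_space"
        "(\<lambda>\<omega>. c) \<in> PiM {..<l} (\<lambda>_. borel) \<rightarrow>\<^sub>M codebook_space M l"
        using c spQ by (auto intro!: measurable_const simp: space_pair_measure)
    qed auto
    have f: "?f m \<in> borel_measurable (cgauss_vec n sw2)" if m: "m < M" for m
    proof -
      have "(\<lambda>(w, v). indicator {m} (?D (\<lambda>i. at_gains F g (c m) w i + v i)) :: ennreal)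
          \<in> borel_measurable (cgauss_vec n sw2 \<Otimes>\<^sub>M cgauss_vec l sv2)"
        using measurable_compose[OF measurable_ml_decode_fixed[OF F s(2) m, where c = c and g = g and ?sv2.0 = sv2], of "indicator {m} :: nat \<Rightarrow> ennreal" borel] c spQ
        by (simp add: case_prod_beta' cong: measurable_cong_sets sets_pair_measure_cong)
      from V.borel_measurable_nn_integral_fst[OF this] show ?thesis by simp
    qed
    have "(\<Sum>m<M. decides sv2 sw2 l n (at_gains F g) M c m {m}) = (\<integral>\<^sup>+w. (\<Sum>m<M. ?f m w) \<partial>cgauss_vec n sw2)"
      unfolding decides_def using f by (subst nn_integral_sum) auto
    also have "\<dots> \<le> (\<integral>\<^sup>+w. (\<Sum>m<M. \<integral>\<^sup>+v. ennreal (?t (c m) v / a) \<partial>cgauss_vec l sv2) + ennreal (K * exp a) \<partial>cgauss_vec n sw2)"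
    \<comment> \<open>For a fixed \<open>w\<close> the ML decoder, which does not see
      \<open>w\<close>, is just one decision rule for observations with known means, so
      \<open>decision_bound\<close> applies with a \<open>q\<close> adapted to
      \<open>w\<close>.\<close>
    proof (rule nn_integral_mono)
      fix w
      have "?D (\<lambda>i. at_gains F g (c m) w i + v i) = ?D (\<lambda>i\<in>{..<l}. at_gains F g (c m) w i + v i)" for m v
        by (rule ml_decode_cong) auto
      then have "(\<Sum>m<M. ?f m w) = (\<Sum>m<M. \<integral>\<^sup>+v. indicator {m} (?D (\<lambda>i\<in>{..<l}. at_gains F g (c m) w i + v i)) \<partial>cgauss_vec l sv2)"
        by simp
      also have "\<dots> \<le> (\<Sum>m<M. \<integral>\<^sup>+v. ennreal (?t (c m) v / a) \<partial>cgauss_vec l sv2) + ennreal (K * exp a)"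
        by (rule decision_bound[OF D q q1 _ _ s(1) K a bound]) (use \<alpha> \<tau>0 s in \<open>auto intro!: add_nonneg_nonneg divide_nonneg_pos mult_nonneg_nonneg sum_nonneg\<close>)
      finally show "(\<Sum>m<M. ?f m w) \<le> (\<Sum>m<M. \<integral>\<^sup>+v. ennreal (?t (c m) v / a) \<partial>cgauss_vec l sv2) + ennreal (K * exp a)" .
    qed
    also have "\<dots> = of_nat M * ennreal (\<alpha> * l / a) + (\<Sum>m<M. ennreal (\<tau> (c m))) / ennreal a + ennreal (K * exp a)"
      unfolding t_int by (simp add: W.emeasure_space_1 sum.distrib divide_ennreal_def sum_distrib_right)
    finally show ?thesis .
  qed
  have \<tau>m: "(\<lambda>c. ennreal (\<tau> (c m))) \<in> borel_measurable Q" if "m < M" for m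
    using measurable_compose[OF measurable_codeword[OF that] \<tau>] by (simp add: measurable_cong_sets[OF setsQ refl])
  have "ennreal (1 - conditional_error sv2 sw2 l n (at_gains F g) M Q) =
      (\<integral>\<^sup>+c. (\<Sum>m<M. decides sv2 sw2 l n (at_gains F g) M c m {m}) / of_nat M \<partial>Q)"
    by (rule ennreal_conditional_success[OF F s Q M])
  also have "\<dots> \<le> (\<integral>\<^sup>+c. (of_nat M * ennreal (\<alpha> * l / a) + (\<Sum>m<M. ennreal (\<tau> (c m))) / ennreal a + ennreal (K * exp a)) / of_nat M \<partial>Q)"
    by (intro nn_integral_mono divide_right_mono_ennreal step)
  also have "\<dots> = (of_nat M * ennreal (\<alpha> * l / a) + (\<Sum>m<M. \<integral>\<^sup>+c. ennreal (\<tau> (c m)) \<partial>Q) / ennreal a + ennreal (K * exp a)) / of_nat M"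
  proof -
    have "(\<integral>\<^sup>+c. (\<Sum>m<M. ennreal (\<tau> (c m))) \<partial>Q) = (\<Sum>m<M. \<integral>\<^sup>+c. ennreal (\<tau> (c m)) \<partial>Q)"
      by (rule nn_integral_sum) (use \<tau>m in auto)
    moreover have "(\<lambda>c. \<Sum>m<M. ennreal (\<tau> (c m))) \<in> borel_measurable Q"
      by (rule borel_measurable_sum) (use \<tau>m in auto)
    ultimately show ?thesis
      by (simp add: nn_integral_divide nn_integral_add Q.emeasure_space_1)
  qed
  also have "\<dots> = ennreal (\<alpha> * l / a) + (\<Sum>m<M. \<integral>\<^sup>+c. ennreal (\<tau> (c m)) \<partial>Q) / of_nat M / ennreal a + ennreal (K * exp a / M)"
  proof -
    have "of_nat M * x / of_nat M = x" for x :: ennreal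
      using M by (metis ennreal_mult_divide_eq ennreal_of_nat_neq_top mult.commute of_nat_eq_0_iff less_numeral_extra(3))
    then have *: "(of_nat M * x + y / z + w) / of_nat M = x + y / of_nat M / z + w / of_nat M" for x y z w :: ennreal
      unfolding divide_ennreal_def distrib_right by (simp add: mult_ac)
    have "ennreal (K * exp a) / of_nat M = ennreal (K * exp a / M)"
      using M K by (simp add: ennreal_of_nat_eq_real_of_nat divide_ennreal)
    then show ?thesis unfolding * by simp
  qed
  also have "\<dots> \<le> ennreal (\<alpha> * l / a) + ennreal C / ennreal a + ennreal (K * exp a / M)"
    by (intro add_mono divide_right_mono_ennreal mean) auto
  also have "\<dots> = ennreal ((\<alpha> * l + C) / a + K * exp a / M)"
    using \<alpha> a C K by (simp add: divide_ennreal add_divide_distrib)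
  finally show ?thesis
    using \<alpha> a C K by (subst (asm) ennreal_le_iff) (auto intro!: add_nonneg_nonneg)
qed

section \<open>The reference density\<close>

lemma sum_cmod_rank_one_update:
  fixes e \<gamma> :: "'i \<Rightarrow> complex" and t :: real and \<sigma> :: complex
  shows "(\<Sum>k\<in>T. (cmod (e k - of_real t * cnj (\<gamma> k) * \<sigma>))\<^sup>2) =
    (\<Sum>k\<in>T. (cmod (e k))\<^sup>2) - 2 * t * Re (cnj \<sigma> * (\<Sum>k\<in>T. \<gamma> k * e k)) + t\<^sup>2 * (cmod \<sigma>)\<^sup>2 * (\<Sum>k\<in>T. (cmod (\<gamma> k))\<^sup>2)"
proof -
  have "(cmod (e k - of_real t * cnj (\<gamma> k) * \<sigma>))\<^sup>2 =
      (cmod (e k))\<^sup>2 - 2 * t * Re (cnj \<sigma> * (\<gamma> k * e k)) + t\<^sup>2 * (cmod \<sigma>)\<^sup>2 * (cmod (\<gamma> k))\<^sup>2" for k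
    by (simp add: cmod_power2) algebra
  then show ?thesis
    by (simp only: sum.distrib sum_subtractf sum_distrib_left[symmetric] Re_sum[symmetric])
qed

text \<open>The orthonormal basis is built by rank-one updates: if \<open>A\<close> is orthonormal for the rows
  in \<open>B\<close> and \<open>\<gamma>\<close> is a further row in these coordinates, then \<open>I - t \<gamma>\<^sup>* \<gamma>\<close> with
  \<open>t = 1 / (u (1 + u))\<close>, \<open>u\<^sup>2 = 1 + |\<gamma>|\<^sup>2\<close>, is the inverse square root of \<open>I + \<gamma>\<^sup>* \<gamma>\<close>.\<close>

lemma orthonormal_coordinates:
  fixes \<beta> :: "'j \<Rightarrow> 'i \<Rightarrow> complex"
  assumes T: "finite T" and B: "finite B"
  shows "\<exists>A :: 'i \<Rightarrow> 'i \<Rightarrow> complex.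
    (\<forall>e. (\<Sum>i\<in>T. (cmod (\<Sum>k\<in>T. A i k * e k))\<^sup>2)
       + (\<Sum>j\<in>B. (cmod (\<Sum>i\<in>T. \<beta> j i * (\<Sum>k\<in>T. A i k * e k)))\<^sup>2) = (\<Sum>k\<in>T. (cmod (e k))\<^sup>2)) \<and>
    (\<forall>x. \<exists>e. \<forall>i\<in>T. x i = (\<Sum>k\<in>T. A i k * e k))"
  using B
proof (induction B)
  case empty
  have *: "(\<Sum>k\<in>T. (if i = k then 1 else 0) * e k) = (e i :: complex)" if "i \<in> T" for e i
    using T that by (simp add: if_distrib[of "\<lambda>x. x * _"] cong: if_cong)
  show ?case
    by (rule exI[of _ "\<lambda>i k. if i = k then 1 else 0"]) (auto simp: * cong: sum.cong)
next
  case (insert b B)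
  then obtain A where
    A: "\<And>e. (\<Sum>i\<in>T. (cmod (\<Sum>k\<in>T. A i k * e k))\<^sup>2)
       + (\<Sum>j\<in>B. (cmod (\<Sum>i\<in>T. \<beta> j i * (\<Sum>k\<in>T. A i k * e k)))\<^sup>2) = (\<Sum>k\<in>T. (cmod (e k))\<^sup>2)"
    and surj: "\<And>x. \<exists>e. \<forall>i\<in>T. x i = (\<Sum>k\<in>T. A i k * e k)" by blast
  define \<gamma> where "\<gamma> k = (\<Sum>i\<in>T. \<beta> b i * A i k)" for k
  define \<Gamma> where "\<Gamma> = (\<Sum>k\<in>T. (cmod (\<gamma> k))\<^sup>2)"
  define u where "u = sqrt (1 + \<Gamma>)"
  have "\<Gamma> \<ge> 0" unfolding \<Gamma>_def by (intro sum_nonneg) auto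
  then have u: "u \<ge> 1" "u\<^sup>2 = 1 + \<Gamma>" unfolding u_def by auto
  define t where "t = 1 / (u * (1 + u))"
  \<comment> \<open>Along the conjugate of \<gamma> the update scales by \<open>1 / u\<close>, the
    inverse square root of the eigenvalue 1 + \<Gamma>; in orthogonal directions it is the
    identity.\<close>
  have t\<Gamma>: "1 - t * \<Gamma> = 1 / u"
  proof -
    have "\<Gamma> = (u - 1) * (1 + u)" using u(2) by (simp add: algebra_simps power2_eq_square)
    then show ?thesis unfolding t_def using u(1) by (simp add: divide_simps)
  qed
  define R where "R e k = e k - of_real t * cnj (\<gamma> k) * (\<Sum>j\<in>T. \<gamma> j * e j)" for e k
  define A' where "A' i k = A i k - of_real t * (\<Sum>j\<in>T. A i j * cnj (\<gamma> j)) * \<gamma> k" for i k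
  have A': "(\<Sum>k\<in>T. A' i k * e k) = (\<Sum>k\<in>T. A i k * R e k)" for i e
  proof -
    have "(\<Sum>k\<in>T. A' i k * e k) = (\<Sum>k\<in>T. A i k * e k) - of_real t * (\<Sum>j\<in>T. A i j * cnj (\<gamma> j)) * (\<Sum>k\<in>T. \<gamma> k * e k)"
      by (simp add: A'_def left_diff_distrib sum_subtractf sum_distrib_left mult.assoc)
    also have "\<dots> = (\<Sum>k\<in>T. A i k * R e k)"
      by (simp add: R_def right_diff_distrib sum_subtractf sum_distrib_left sum_distrib_right mult_ac)
    finally show ?thesis .
  qed
  have \<gamma>: "(\<Sum>i\<in>T. \<beta> b i * (\<Sum>k\<in>T. A i k * e k)) = (\<Sum>k\<in>T. \<gamma> k * e k)" for e
    unfolding \<gamma>_def sum_distrib_left sum_distrib_right by (subst sum.swap) (simp add: mult.assoc)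
  have \<gamma>cnj: "(\<Sum>k\<in>T. \<gamma> k * cnj (\<gamma> k)) = of_real \<Gamma>"
    by (simp add: \<Gamma>_def complex_mult_cnj cmod_power2)
  have \<gamma>R: "(\<Sum>k\<in>T. \<gamma> k * R e k) = of_real (1 / u) * (\<Sum>k\<in>T. \<gamma> k * e k)" for e
  proof -
    have "(\<Sum>k\<in>T. \<gamma> k * R e k) = (\<Sum>k\<in>T. \<gamma> k * e k) - of_real t * (\<Sum>k\<in>T. \<gamma> k * cnj (\<gamma> k)) * (\<Sum>k\<in>T. \<gamma> k * e k)"
      by (simp add: R_def right_diff_distrib sum_subtractf sum_distrib_left sum_distrib_right mult_ac)
    also have "\<dots> = of_real (1 - t * \<Gamma>) * (\<Sum>k\<in>T. \<gamma> k * e k)"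
      by (simp add: \<gamma>cnj algebra_simps)
    finally show ?thesis by (simp only: t\<Gamma>)
  qed
  have "(\<Sum>i\<in>T. (cmod (\<Sum>k\<in>T. A' i k * e k))\<^sup>2) +
      (\<Sum>j\<in>insert b B. (cmod (\<Sum>i\<in>T. \<beta> j i * (\<Sum>k\<in>T. A' i k * e k)))\<^sup>2) = (\<Sum>k\<in>T. (cmod (e k))\<^sup>2)" for e
  proof -
    define \<sigma> where "\<sigma> = (\<Sum>k\<in>T. \<gamma> k * e k)"
    \<comment> \<open>By the induction hypothesis at \<open>R e\<close> the coordinates and the old
      rows add up to the squared norm of \<open>R e\<close>; only the new row is left.\<close>
    have "(\<Sum>i\<in>T. (cmod (\<Sum>k\<in>T. A' i k * e k))\<^sup>2) +
      (\<Sum>j\<in>insert b B. (cmod (\<Sum>i\<in>T. \<beta> j i * (\<Sum>k\<in>T. A' i k * e k)))\<^sup>2) =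
      (\<Sum>k\<in>T. (cmod (R e k))\<^sup>2) + (cmod (\<Sum>k\<in>T. \<gamma> k * R e k))\<^sup>2"
      using insert.hyps by (simp add: A' \<gamma> A[of "R e", symmetric] add_ac)
    also have "(\<Sum>k\<in>T. (cmod (R e k))\<^sup>2) = (\<Sum>k\<in>T. (cmod (e k))\<^sup>2) - 2 * t * Re (cnj \<sigma> * \<sigma>) + t\<^sup>2 * (cmod \<sigma>)\<^sup>2 * \<Gamma>"
      unfolding R_def \<sigma>_def[symmetric] sum_cmod_rank_one_update \<Gamma>_def ..
    also have "Re (cnj \<sigma> * \<sigma>) = (cmod \<sigma>)\<^sup>2"
      by (simp add: cmod_power2 flip: power2_eq_square)
    also have "(\<Sum>k\<in>T. \<gamma> k * R e k) = of_real (1 / u) * \<sigma>"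
      unfolding \<gamma>R \<sigma>_def ..
    also have "(cmod (of_real (1 / u) * \<sigma>))\<^sup>2 = (1 / u)\<^sup>2 * (cmod \<sigma>)\<^sup>2"
      by (simp only: norm_mult norm_of_real power_mult_distrib power2_abs)
    also have "(1 / u)\<^sup>2 = 1 - 2 * (t * \<Gamma>) + (t * \<Gamma>)\<^sup>2"
      unfolding t\<Gamma>[symmetric] by (simp add: power2_eq_square algebra_simps)
    also have "(\<Sum>k\<in>T. (cmod (e k))\<^sup>2) - 2 * t * (cmod \<sigma>)\<^sup>2 + t\<^sup>2 * (cmod \<sigma>)\<^sup>2 * \<Gamma> + (1 - 2 * (t * \<Gamma>) + (t * \<Gamma>)\<^sup>2) * (cmod \<sigma>)\<^sup>2 =
       (\<Sum>k\<in>T. (cmod (e k))\<^sup>2) + (1 + (1 + \<Gamma>) * (t * (t * \<Gamma>) - 2 * t)) * (cmod \<sigma>)\<^sup>2"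
      by (simp add: power2_eq_square algebra_simps)
    also have "1 + (1 + \<Gamma>) * (t * (t * \<Gamma>) - 2 * t) = 0"
    proof -
      have "t * \<Gamma> = 1 - 1 / u" using t\<Gamma> by simp
      then have "t * (t * \<Gamma>) - 2 * t = - t * (1 + 1 / u)"
        by (simp only:) (simp add: algebra_simps)
      also have "1 + 1 / u = (1 + u) / u" using u(1) by (simp add: field_simps)
      also have "- t * ((1 + u) / u) = - (1 / u\<^sup>2)" using u(1) by (simp add: t_def power2_eq_square)
      finally have *: "t * (t * \<Gamma>) - 2 * t = - (1 / u\<^sup>2)" .
      show ?thesis unfolding * u(2)[symmetric] using u(1) by simp
    qed
    finally show ?thesis by simp
  qed
  moreover have "\<exists>e. \<forall>i\<in>T. x i = (\<Sum>k\<in>T. A' i k * e k)" for x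
  proof -
    obtain e where e: "\<forall>i\<in>T. x i = (\<Sum>k\<in>T. A i k * e k)" using surj by blast
    define \<sigma> where "\<sigma> = (\<Sum>k\<in>T. \<gamma> k * e k)"
    \<comment> \<open>The rank-one update is inverted by adding the same rank-one matrix with
      coefficient t / (1 - t \<Gamma>) = t u = 1 / (1 + u).\<close>
    define e' where "e' k = e k + of_real (1 / (1 + u)) * cnj (\<gamma> k) * \<sigma>" for k
    have "(\<Sum>k\<in>T. \<gamma> k * e' k) = \<sigma> + of_real (1 / (1 + u)) * (\<Sum>k\<in>T. \<gamma> k * cnj (\<gamma> k)) * \<sigma>"
      by (simp add: e'_def distrib_left sum.distrib \<sigma>_def sum_distrib_left sum_distrib_right mult_ac)
    also have "\<dots> = of_real (1 + 1 / (1 + u) * \<Gamma>) * \<sigma>"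
      by (simp add: \<gamma>cnj algebra_simps)
    also have "1 + 1 / (1 + u) * \<Gamma> = u"
    proof -
      have "\<Gamma> = (u - 1) * (1 + u)" using u(2) by (simp add: algebra_simps power2_eq_square)
      then show ?thesis using u(1) by (simp add: field_simps)
    qed
    finally have \<sigma>': "(\<Sum>k\<in>T. \<gamma> k * e' k) = of_real u * \<sigma>" .
    have tu: "t * u = 1 / (1 + u)" using u(1) by (simp add: t_def)
    have "R e' k = e k" for k
    proof -
      have "R e' k = e' k - of_real t * cnj (\<gamma> k) * (of_real u * \<sigma>)" unfolding R_def \<sigma>' ..
      also have "\<dots> = e k" unfolding e'_def tu[symmetric] by (simp add: algebra_simps)
      finally show ?thesis .
    qed
    then have "R e' = e" by (simp add: fun_eq_iff)
    then show ?thesis using e by (intro exI[of _ e']) (simp add: A')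
  qed
  ultimately show ?case by blast
qed

text \<open>The area pi s of the disc times a lower bound of the density there, where |z|^2 is at
  most 2 |e|^2 + 2 s.\<close>

lemma emeasure_cgauss_disc_ge:
  assumes E: "E > 0" and s: "s \<ge> 0"
  shows "ennreal (s / E * exp (- ((2 * (cmod e)\<^sup>2 + 2 * s) / E))) \<le> emeasure (cgauss E) {z. (cmod (z - e))\<^sup>2 \<le> s}"
proof -
  have S: "{z. (cmod (z - e))\<^sup>2 \<le> s} = cball e (sqrt s)"
    using s by (auto simp: dist_norm norm_minus_commute real_le_rsqrt intro: sqrt_ge_absD)
  define \<delta> where "\<delta> = exp (- ((2 * (cmod e)\<^sup>2 + 2 * s) / E)) / (pi * E)"
  have \<delta>: "\<delta> \<ge> 0" using E by (simp add: \<delta>_def)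
  have le: "\<delta> \<le> cgauss_density E z" if "(cmod (z - e))\<^sup>2 \<le> s" for z
  proof -
    have "(cmod z)\<^sup>2 \<le> (cmod (z - e) + cmod e)\<^sup>2"
      using norm_triangle_ineq[of "z - e" e] by (intro power_mono) auto
    also have "\<dots> \<le> 2 * (cmod e)\<^sup>2 + 2 * (cmod (z - e))\<^sup>2"
      using sum_squares_bound[of "cmod (z - e)" "cmod e"] by (simp add: power2_sum)
    also have "\<dots> \<le> 2 * (cmod e)\<^sup>2 + 2 * s" using that by simp
    finally show ?thesis
      using E unfolding \<delta>_def cgauss_density_def by (simp add: divide_right_mono)
  qed
  have "ennreal (s / E * exp (- ((2 * (cmod e)\<^sup>2 + 2 * s) / E))) = ennreal \<delta> * emeasure lborel (cball e (sqrt s))"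
    using E s \<delta> by (subst emeasure_cball) (auto simp: unit_ball_vol_2 ennreal_mult[symmetric] \<delta>_def)
  also have "\<dots> = (\<integral>\<^sup>+z. ennreal \<delta> * indicator (cball e (sqrt s)) z \<partial>lborel)"
    by (subst nn_integral_cmult_indicator) auto
  also have "\<dots> \<le> (\<integral>\<^sup>+z. ennreal (cgauss_density E z) * indicator (cball e (sqrt s)) z \<partial>lborel)"
    unfolding S[symmetric] using le by (intro nn_integral_mono) (auto simp: indicator_def intro!: ennreal_leI)
  also have "\<dots> = emeasure (cgauss E) (cball e (sqrt s))"
    unfolding cgauss_def by (subst emeasure_density) auto
  finally show ?thesis unfolding S .
qed

lemma emeasure_PiM_cgauss_polydisc_ge:
  fixes E s :: real
  assumes T: "finite T" and E: "E > 0" and s: "s \<ge> 0"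
  shows "ennreal ((s / E) ^ card T * exp (- ((2 * (\<Sum>k\<in>T. (cmod (e k))\<^sup>2) + 2 * s * card T) / E)))
    \<le> emeasure (PiM T (\<lambda>_. cgauss E)) (\<Pi>\<^sub>E k\<in>T. {z. (cmod (z - e k))\<^sup>2 \<le> s})"
proof -
  have "emeasure (PiM T (\<lambda>_. cgauss E)) (\<Pi>\<^sub>E k\<in>T. {z. (cmod (z - e k))\<^sup>2 \<le> s}) =
      (\<Prod>k\<in>T. emeasure (cgauss E) {z. (cmod (z - e k))\<^sup>2 \<le> s})"
    using T by (subst product_sigma_finite.emeasure_PiM[OF product_sigma_finite_cgauss[OF E]]) auto
  also have "\<dots> \<ge> (\<Prod>k\<in>T. ennreal (s / E * exp (- ((2 * (cmod (e k))\<^sup>2 + 2 * s) / E))))"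
    using emeasure_cgauss_disc_ge[OF E s] by (intro prod_mono_ennreal) auto
  also have "(\<Prod>k\<in>T. ennreal (s / E * exp (- ((2 * (cmod (e k))\<^sup>2 + 2 * s) / E)))) =
      ennreal (\<Prod>k\<in>T. s / E * exp (- ((2 * (cmod (e k))\<^sup>2 + 2 * s) / E)))"
    using E s by (intro prod_ennreal) auto
  also have "(\<Prod>k\<in>T. s / E * exp (- ((2 * (cmod (e k))\<^sup>2 + 2 * s) / E))) =
      (s / E) ^ card T * exp (- ((2 * (\<Sum>k\<in>T. (cmod (e k))\<^sup>2) + 2 * s * card T) / E))"
  proof -
    have "(\<Sum>k\<in>T. - ((2 * (cmod (e k))\<^sup>2 + 2 * s) / E)) = - ((2 * (\<Sum>k\<in>T. (cmod (e k))\<^sup>2) + 2 * s * card T) / E)"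
      by (simp add: sum_negf sum_divide_distrib[symmetric] sum.distrib sum_distrib_left mult_ac)
    then show ?thesis using T by (simp only: prod.distrib exp_sum[symmetric] prod_constant)
  qed
  finally show ?thesis .
qed

lemma cmod_sum_square_le:
  "(cmod (a + b))\<^sup>2 \<le> 2 * (cmod a)\<^sup>2 + 2 * (cmod b)\<^sup>2"
  "(cmod (a + b + c))\<^sup>2 \<le> 3 * (cmod a)\<^sup>2 + 3 * (cmod b)\<^sup>2 + 3 * (cmod c)\<^sup>2"
proof -
  have "(cmod (a + b))\<^sup>2 \<le> (cmod a + cmod b)\<^sup>2"
    by (intro power_mono norm_triangle_ineq) auto
  also have "\<dots> \<le> 2 * (cmod a)\<^sup>2 + 2 * (cmod b)\<^sup>2"
    using sum_squares_bound[of "cmod a" "cmod b"] by (simp add: power2_sum)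
  finally show "(cmod (a + b))\<^sup>2 \<le> 2 * (cmod a)\<^sup>2 + 2 * (cmod b)\<^sup>2" .
  have "(cmod (a + b + c))\<^sup>2 \<le> (cmod a + cmod b + cmod c)\<^sup>2"
    using norm_triangle_ineq[of "a + b" c] norm_triangle_ineq[of a b] by (intro power_mono) auto
  also have "\<dots> \<le> 3 * (cmod a)\<^sup>2 + 3 * (cmod b)\<^sup>2 + 3 * (cmod c)\<^sup>2"
    using sum_squares_bound[of "cmod a" "cmod b"] sum_squares_bound[of "cmod a" "cmod c"]
      sum_squares_bound[of "cmod b" "cmod c"] by (simp add: power2_sum algebra_simps)
  finally show "(cmod (a + b + c))\<^sup>2 \<le> 3 * (cmod a)\<^sup>2 + 3 * (cmod b)\<^sup>2 + 3 * (cmod c)\<^sup>2" .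
qed

text \<open>Widening the noise to variance X s costs a factor X in the normalisation of one complex
  symbol; in return a displacement with square of order X s costs only a bounded exponent.\<close>

lemma exp_mult_cgauss_density_le:
  assumes s: "s > 0" and X: "X > 0" and le: "(cmod z)\<^sup>2 \<le> X * (cmod v)\<^sup>2 + X * s * r"
  shows "exp (- r) / X * cgauss_density s v \<le> cgauss_density (X * s) z"
proof -
  have "(cmod z)\<^sup>2 / (X * s) \<le> (X * (cmod v)\<^sup>2 + X * s * r) / (X * s)"
    using le s X by (intro divide_right_mono) auto
  also have "\<dots> = (cmod v)\<^sup>2 / s + r"
    using s X by (simp add: field_simps)
  finally have "exp (- r) * exp (- (cmod v)\<^sup>2 / s) \<le> exp (- (cmod z)\<^sup>2 / (X * s))"
    by (simp add: exp_add[symmetric])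
  then have "exp (- r) * exp (- (cmod v)\<^sup>2 / s) / (pi * (X * s)) \<le> exp (- (cmod z)\<^sup>2 / (X * s)) / (pi * (X * s))"
    using s X by (intro divide_right_mono) auto
  then show ?thesis
    using s X by (simp add: cgauss_density_def field_simps)
qed

text \<open>The reference density \<open>q\<close> belongs to a Gaussian input whose inverse covariance is the
  quadratic form bounded by the energy constraints, and to noise of variance \<open>X s\<close> in the
  symbols sent by the relay. An input within \<open>E / X\<close> of \<open>u\<close> is indistinguishable from \<open>u\<close>, and the
  prior probability of these inputs is of order \<open>X ^ - card T\<close>.\<close>

lemma reference_density:
  fixes \<beta> :: "nat \<Rightarrow> nat \<Rightarrow> complex" and E s X :: real
  assumes T: "T \<subseteq> {..<l}" and E: "E > 0" and s: "s > 0" and X: "X \<ge> 1"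
    and g1: "E * (cmod g1)\<^sup>2 \<le> X * s" and g2: "E * (cmod g2)\<^sup>2 \<le> X\<^sup>2 * s"
  defines "B \<equiv> {..<l} - T"
  shows "\<exists>q \<in> borel_measurable (PiM {..<l} (\<lambda>_. borel)).
    (\<integral>\<^sup>+y. q y \<partial>PiM {..<l} (\<lambda>_. lborel)) \<le> 1 \<and>
    (\<forall>u v. (\<Prod>i<l. ennreal (cgauss_density s (v i))) \<le>
      ennreal (X ^ l * exp (3 * (\<Sum>i<l. (cmod (v i))\<^sup>2) / s + (3 * (\<Sum>i<l. (cmod (u i))\<^sup>2) / E
        + 2 * ((\<Sum>i\<in>T. (cmod (u i))\<^sup>2) + (\<Sum>j\<in>B. (cmod (\<Sum>i\<in>T. \<beta> j i * u i))\<^sup>2)) / E + (3 * l\<^sup>2 + 2 * l)))) *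
      q (\<lambda>i\<in>{..<l}. (if i \<in> T then g1 * u i else g1 * u i + g2 * (\<Sum>k\<in>T. \<beta> i k * u k)) + \<nu> i + v i))"
proof -
  have finT: "finite T" using T finite_subset by blast
  have finB: "finite B" unfolding B_def by simp
  have card: "card T + card B = l" "card T \<le> l"
    unfolding B_def using T finT card_mono[OF _ T] by (auto simp: card_Diff_subset)
  from orthonormal_coordinates[OF finT finB, of \<beta>] obtain A where
    A: "\<And>e. (\<Sum>i\<in>T. (cmod (\<Sum>k\<in>T. A i k * e k))\<^sup>2)
       + (\<Sum>j\<in>B. (cmod (\<Sum>i\<in>T. \<beta> j i * (\<Sum>k\<in>T. A i k * e k)))\<^sup>2) = (\<Sum>k\<in>T. (cmod (e k))\<^sup>2)"
    and surj: "\<And>x. \<exists>e. \<forall>i\<in>T. x i = (\<Sum>k\<in>T. A i k * e k)" by blast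
  define x where "x z i = (\<Sum>k\<in>T. A i k * z k)" for z i
  \<comment> \<open>In the relay's symbols the centre omits the direct term \<open>g1 * u i\<close>.
    Its square is at most X s |u i|^2 / E, so it disappears in the noise of variance X s chosen for
    these symbols; only the symbols in \<open>T\<close> have to be covered by the prior.\<close>
  define c where "c z i = \<nu> i + (if i \<in> T then g1 * x z i else g2 * (\<Sum>k\<in>T. \<beta> i k * x z k))" for z i
  define \<tau> where "\<tau> i = (if i \<in> T then 1 else X)" for i
  have \<tau>: "\<tau> i \<ge> 1" for i using X by (simp add: \<tau>_def)
  let ?Z = "PiM T (\<lambda>_. cgauss E)" and ?L = "PiM {..<l} (\<lambda>_. lborel :: complex measure)"
  let ?p = "\<lambda>z y. \<Prod>i<l. ennreal (cgauss_density (\<tau> i * s) (y i - c z i))"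
  interpret Z: prob_space ?Z using E by (rule prob_space_PiM_cgauss)
  interpret L: sigma_finite_measure ?L
    by (rule product_sigma_finite.sigma_finite[OF product_sigma_finite_lborel]) simp
  interpret ZL: pair_sigma_finite ?Z ?L ..
  have setsL [measurable_cong]: "sets ?L = sets (PiM {..<l} (\<lambda>_. borel))" by (intro sets_PiM_cong) auto
  have setsZ [measurable_cong]: "sets ?Z = sets (PiM T (\<lambda>_. borel))" by (intro sets_PiM_cong) auto
  have xm [measurable]: "(\<lambda>z. x z i) \<in> borel_measurable (PiM T (\<lambda>_. borel))" for i
    unfolding x_def by measurable
  have cm [measurable]: "(\<lambda>z. c z i) \<in> borel_measurable (PiM T (\<lambda>_. borel))" for i
    unfolding c_def by measurable
  have pm: "(\<lambda>(z, y). ?p z y) \<in> borel_measurable (?Z \<Otimes>\<^sub>M ?L)"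
    unfolding case_prod_beta' by measurable
  define q where "q y = (\<integral>\<^sup>+z. ?p z y \<partial>?Z)" for y
  have "(\<lambda>(y, z). ?p z y) \<in> borel_measurable (PiM {..<l} (\<lambda>_. borel) \<Otimes>\<^sub>M ?Z)"
    unfolding case_prod_beta' by measurable
  from Z.borel_measurable_nn_integral_fst[OF this]
  have qm: "q \<in> borel_measurable (PiM {..<l} (\<lambda>_. borel))" by (simp add: q_def[abs_def])
  have "(\<integral>\<^sup>+y. q y \<partial>?L) = (\<integral>\<^sup>+z. (\<integral>\<^sup>+y. ?p z y \<partial>?L) \<partial>?Z)"
    unfolding q_def using ZL.Fubini'[OF pm] by simp
  also have "\<dots> = (\<integral>\<^sup>+z. 1 \<partial>?Z)"
  proof -
    have "\<tau> i * s > 0" for i using X s by (simp add: \<tau>_def)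
    then show ?thesis by (intro nn_integral_cong nn_integral_cgauss_product_density) auto
  qed
  also have "\<dots> = 1" by (simp add: Z.emeasure_space_1)
  finally have q1: "(\<integral>\<^sup>+y. q y \<partial>?L) \<le> 1" by simp
  have bound: "(\<Prod>i<l. ennreal (cgauss_density s (v i))) \<le>
      ennreal (X ^ l * exp (3 * (\<Sum>i<l. (cmod (v i))\<^sup>2) / s + (3 * (\<Sum>i<l. (cmod (u i))\<^sup>2) / E
        + 2 * ((\<Sum>i\<in>T. (cmod (u i))\<^sup>2) + (\<Sum>j\<in>B. (cmod (\<Sum>i\<in>T. \<beta> j i * u i))\<^sup>2)) / E + (3 * l\<^sup>2 + 2 * l)))) *
      q (\<lambda>i\<in>{..<l}. (if i \<in> T then g1 * u i else g1 * u i + g2 * (\<Sum>k\<in>T. \<beta> i k * u k)) + \<nu> i + v i)" for u v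
  proof -
    let ?y = "\<lambda>i\<in>{..<l}. (if i \<in> T then g1 * u i else g1 * u i + g2 * (\<Sum>k\<in>T. \<beta> i k * u k)) + \<nu> i + v i"
    obtain e where e: "\<And>i. i \<in> T \<Longrightarrow> u i = x e i" using surj[of u] unfolding x_def by blast
    define Qu where "Qu = (\<Sum>i\<in>T. (cmod (u i))\<^sup>2) + (\<Sum>j\<in>B. (cmod (\<Sum>i\<in>T. \<beta> j i * u i))\<^sup>2)"
    have Qu: "Qu = (\<Sum>k\<in>T. (cmod (e k))\<^sup>2)"
      unfolding Qu_def A[of e, symmetric] x_def[symmetric] using e by (simp cong: sum.cong)
    \<comment> \<open>The inputs, in orthonormal coordinates, that cannot be told apart from
      \<open>u\<close> at gains in the outage region. A smaller radius would cost more prior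
      probability, a larger one would no longer be hidden by the noise.\<close>
    define S where "S = (\<Pi>\<^sub>E k\<in>T. {z. (cmod (z - e k))\<^sup>2 \<le> E / X})"
    have S: "S \<in> sets ?Z" unfolding S_def setsZ using finT by (intro sets_PiM_I_finite) auto
    \<comment> \<open>The factors 3 come from the square of a sum of three terms: noise, direct
      signal and error of the relayed combination. The last one contributes
      \<open>3 * l\<close>.\<close>
    define r where "r i = 3 * (cmod (v i))\<^sup>2 / s + 3 * (cmod (u i))\<^sup>2 / E + 3 * l" for i
    have r0: "r i \<ge> 0" for i using s E by (simp add: r_def)
    \<comment> \<open>The coordinates are orthonormal for the full quadratic form, so a single
      polydisc controls the errors of the source symbols and of the relay's combinations at
      once.\<close>
    have sq: "(\<Sum>i\<in>T. (cmod (x e i - x z i))\<^sup>2) + (\<Sum>j\<in>B. (cmod (\<Sum>i\<in>T. \<beta> j i * (x e i - x z i)))\<^sup>2) \<le> l * (E / X)"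
      if z: "z \<in> S" for z
    proof -
      have xd: "x e i - x z i = (\<Sum>k\<in>T. A i k * (e k - z k))" for i
        unfolding x_def by (simp add: sum_subtractf right_diff_distrib)
      have "(\<Sum>i\<in>T. (cmod (x e i - x z i))\<^sup>2) + (\<Sum>j\<in>B. (cmod (\<Sum>i\<in>T. \<beta> j i * (x e i - x z i)))\<^sup>2) =
          (\<Sum>k\<in>T. (cmod (e k - z k))\<^sup>2)"
        unfolding xd by (rule A)
      also have "\<dots> \<le> (\<Sum>k\<in>T. E / X)"
        using z by (intro sum_mono) (auto simp: S_def PiE_iff norm_minus_commute)
      also have "\<dots> \<le> l * (E / X)"
        using card E X by (simp add: divide_right_mono mult_right_mono)
      finally show ?thesis .
    qed
    have dens: "exp (- r i) / \<tau> i * cgauss_density s (v i) \<le> cgauss_density (\<tau> i * s) (?y i - c z i)"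
      if z: "z \<in> S" and i: "i < l" for z i
    proof (cases "i \<in> T")
      case True
      have "(cmod (x e i - x z i))\<^sup>2 \<le> (\<Sum>i\<in>T. (cmod (x e i - x z i))\<^sup>2)"
        using True finT by (intro member_le_sum) auto
      also have "\<dots> \<le> l * (E / X)"
        by (rule order_trans[OF _ sq[OF z]]) (simp add: sum_nonneg)
      finally have "(cmod g1)\<^sup>2 * (cmod (x e i - x z i))\<^sup>2 \<le> (cmod g1)\<^sup>2 * (l * (E / X))"
        by (intro mult_left_mono) auto
      also have "\<dots> = l * (E * (cmod g1)\<^sup>2 / X)" by simp
      also have "\<dots> \<le> l * s"
        using g1 X by (intro mult_left_mono) (auto simp: divide_le_eq mult.commute)
      finally have d: "(cmod (g1 * (x e i - x z i)))\<^sup>2 \<le> l * s"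
        by (simp add: norm_mult power_mult_distrib)
      have "?y i - c z i = v i + g1 * (x e i - x z i)"
        using True i e by (simp add: c_def algebra_simps)
      then have "(cmod (?y i - c z i))\<^sup>2 \<le> 2 * (cmod (v i))\<^sup>2 + 2 * (l * s)"
        using cmod_sum_square_le(1)[of "v i" "g1 * (x e i - x z i)"] d by simp
      also have "\<dots> \<le> 1 * (cmod (v i))\<^sup>2 + 1 * s * r i"
        using s E by (simp add: r_def field_simps)
      finally show ?thesis
        using exp_mult_cgauss_density_le[of s 1] s True by (simp add: \<tau>_def)
    next
      case False
      then have iB: "i \<in> B" using i by (simp add: B_def)
      let ?d = "\<Sum>k\<in>T. \<beta> i k * (x e k - x z k)"
      have "(cmod ?d)\<^sup>2 \<le> (\<Sum>j\<in>B. (cmod (\<Sum>i\<in>T. \<beta> j i * (x e i - x z i)))\<^sup>2)"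
        using iB finB by (intro member_le_sum) auto
      also have "\<dots> \<le> l * (E / X)"
        by (rule order_trans[OF _ sq[OF z]]) (simp add: sum_nonneg)
      finally have "(cmod g2)\<^sup>2 * (cmod ?d)\<^sup>2 \<le> (cmod g2)\<^sup>2 * (l * (E / X))"
        by (intro mult_left_mono) auto
      also have "\<dots> = l * (E * (cmod g2)\<^sup>2 / X)" by simp
      also have "\<dots> \<le> l * (X * s)"
        using g2 X by (intro mult_left_mono) (auto simp: divide_le_eq power2_eq_square mult_ac)
      finally have d: "(cmod (g2 * ?d))\<^sup>2 \<le> l * (X * s)"
        by (simp add: norm_mult power_mult_distrib)
      have "E * (cmod g1)\<^sup>2 * (cmod (u i))\<^sup>2 \<le> X * s * (cmod (u i))\<^sup>2"
        using g1 by (intro mult_right_mono) auto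
      then have d': "(cmod (g1 * u i))\<^sup>2 \<le> X * s * ((cmod (u i))\<^sup>2 / E)"
        using E by (simp add: norm_mult power_mult_distrib field_simps)
      have "(\<Sum>k\<in>T. \<beta> i k * u k) = (\<Sum>k\<in>T. \<beta> i k * x e k)" using e by simp
      then have "?y i - c z i = v i + g1 * u i + g2 * ?d"
        using False i by (simp add: c_def algebra_simps sum_subtractf sum_distrib_left)
      then have "(cmod (?y i - c z i))\<^sup>2 \<le> 3 * (cmod (v i))\<^sup>2 + 3 * (X * s * ((cmod (u i))\<^sup>2 / E)) + 3 * (l * (X * s))"
        using cmod_sum_square_le(2)[of "v i" "g1 * u i" "g2 * ?d"] d d' by simp
      also have "\<dots> \<le> 3 * X * (cmod (v i))\<^sup>2 + 3 * (X * s * ((cmod (u i))\<^sup>2 / E)) + 3 * (l * (X * s))"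
        using X mult_right_mono[of 1 X "3 * (cmod (v i))\<^sup>2"] by (simp add: mult_ac)
      also have "\<dots> = X * s * r i"
        using s by (simp add: r_def algebra_simps)
      also have "\<dots> \<le> X * (cmod (v i))\<^sup>2 + X * s * r i" using X by simp
      finally show ?thesis
        using exp_mult_cgauss_density_le[of s X] s X False by (simp add: \<tau>_def)
    qed
    define R where "R = (\<Sum>i<l. r i)"
    define P where "P = (\<Prod>i<l. cgauss_density s (v i))"
    have P0: "P \<ge> 0" unfolding P_def using s by (intro prod_nonneg) auto
    \<comment> \<open>Each relay symbol costs one factor X here, each symbol in \<open>T\<close>
      costs one through the prior probability of \<open>S\<close>; hence \<open>X ^ l\<close>,
      whatever the size of \<open>T\<close>.\<close>
    have "(\<Prod>i<l. \<tau> i) = X ^ card B"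
    proof -
      have "(\<Prod>i<l. \<tau> i) = (\<Prod>i\<in>T \<union> B. \<tau> i)" using T by (auto simp: B_def intro!: prod.cong)
      also have "\<dots> = (\<Prod>i\<in>T. \<tau> i) * (\<Prod>i\<in>B. \<tau> i)"
        using finT finB by (intro prod.union_disjoint) (auto simp: B_def)
      also have "\<dots> = X ^ card B" by (simp add: \<tau>_def B_def)
      finally show ?thesis .
    qed
    then have prod: "(\<Prod>i<l. exp (- r i) / \<tau> i * cgauss_density s (v i)) = exp (- R) / X ^ card B * P"
      by (simp add: prod.distrib prod_dividef exp_sum[symmetric] sum_negf R_def P_def)
    let ?\<delta> = "exp (- R) / X ^ card B * P"
    have \<delta>0: "?\<delta> \<ge> 0" using P0 X by simp
    have "ennreal ?\<delta> \<le> ?p z ?y" if z: "z \<in> S" for z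
    proof -
      have "ennreal ?\<delta> = (\<Prod>i<l. ennreal (exp (- r i) / \<tau> i * cgauss_density s (v i)))"
        unfolding prod[symmetric] using s order_trans[OF zero_le_one \<tau>]
        by (intro prod_ennreal[symmetric] mult_nonneg_nonneg divide_nonneg_nonneg) auto
      also have "\<dots> \<le> ?p z ?y"
        using dens[OF z] by (intro prod_mono_ennreal ennreal_leI) auto
      finally show ?thesis .
    qed
    then have "(\<integral>\<^sup>+z. ennreal ?\<delta> * indicator S z \<partial>?Z) \<le> q ?y"
      unfolding q_def by (intro nn_integral_mono) (auto simp: indicator_def)
    then have 1: "ennreal ?\<delta> * emeasure ?Z S \<le> q ?y"
      using S by (simp add: nn_integral_cmult_indicator)
    let ?\<epsilon> = "(1 / X) ^ card T * exp (- (2 * Qu / E + 2 * l))"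
    have "ennreal ?\<epsilon> \<le> ennreal ((E / X / E) ^ card T * exp (- ((2 * (\<Sum>k\<in>T. (cmod (e k))\<^sup>2) + 2 * (E / X) * card T) / E)))"
    proof -
      have "card T / X \<le> l"
        using card X by (metis divide_le_eq_1_pos div_by_1 frac_le le_numeral_extra(1) of_nat_0_le_iff of_nat_mono zero_less_one)
      then have "(2 * (\<Sum>k\<in>T. (cmod (e k))\<^sup>2) + 2 * (E / X) * card T) / E \<le> 2 * Qu / E + 2 * l"
        unfolding Qu using E by (simp add: add_divide_distrib)
      then show ?thesis using E X by (intro ennreal_leI mult_mono) auto
    qed
    also have "\<dots> \<le> emeasure ?Z S"
      unfolding S_def using E X by (intro emeasure_PiM_cgauss_polydisc_ge finT) auto
    finally have "ennreal (?\<delta> * ?\<epsilon>) \<le> q ?y"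
      using 1 \<delta>0 X by (subst ennreal_mult) (auto intro: order_trans[OF mult_left_mono])
    then have 2: "ennreal (X ^ l * exp (R + (2 * Qu / E + 2 * l))) * ennreal (?\<delta> * ?\<epsilon>) \<le>
        ennreal (X ^ l * exp (R + (2 * Qu / E + 2 * l))) * q ?y"
      by (intro mult_left_mono) auto
    have eq: "X ^ l * exp (R + (2 * Qu / E + 2 * l)) * (?\<delta> * ?\<epsilon>) = P"
    proof -
      have "X ^ l = X ^ card T * X ^ card B" unfolding power_add[symmetric] card(1) ..
      moreover have "exp (R + (2 * Qu / E + 2 * l)) * (exp (- R) * exp (- (2 * Qu / E + 2 * l))) = 1"
        unfolding exp_add[symmetric] by simp
      ultimately show ?thesis using X by (simp add: field_simps)
    qed
    have "0 \<le> ?\<delta> * ?\<epsilon>" using X by (intro mult_nonneg_nonneg[OF \<delta>0]) auto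
    then have "ennreal (X ^ l * exp (R + (2 * Qu / E + 2 * l)) * (?\<delta> * ?\<epsilon>)) =
        ennreal (X ^ l * exp (R + (2 * Qu / E + 2 * l))) * ennreal (?\<delta> * ?\<epsilon>)"
      using X by (intro ennreal_mult) auto
    then have "ennreal P = ennreal (X ^ l * exp (R + (2 * Qu / E + 2 * l))) * ennreal (?\<delta> * ?\<epsilon>)"
      by (simp only: eq)
    then have "ennreal P \<le> ennreal (X ^ l * exp (R + (2 * Qu / E + 2 * l))) * q ?y"
      using 2 by simp
    moreover have "ennreal P = (\<Prod>i<l. ennreal (cgauss_density s (v i)))"
      unfolding P_def using s by (intro prod_ennreal[symmetric]) auto
    moreover have "R + (2 * Qu / E + 2 * l) = 3 * (\<Sum>i<l. (cmod (v i))\<^sup>2) / s + (3 * (\<Sum>i<l. (cmod (u i))\<^sup>2) / E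
        + 2 * Qu / E + (3 * l\<^sup>2 + 2 * l))"
      by (simp add: R_def r_def sum.distrib sum_divide_distrib sum_distrib_left power2_eq_square)
    ultimately show ?thesis by (simp only: Qu_def)
  qed
  show ?thesis by (intro bexI[OF _ qm] conjI allI q1 bound)
qed

section \<open>Averages over the messages and the code ensemble\<close>

definition mean_over :: "nat \<Rightarrow> codebook measure \<Rightarrow> ((nat \<Rightarrow> complex) \<Rightarrow> real) \<Rightarrow> ennreal" where
  "mean_over M Q f = (\<Sum>m<M. \<integral>\<^sup>+c. ennreal (f (c m)) \<partial>Q) / of_nat M"

lemma mean_energy_eq: "mean_energy M Q f = mean_over M Q (\<lambda>x. (cmod (f x))\<^sup>2)"
  by (simp add: mean_energy_def mean_over_def)

lemma mean_over_mono:
  assumes "mean_over M Q g \<le> e" "\<And>x. f x \<le> g x"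
  shows "mean_over M Q f \<le> e"
  using assms(1) unfolding mean_over_def
  by (rule order_trans[rotated]) (intro divide_right_mono_ennreal sum_mono nn_integral_mono ennreal_leI assms(2))

lemma mean_over_const:
  assumes "code_ensemble M l Q" "M > 0" "a \<ge> 0"
  shows "mean_over M Q (\<lambda>_. a) \<le> ennreal a"
proof -
  interpret prob_space Q using assms by (simp add: code_ensemble_def)
  show ?thesis using assms
    by (simp add: mean_over_def emeasure_space_1 ennreal_of_nat_eq_real_of_nat ennreal_mult[symmetric] divide_ennreal)
qed

lemma measurable_codeword_ensemble:
  assumes Q: "code_ensemble M l Q" and "m < M"
    and f: "f \<in> borel_measurable (PiM {..<l} (\<lambda>_. borel))"
  shows "(\<lambda>c. ennreal (f (c m))) \<in> borel_measurable Q"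
proof -
  have "sets Q = sets (codebook_space M l)" using Q by (simp add: code_ensemble_def)
  then show ?thesis
    using measurable_compose[OF measurable_codeword[OF assms(2)] f]
    by (simp add: measurable_cong_sets[OF \<open>sets Q = _\<close> refl])
qed

lemma mean_over_add:
  assumes Q: "code_ensemble M l Q"
    and f: "f \<in> borel_measurable (PiM {..<l} (\<lambda>_. borel))" and g: "g \<in> borel_measurable (PiM {..<l} (\<lambda>_. borel))"
    and "\<And>x. f x \<ge> 0" "\<And>x. g x \<ge> 0" "a \<ge> 0" "b \<ge> 0"
    and "mean_over M Q f \<le> ennreal a" "mean_over M Q g \<le> ennreal b"
  shows "mean_over M Q (\<lambda>x. f x + g x) \<le> ennreal (a + b)"
proof -
  have "mean_over M Q (\<lambda>x. f x + g x) = mean_over M Q f + mean_over M Q g"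
  proof -
    have "(\<integral>\<^sup>+c. ennreal (f (c m) + g (c m)) \<partial>Q) = (\<integral>\<^sup>+c. ennreal (f (c m)) \<partial>Q) + (\<integral>\<^sup>+c. ennreal (g (c m)) \<partial>Q)"
      if "m < M" for m
      using nn_integral_add[OF measurable_codeword_ensemble[OF Q that f] measurable_codeword_ensemble[OF Q that g]]
        assms(4,5) by simp
    then have "(\<Sum>m<M. \<integral>\<^sup>+c. ennreal (f (c m) + g (c m)) \<partial>Q) =
        (\<Sum>m<M. (\<integral>\<^sup>+c. ennreal (f (c m)) \<partial>Q) + (\<integral>\<^sup>+c. ennreal (g (c m)) \<partial>Q))"
      by (intro sum.cong) auto
    then show ?thesis
      unfolding mean_over_def by (simp add: sum.distrib divide_ennreal_def distrib_right)
  qed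
  then show ?thesis using assms by (simp add: add_mono)
qed

lemma mean_over_cmult:
  assumes Q: "code_ensemble M l Q"
    and f: "f \<in> borel_measurable (PiM {..<l} (\<lambda>_. borel))"
    and "\<And>x. f x \<ge> 0" "a \<ge> 0" "b \<ge> 0" and "mean_over M Q f \<le> ennreal a"
  shows "mean_over M Q (\<lambda>x. b * f x) \<le> ennreal (b * a)"
proof -
  have "mean_over M Q (\<lambda>x. b * f x) = ennreal b * mean_over M Q f"
  proof -
    have "(\<integral>\<^sup>+c. ennreal (b * f (c m)) \<partial>Q) = ennreal b * (\<integral>\<^sup>+c. ennreal (f (c m)) \<partial>Q)" if "m < M" for m
      using nn_integral_cmult[OF measurable_codeword_ensemble[OF Q that f]] assms(3,5)
      by (simp add: ennreal_mult)
    then have "(\<Sum>m<M. \<integral>\<^sup>+c. ennreal (b * f (c m)) \<partial>Q) =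
        (\<Sum>m<M. ennreal b * (\<integral>\<^sup>+c. ennreal (f (c m)) \<partial>Q))"
      by (intro sum.cong) auto
    then show ?thesis
      unfolding mean_over_def by (simp add: sum_distrib_left[symmetric] divide_ennreal_def mult.assoc)
  qed
  then show ?thesis using assms by (simp add: ennreal_mult mult_left_mono)
qed

lemma mean_over_sum:
  fixes a :: real
  assumes Q: "code_ensemble M l Q" and M: "M > 0" and J: "finite J"
    and f: "\<And>j. j \<in> J \<Longrightarrow> f j \<in> borel_measurable (PiM {..<l} (\<lambda>_. borel))"
    and "\<And>j x. f j x \<ge> 0" "a \<ge> 0" and "\<And>j. j \<in> J \<Longrightarrow> mean_over M Q (f j) \<le> ennreal a"
  shows "mean_over M Q (\<lambda>x. \<Sum>j\<in>J. f j x) \<le> ennreal (card J * a)"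
  using J f assms(7)
proof (induction J)
  case empty
  then show ?case using mean_over_const[OF Q M, of 0] by simp
next
  case (insert j J)
  have "mean_over M Q (\<lambda>x. f j x + (\<Sum>j\<in>J. f j x)) \<le> ennreal (a + card J * a)"
    using insert assms by (intro mean_over_add[OF Q]) (auto intro!: sum_nonneg)
  then show ?case using insert by (simp add: algebra_simps)
qed

text \<open>The common form of the two relaying schemes for a given relay gain: \<open>T\<close> is the set of
  symbols that the relay listens to.\<close>

definition relay_form ::
    "nat \<Rightarrow> nat set \<Rightarrow> (nat \<Rightarrow> (nat \<Rightarrow> complex) \<Rightarrow> complex) \<Rightarrow> (nat \<Rightarrow> nat \<Rightarrow> complex) \<Rightarrow>
     complex \<Rightarrow> complex \<Rightarrow> ((nat \<Rightarrow> complex) \<Rightarrow> nat \<Rightarrow> complex) \<Rightarrow> scheme \<Rightarrow> bool" where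
  "relay_form l T u \<beta> g1 g2 \<nu> F \<longleftrightarrow> (\<forall>x w. \<forall>i<l. F x w i =
     (if i \<in> T then g1 * u i x else g1 * u i x + g2 * (\<Sum>k\<in>T. \<beta> i k * u k x)) + \<nu> w i)"

text \<open>\<open>u\<close> holds the symbols as transmitted by the source; together with
  \<open>T\<close> it is fixed before the gains, of which the source knows none, whereas \<beta> and
  \<nu> may depend on them. The last bound concerns the signal part of the relay's transmission: the
  noise part is in \<nu>, which the converse gives to the destination.\<close>

definition relay_linear ::
    "real \<Rightarrow> nat \<Rightarrow> (complex \<Rightarrow> complex \<Rightarrow> complex \<Rightarrow> scheme) \<Rightarrow> nat \<Rightarrow> codebook measure \<Rightarrow> bool" where
  "relay_linear E l F M Q \<longleftrightarrow>
     (\<exists>T u. T \<subseteq> {..<l} \<and> (\<forall>i<l. u i \<in> borel_measurable (PiM {..<l} (\<lambda>_. borel))) \<and>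
       (\<forall>i<l. mean_energy M Q (u i) \<le> ennreal E) \<and>
       (\<forall>g1 g2 h. \<exists>\<beta> \<nu>. relay_form l T u \<beta> g1 g2 \<nu> (F g1 g2 h) \<and>
          (\<forall>i\<in>{..<l} - T. mean_energy M Q (\<lambda>x. \<Sum>k\<in>T. \<beta> i k * u k x) \<le> ennreal E)))"

lemma relay_linear_at:
  assumes "relay_linear E l F M Q"
  shows "\<exists>T u \<beta> \<nu>. T \<subseteq> {..<l} \<and> (\<forall>i<l. u i \<in> borel_measurable (PiM {..<l} (\<lambda>_. borel))) \<and>
    (\<forall>i<l. mean_energy M Q (u i) \<le> ennreal E) \<and> relay_form l T u \<beta> g1 g2 \<nu> (F g1 g2 h) \<and>
    (\<forall>i\<in>{..<l} - T. mean_energy M Q (\<lambda>x. \<Sum>k\<in>T. \<beta> i k * u k x) \<le> ennreal E)"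
proof -
  from assms obtain T u where *: "T \<subseteq> {..<l}"
    "\<forall>i<l. u i \<in> borel_measurable (PiM {..<l} (\<lambda>_. borel))" "\<forall>i<l. mean_energy M Q (u i) \<le> ennreal E"
    "\<forall>g1 g2 h. \<exists>\<beta> \<nu>. relay_form l T u \<beta> g1 g2 \<nu> (F g1 g2 h) \<and>
          (\<forall>i\<in>{..<l} - T. mean_energy M Q (\<lambda>x. \<Sum>k\<in>T. \<beta> i k * u k x) \<le> ennreal E)"
    unfolding relay_linear_def by (elim exE conjE)
  from *(4)[rule_format, of g1 g2 h] obtain \<beta> \<nu> where "relay_form l T u \<beta> g1 g2 \<nu> (F g1 g2 h)"
    "\<forall>i\<in>{..<l} - T. mean_energy M Q (\<lambda>x. \<Sum>k\<in>T. \<beta> i k * u k x) \<le> ennreal E"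
    by (elim exE conjE)
  with *(1-3) show ?thesis by (intro exI conjI)
qed

text \<open>The constant is 3 l from the noise, 5 l from the mean energies and 3 l^2 + 2 l from
  \<open>reference_density\<close>.\<close>

lemma conditional_success_outage:
  assumes F: "measurable_scheme l n F" and s: "sv2 > 0" "sw2 > 0" and Q: "code_ensemble M l Q"
    and M: "M > 0" and E: "E > 0" and lin: "relay_linear E l F M Q" and X: "X \<ge> 1" and a: "a > 0"
    and g1: "E * (cmod (fst g))\<^sup>2 \<le> X * sv2" and g2: "E * (cmod (fst (snd g)))\<^sup>2 \<le> X\<^sup>2 * sv2"
  shows "1 - conditional_error sv2 sw2 l n (at_gains F g) M Q \<le> (3 * real l ^ 2 + 10 * l) / a + X ^ l * exp a / M"
proof -
  let ?g1 = "fst g" and ?g2 = "fst (snd g)"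
  from relay_linear_at[OF lin, where ?g1.0 = "fst g" and ?g2.0 = "fst (snd g)" and h = "snd (snd g)"]
  obtain T u \<beta> \<nu> where T: "T \<subseteq> {..<l}"
    and u': "\<forall>i<l. u i \<in> borel_measurable (PiM {..<l} (\<lambda>_. borel))"
    and en1': "\<forall>i<l. mean_energy M Q (u i) \<le> ennreal E"
    and form: "relay_form l T u \<beta> ?g1 ?g2 \<nu> (at_gains F g)"
    and en2': "\<forall>i\<in>{..<l} - T. mean_energy M Q (\<lambda>x. \<Sum>k\<in>T. \<beta> i k * u k x) \<le> ennreal E"
    by (elim exE conjE)
  note u [measurable] = u'[rule_format] and en1 = en1'[rule_format] and en2 = en2'[rule_format]
  let ?B = "{..<l} - T"
  define \<tau> where "\<tau> x = 3 * (\<Sum>i<l. (cmod (u i x))\<^sup>2) / E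
        + 2 * ((\<Sum>i\<in>T. (cmod (u i x))\<^sup>2) + (\<Sum>j\<in>?B. (cmod (\<Sum>i\<in>T. \<beta> j i * u i x))\<^sup>2)) / E + (3 * l\<^sup>2 + 2 * l)" for x
  have "\<forall>w. \<exists>q. q \<in> borel_measurable (PiM {..<l} (\<lambda>_. borel)) \<and>
      (\<integral>\<^sup>+y. q y \<partial>PiM {..<l} (\<lambda>_. lborel)) \<le> 1 \<and>
      (\<forall>x v. (\<Prod>i<l. ennreal (cgauss_density sv2 (v i))) \<le>
         ennreal (X ^ l * exp (3 * (\<Sum>i<l. (cmod (v i))\<^sup>2) / sv2 + \<tau> x)) *
         q (\<lambda>i\<in>{..<l}. at_gains F g x w i + v i))"
  proof
    fix w
    from reference_density[OF T E s(1) X g1 g2, where \<beta> = \<beta> and \<nu> = "\<nu> w"]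
    obtain q where q: "q \<in> borel_measurable (PiM {..<l} (\<lambda>_. borel))"
      "(\<integral>\<^sup>+y. q y \<partial>PiM {..<l} (\<lambda>_. lborel)) \<le> 1"
      "\<forall>u v. (\<Prod>i<l. ennreal (cgauss_density sv2 (v i))) \<le>
      ennreal (X ^ l * exp (3 * (\<Sum>i<l. (cmod (v i))\<^sup>2) / sv2 + (3 * (\<Sum>i<l. (cmod (u i))\<^sup>2) / E
        + 2 * ((\<Sum>i\<in>T. (cmod (u i))\<^sup>2) + (\<Sum>j\<in>?B. (cmod (\<Sum>i\<in>T. \<beta> j i * u i))\<^sup>2)) / E + (3 * l\<^sup>2 + 2 * l)))) *
      q (\<lambda>i\<in>{..<l}. (if i \<in> T then ?g1 * u i else ?g1 * u i + ?g2 * (\<Sum>k\<in>T. \<beta> i k * u k)) + \<nu> w i + v i)"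
      by (elim bexE conjE)
    have "(\<lambda>i\<in>{..<l}. at_gains F g x w i + v i) =
        (\<lambda>i\<in>{..<l}. (if i \<in> T then ?g1 * u i x else ?g1 * u i x + ?g2 * (\<Sum>k\<in>T. \<beta> i k * u k x)) + \<nu> w i + v i)" for x v
      using form by (auto simp: relay_form_def fun_eq_iff)
    then have "\<forall>x v. (\<Prod>i<l. ennreal (cgauss_density sv2 (v i))) \<le>
         ennreal (X ^ l * exp (3 * (\<Sum>i<l. (cmod (v i))\<^sup>2) / sv2 + \<tau> x)) *
         q (\<lambda>i\<in>{..<l}. at_gains F g x w i + v i)"
      unfolding \<tau>_def using q(3)[rule_format, where u = "\<lambda>i. u i _"] by (simp only: simp_thms)
    with q(1,2) show "\<exists>q. q \<in> borel_measurable (PiM {..<l} (\<lambda>_. borel)) \<and>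
      (\<integral>\<^sup>+y. q y \<partial>PiM {..<l} (\<lambda>_. lborel)) \<le> 1 \<and>
      (\<forall>x v. (\<Prod>i<l. ennreal (cgauss_density sv2 (v i))) \<le>
         ennreal (X ^ l * exp (3 * (\<Sum>i<l. (cmod (v i))\<^sup>2) / sv2 + \<tau> x)) *
         q (\<lambda>i\<in>{..<l}. at_gains F g x w i + v i))" by (intro exI conjI)
  qed
  from choice[OF this] obtain q where *: "\<forall>w. q w \<in> borel_measurable (PiM {..<l} (\<lambda>_. borel)) \<and>
      (\<integral>\<^sup>+y. q w y \<partial>PiM {..<l} (\<lambda>_. lborel)) \<le> 1 \<and>
      (\<forall>x v. (\<Prod>i<l. ennreal (cgauss_density sv2 (v i))) \<le>
         ennreal (X ^ l * exp (3 * (\<Sum>i<l. (cmod (v i))\<^sup>2) / sv2 + \<tau> x)) *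
         q w (\<lambda>i\<in>{..<l}. at_gains F g x w i + v i))" by (elim exE)
  have q: "q w \<in> borel_measurable (PiM {..<l} (\<lambda>_. borel))"
      "(\<integral>\<^sup>+y. q w y \<partial>PiM {..<l} (\<lambda>_. lborel)) \<le> 1"
      "(\<Prod>i<l. ennreal (cgauss_density sv2 (v i))) \<le>
         ennreal (X ^ l * exp (3 * (\<Sum>i<l. (cmod (v i))\<^sup>2) / sv2 + \<tau> x)) *
         q w (\<lambda>i\<in>{..<l}. at_gains F g x w i + v i)" for x w v
    using *[rule_format, of w] by (elim conjE; simp only:)+
  have uT [measurable]: "i \<in> T \<Longrightarrow> u i \<in> borel_measurable (PiM {..<l} (\<lambda>_. borel))" for i using T by (auto intro: u)
  \<comment> \<open>Sorting \<tau> by symbols: the quadratic form has one term for each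
    \<open>i < l\<close>, bounded by the source's energy constraint on \<open>T\<close> and by the
    relay's elsewhere. Each \<open>p i\<close> thus has mean at most 3 + 2.\<close>
  define p where "p i x = 3 / E * (cmod (u i x))\<^sup>2 +
      (2 / E * (if i \<in> T then (cmod (u i x))\<^sup>2 else (cmod (\<Sum>k\<in>T. \<beta> i k * u k x))\<^sup>2))" for i x
  have pm: "p i \<in> borel_measurable (PiM {..<l} (\<lambda>_. borel))" if i: "i < l" for i
    unfolding p_def using u[OF i] by measurable
  have p0: "p i x \<ge> 0" for i x using E by (auto simp: p_def)
  have pE: "mean_over M Q (p i) \<le> ennreal 5" if i: "i < l" for i
  proof -
    have 1: "mean_over M Q (\<lambda>x. 3 / E * (cmod (u i x))\<^sup>2) \<le> ennreal (3 / E * E)"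
      using en1[OF i] E u[OF i] unfolding mean_energy_eq by (intro mean_over_cmult[OF Q]) auto
    have "mean_over M Q (\<lambda>x. if i \<in> T then (cmod (u i x))\<^sup>2 else (cmod (\<Sum>k\<in>T. \<beta> i k * u k x))\<^sup>2) \<le> ennreal E"
      using en1[OF i] en2[of i] i unfolding mean_energy_eq by (cases "i \<in> T") auto
    then have "mean_over M Q (\<lambda>x. 2 / E * (if i \<in> T then (cmod (u i x))\<^sup>2 else (cmod (\<Sum>k\<in>T. \<beta> i k * u k x))\<^sup>2)) \<le> ennreal (2 / E * E)"
      using E u[OF i] by (intro mean_over_cmult[OF Q]) auto
    from mean_over_add[OF Q _ _ _ _ _ _ 1 this] show ?thesis
      using E u[OF i] by (simp add: p_def[abs_def])
  qed
  have \<tau>p: "\<tau> x = (\<Sum>i<l. p i x) + (3 * l\<^sup>2 + 2 * l)" for x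
  proof -
    have "(\<Sum>i<l. if i \<in> T then (cmod (u i x))\<^sup>2 else (cmod (\<Sum>k\<in>T. \<beta> i k * u k x))\<^sup>2) =
        (\<Sum>i\<in>T. (cmod (u i x))\<^sup>2) + (\<Sum>j\<in>?B. (cmod (\<Sum>i\<in>T. \<beta> j i * u i x))\<^sup>2)"
      using T by (simp add: sum.If_cases Int_absorb1 Diff_eq)
    moreover have "(\<Sum>i<l. p i x) = 3 / E * (\<Sum>i<l. (cmod (u i x))\<^sup>2) +
        2 / E * (\<Sum>i<l. if i \<in> T then (cmod (u i x))\<^sup>2 else (cmod (\<Sum>k\<in>T. \<beta> i k * u k x))\<^sup>2)"
      unfolding p_def by (simp only: sum.distrib sum_distrib_left)
    ultimately show ?thesis by (simp add: \<tau>_def)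
  qed
  have "mean_over M Q \<tau> \<le> ennreal (real (card {..<l}) * 5 + real (3 * l\<^sup>2 + 2 * l))"
    unfolding \<tau>p[abs_def] using pm p0
    by (intro mean_over_add[OF Q] mean_over_sum[OF Q M] mean_over_const[OF Q M] pE) (auto intro!: sum_nonneg)
  then have mean: "(\<Sum>m<M. \<integral>\<^sup>+c. ennreal (\<tau> (c m)) \<partial>Q) / of_nat M \<le> ennreal (3 * l\<^sup>2 + 7 * l)"
    by (simp add: mean_over_def algebra_simps)
  have "\<tau> \<in> borel_measurable (PiM {..<l} (\<lambda>_. borel))"
    unfolding \<tau>p[abs_def] using pm by measurable
  moreover have "\<tau> x \<ge> 0" for x unfolding \<tau>p using p0 by (intro add_nonneg_nonneg sum_nonneg) auto
  ultimately have "1 - conditional_error sv2 sw2 l n (at_gains F g) M Q \<le> (3 * real l + real (3 * l\<^sup>2 + 7 * l)) / a + X ^ l * exp a / M"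
    by (intro conditional_success_le[OF F s Q M q(1,2) _ _ _ _ a _ q(3) mean]) (use X in auto)
  then show ?thesis by (simp add: algebra_simps)
qed

text \<open>The reference density is that of the noise alone, so \<open>K = 1\<close> and nothing is
  lost even with two messages. The whole signal counts as a displacement, of mean energy at most 4
  \<delta> times the noise variance in each symbol.\<close>

lemma conditional_success_silence:
  assumes F: "measurable_scheme l n F" and s: "sv2 > 0" "sw2 > 0" and Q: "code_ensemble M l Q"
    and M: "M > 0" and E: "E > 0" and lin: "relay_linear E l F M Q" and a: "a > 0"
    and \<eta>: "\<eta> > 0" and \<delta>: "\<delta> \<ge> 0"
    and g1: "E * (cmod (fst g))\<^sup>2 \<le> \<delta> * sv2" and g2: "E * (cmod (fst (snd g)))\<^sup>2 \<le> \<delta> * sv2"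
  shows "1 - conditional_error sv2 sw2 l n (at_gains F g) M Q \<le> (\<eta> * l + (1 + 1 / \<eta>) * 4 * \<delta> * l) / a + exp a / M"
proof -
  let ?g1 = "fst g" and ?g2 = "fst (snd g)"
  from relay_linear_at[OF lin, where ?g1.0 = "fst g" and ?g2.0 = "fst (snd g)" and h = "snd (snd g)"]
  obtain T u \<beta> \<nu> where T: "T \<subseteq> {..<l}"
    and u': "\<forall>i<l. u i \<in> borel_measurable (PiM {..<l} (\<lambda>_. borel))"
    and en1': "\<forall>i<l. mean_energy M Q (u i) \<le> ennreal E"
    and form: "relay_form l T u \<beta> ?g1 ?g2 \<nu> (at_gains F g)"
    and en2': "\<forall>i\<in>{..<l} - T. mean_energy M Q (\<lambda>x. \<Sum>k\<in>T. \<beta> i k * u k x) \<le> ennreal E"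
    by (elim exE conjE)
  note u [measurable] = u'[rule_format] and en1 = en1'[rule_format] and en2 = en2'[rule_format]
  have uT [measurable]: "i \<in> T \<Longrightarrow> u i \<in> borel_measurable (PiM {..<l} (\<lambda>_. borel))" for i using T by (auto intro: u)
  define d where "d i x = (if i \<in> T then ?g1 * u i x else ?g1 * u i x + ?g2 * (\<Sum>k\<in>T. \<beta> i k * u k x))" for i x
  define \<tau> where "\<tau> x = (1 + 1 / \<eta>) / sv2 * (\<Sum>i<l. (cmod (d i x))\<^sup>2)" for x
  define q where "q w y = (\<Prod>i<l. ennreal (cgauss_density sv2 (y i - \<nu> w i)))" for w and y :: "nat \<Rightarrow> complex"
  have q: "q w \<in> borel_measurable (PiM {..<l} (\<lambda>_. borel))" for w unfolding q_def[abs_def] by measurable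
  have q1: "(\<integral>\<^sup>+y. q w y \<partial>PiM {..<l} (\<lambda>_. lborel)) \<le> 1" for w
    unfolding q_def using s by (subst nn_integral_cgauss_product_density) auto
  have bound: "(\<Prod>i<l. ennreal (cgauss_density sv2 (v i))) \<le>
      ennreal (1 * exp (\<eta> * (\<Sum>i<l. (cmod (v i))\<^sup>2) / sv2 + \<tau> x)) * q w (\<lambda>i\<in>{..<l}. at_gains F g x w i + v i)" for x w v
  proof -
    have y: "at_gains F g x w i + v i - \<nu> w i = v i + d i x" if "i < l" for i
      using form that by (auto simp: relay_form_def d_def)
    have each: "cgauss_density sv2 (v i) \<le>
        exp (\<eta> * (cmod (v i))\<^sup>2 / sv2 + (1 + 1 / \<eta>) / sv2 * (cmod (d i x))\<^sup>2) * cgauss_density sv2 (v i + d i x)" for i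
    proof -
      have "(cmod (v i + d i x))\<^sup>2 \<le> (cmod (v i) + cmod (d i x))\<^sup>2"
        by (intro power_mono norm_triangle_ineq) auto
      \<comment> \<open>Young's inequality with a free parameter: with \<eta> small, the noise
        contributes only \<eta> l to the mean of the exponent.\<close>
      also have "\<dots> \<le> (1 + \<eta>) * (cmod (v i))\<^sup>2 + (1 + 1 / \<eta>) * (cmod (d i x))\<^sup>2"
        using sum_squares_bound[of "sqrt \<eta> * cmod (v i)" "cmod (d i x) / sqrt \<eta>"] \<eta>
        by (simp add: power2_sum algebra_simps power_mult_distrib power_divide)
      finally have "(cmod (v i + d i x))\<^sup>2 / sv2 \<le> ((1 + \<eta>) * (cmod (v i))\<^sup>2 + (1 + 1 / \<eta>) * (cmod (d i x))\<^sup>2) / sv2"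
        using s by (intro divide_right_mono) auto
      then have "exp (- (cmod (v i))\<^sup>2 / sv2) \<le>
          exp (\<eta> * (cmod (v i))\<^sup>2 / sv2 + (1 + 1 / \<eta>) / sv2 * (cmod (d i x))\<^sup>2) * exp (- (cmod (v i + d i x))\<^sup>2 / sv2)"
        by (simp add: exp_add[symmetric] add_divide_distrib distrib_right)
      then show ?thesis
        using s unfolding cgauss_density_def times_divide_eq_right by (intro divide_right_mono) auto
    qed
    have "(\<Prod>i<l. ennreal (cgauss_density sv2 (v i))) \<le>
        (\<Prod>i<l. ennreal (exp (\<eta> * (cmod (v i))\<^sup>2 / sv2 + (1 + 1 / \<eta>) / sv2 * (cmod (d i x))\<^sup>2)) * ennreal (cgauss_density sv2 (v i + d i x)))"
      using each by (intro prod_mono_ennreal) (simp add: ennreal_mult'[symmetric] ennreal_leI)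
    also have "\<dots> = ennreal (\<Prod>i<l. exp (\<eta> * (cmod (v i))\<^sup>2 / sv2 + (1 + 1 / \<eta>) / sv2 * (cmod (d i x))\<^sup>2)) *
        q w (\<lambda>i\<in>{..<l}. at_gains F g x w i + v i)"
      by (simp add: prod.distrib prod_ennreal q_def y)
    also have "(\<Prod>i<l. exp (\<eta> * (cmod (v i))\<^sup>2 / sv2 + (1 + 1 / \<eta>) / sv2 * (cmod (d i x))\<^sup>2)) =
        1 * exp (\<eta> * (\<Sum>i<l. (cmod (v i))\<^sup>2) / sv2 + \<tau> x)"
      unfolding \<tau>_def by (simp add: exp_sum[symmetric] sum.distrib sum_distrib_left sum_divide_distrib)
    finally show ?thesis .
  qed
  have dm: "d i \<in> borel_measurable (PiM {..<l} (\<lambda>_. borel))" if i: "i < l" for i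
    unfolding d_def using u[OF i] by measurable
  have dE: "mean_over M Q (\<lambda>x. (cmod (d i x))\<^sup>2) \<le> ennreal (4 * \<delta> * sv2)" if i: "i < l" for i
  proof -
    let ?r = "\<lambda>x. if i \<in> T then 0 else \<Sum>k\<in>T. \<beta> i k * u k x"
    have 1: "mean_over M Q (\<lambda>x. 2 * (cmod ?g1)\<^sup>2 * (cmod (u i x))\<^sup>2) \<le> ennreal (2 * (cmod ?g1)\<^sup>2 * E)"
      using en1[OF i] E u[OF i] unfolding mean_energy_eq by (intro mean_over_cmult[OF Q]) auto
    have "mean_over M Q (\<lambda>x. (cmod (?r x))\<^sup>2) \<le> ennreal E"
      using en2[of i] i E mean_over_const[OF Q M, of 0] unfolding mean_energy_eq by (cases "i \<in> T") auto
    then have 2: "mean_over M Q (\<lambda>x. 2 * (cmod ?g2)\<^sup>2 * (cmod (?r x))\<^sup>2) \<le> ennreal (2 * (cmod ?g2)\<^sup>2 * E)"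
      using E by (intro mean_over_cmult[OF Q]) auto
    have "mean_over M Q (\<lambda>x. 2 * (cmod ?g1)\<^sup>2 * (cmod (u i x))\<^sup>2 + 2 * (cmod ?g2)\<^sup>2 * (cmod (?r x))\<^sup>2) \<le>
        ennreal (2 * (cmod ?g1)\<^sup>2 * E + 2 * (cmod ?g2)\<^sup>2 * E)"
      using E u[OF i] by (intro mean_over_add[OF Q _ _ _ _ _ _ 1 2]) auto
    also have "\<dots> \<le> ennreal (4 * \<delta> * sv2)"
      using g1 g2 by (intro ennreal_leI) (simp add: mult_ac)
    finally show ?thesis
    proof (rule mean_over_mono)
      fix x
      have "d i x = ?g1 * u i x + ?g2 * ?r x" by (simp add: d_def)
      then show "(cmod (d i x))\<^sup>2 \<le> 2 * (cmod ?g1)\<^sup>2 * (cmod (u i x))\<^sup>2 + 2 * (cmod ?g2)\<^sup>2 * (cmod (?r x))\<^sup>2"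
        using cmod_sum_square_le(1)[of "?g1 * u i x" "?g2 * ?r x"]
        by (simp only: norm_mult power_mult_distrib mult.assoc)
    qed
  qed
  have sum: "mean_over M Q (\<lambda>x. \<Sum>i<l. (cmod (d i x))\<^sup>2) \<le> ennreal (card {..<l} * (4 * \<delta> * sv2))"
    using dm dE \<delta> s by (intro mean_over_sum[OF Q M]) auto
  have "mean_over M Q \<tau> \<le> ennreal ((1 + 1 / \<eta>) / sv2 * (card {..<l} * (4 * \<delta> * sv2)))"
    unfolding \<tau>_def[abs_def] using dm \<eta> s \<delta> by (intro mean_over_cmult[OF Q _ _ _ _ sum]) (auto intro!: sum_nonneg)
  also have "(1 + 1 / \<eta>) / sv2 * (card {..<l} * (4 * \<delta> * sv2)) = (1 + 1 / \<eta>) * 4 * \<delta> * l"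
    using s by simp
  finally have mean: "(\<Sum>m<M. \<integral>\<^sup>+c. ennreal (\<tau> (c m)) \<partial>Q) / of_nat M \<le> ennreal ((1 + 1 / \<eta>) * 4 * \<delta> * l)"
    by (simp add: mean_over_def)
  have "\<tau> \<in> borel_measurable (PiM {..<l} (\<lambda>_. borel))"
    unfolding \<tau>_def[abs_def] using dm by measurable
  moreover have "\<tau> x \<ge> 0" for x unfolding \<tau>_def using \<eta> s by (intro mult_nonneg_nonneg sum_nonneg) auto
  ultimately have "1 - conditional_error sv2 sw2 l n (at_gains F g) M Q \<le> (\<eta> * l + (1 + 1 / \<eta>) * 4 * \<delta> * l) / a + 1 * exp a / M"
    by (intro conditional_success_le[OF F s Q M q q1 _ _ _ _ a _ bound mean]) (use \<eta> \<delta> in auto)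
  then show ?thesis by simp
qed

text \<open>Only a rectangle of weak gains is kept: \<open>g1\<close> and \<open>g2\<close> are
  independent and \<open>h\<close> is unrestricted. The minima with 1 bring the radii into the range
  where the disc probability is bounded below linearly.\<close>

lemma error_probability_ge:
  assumes F: "measurable_scheme l n F" and s: "sv2 > 0" "sw2 > 0" and Q: "code_ensemble M l Q" and M: "M > 0"
    and a: "a1 \<ge> 0" "a2 \<ge> 0" and p: "p \<ge> 0"
    and le: "\<And>g. (cmod (fst g))\<^sup>2 \<le> a1 \<Longrightarrow> (cmod (fst (snd g)))\<^sup>2 \<le> a2 \<Longrightarrow>
      p \<le> conditional_error sv2 sw2 l n (at_gains F g) M Q"
  shows "p * (exp (-1) * min 1 a1) * (exp (-1) * min 1 a2) \<le> error_probability sv2 sw2 l n F M Q"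
proof -
  interpret G: prob_space gains by (rule prob_space_gains)
  interpret C: prob_space "cgauss 1" by (rule prob_space_cgauss) simp
  interpret CC': prob_space "cgauss 1 \<Otimes>\<^sub>M cgauss 1" by (intro prob_space_pair C.prob_space_axioms)
  let ?e = "\<lambda>g. conditional_error sv2 sw2 l n (at_gains F g) M Q"
  let ?A = "\<lambda>a. {z. (cmod z)\<^sup>2 \<le> a}"
  let ?R = "?A a1 \<times> (?A a2 \<times> UNIV)"
  have A: "?A a \<in> sets (cgauss 1)" for a by simp
  have R: "?R \<in> sets gains" by (intro pair_measureI A) simp
  have disc: "exp (-1) * min 1 a \<le> measure (cgauss 1) (?A a)" if "a \<ge> 0" for a
  proof -
    have "exp (-1) * min 1 a \<le> measure (cgauss 1) (?A (min 1 a))"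
      using that by (intro cgauss_disc_ge) auto
    also have "\<dots> \<le> measure (cgauss 1) (?A a)"
      by (intro C.finite_measure_mono A) auto
    finally show ?thesis .
  qed
  have m: "?e \<in> borel_measurable gains"
    using borel_measurable_conditional_error[OF F s Q] by (simp add: measurable_cong_sets[OF sets_gains refl])
  have int: "integrable gains ?e"
    using m by (rule G.integrable_const_bound[where B = 1, rotated])
      (auto simp: conditional_error_nonneg[OF F s Q M] conditional_error_le_1[OF F s Q M])
  have "measure gains ?R = measure (cgauss 1) (?A a1) * (measure (cgauss 1) (?A a2) * 1)"
  proof -
    have "emeasure (cgauss 1 \<Otimes>\<^sub>M cgauss 1) (?A a2 \<times> UNIV) = emeasure (cgauss 1) (?A a2) * emeasure (cgauss 1) UNIV"
      by (intro C.emeasure_pair_measure_Times A) simp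
    moreover have "emeasure gains ?R = emeasure (cgauss 1) (?A a1) * emeasure (cgauss 1 \<Otimes>\<^sub>M cgauss 1) (?A a2 \<times> UNIV)"
      by (intro CC'.emeasure_pair_measure_Times A pair_measureI) simp
    ultimately show ?thesis
      using C.emeasure_space_1 by (simp add: measure_def enn2real_mult)
  qed
  then have "(exp (-1) * min 1 a1) * (exp (-1) * min 1 a2) \<le> measure gains ?R"
    using disc a by (simp add: mult_mono)
  then have "p * (exp (-1) * min 1 a1) * (exp (-1) * min 1 a2) \<le> p * measure gains ?R"
    using p by (simp add: mult.assoc mult_left_mono)
  also have "\<dots> = (\<integral>g. p * indicator ?R g \<partial>gains)"
    using R by simp
  also have "\<dots> \<le> (\<integral>g. ?e g \<partial>gains)"
  proof (rule integral_mono)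
    show "integrable gains (\<lambda>g. p * indicator ?R g)"
      using R by (intro integrable_mult_right integrable_real_indicator) (simp_all only: G.emeasure_eq_measure ennreal_less_top infinity_ennreal_def)
    show "p * indicator ?R g \<le> ?e g" for g
      using le[of g] conditional_error_nonneg[OF F s Q M, of g] by (cases g) (auto simp: indicator_def)
  qed (rule int)
  finally show ?thesis by (simp add: error_probability_eq[OF F s Q])
qed

section \<open>Error probability of the NAF protocol\<close>

lemma cgauss_density_le: "s > 0 \<Longrightarrow> cgauss_density s z \<le> 1 / (pi * s)"
  by (simp add: cgauss_density_def divide_right_mono)

lemma ennreal_likelihood:
  assumes F: "measurable_scheme l n F" and s: "sv2 > 0" "sw2 > 0"
    and x: "x \<in> space (PiM {..<l} (\<lambda>_. borel))"
  shows "ennreal (likelihood sv2 sw2 l n (at_gains F g) x y) =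
    (\<integral>\<^sup>+w. (\<Prod>i<l. ennreal (cgauss_density sv2 (y i - at_gains F g x w i))) \<partial>cgauss_vec n sw2)"
proof -
  interpret prob_space "cgauss_vec n sw2" using s by (intro prob_space_cgauss_vec)
  have Fm: "(\<lambda>w. at_gains F g x w i) \<in> borel_measurable (cgauss_vec n sw2)" if "i < l" for i
    by (rule measurable_scheme_compose[OF F that, of "\<lambda>_. g"])
       (use x in \<open>auto intro!: measurable_const measurable_ident_sets simp: space_pair_measure\<close>)
  let ?p = "\<lambda>w. \<Prod>i<l. cgauss_density sv2 (y i - at_gains F g x w i)"
  have pm: "?p \<in> borel_measurable (cgauss_vec n sw2)"
  proof (rule borel_measurable_prod)
    fix i assume "i \<in> {..<l}"
    then have "(\<lambda>w. y i - at_gains F g x w i) \<in> borel_measurable (cgauss_vec n sw2)"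
      using Fm by (intro borel_measurable_diff) auto
    from measurable_compose[OF this borel_measurable_cgauss_density]
    show "(\<lambda>w. cgauss_density sv2 (y i - at_gains F g x w i)) \<in> borel_measurable (cgauss_vec n sw2)" .
  qed
  have p0: "?p w \<ge> 0" for w using s by (intro prod_nonneg) auto
  have "?p w \<le> (\<Prod>i<l. 1 / (pi * sv2))" for w
    using s by (intro prod_mono) (auto intro: cgauss_density_le)
  then have "integrable (cgauss_vec n sw2) ?p"
    using p0 by (intro integrable_const_bound[where B = "\<Prod>i<l. 1 / (pi * sv2)"] pm) auto
  from nn_integral_eq_integral[OF this] show ?thesis
    using p0 s unfolding likelihood_def by (simp add: prod_ennreal)
qed

text \<open>\<open>likelihood\<close> is the Lebesgue density of the observation: for fixed
  \<open>w\<close> the noise is translated into \<open>y\<close>, then the integrals over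
  \<open>w\<close> and \<open>y\<close> are exchanged.\<close>

lemma observation_distribution:
  assumes F: "measurable_scheme l n F" and s: "sv2 > 0" "sw2 > 0"
    and x: "x \<in> space (PiM {..<l} (\<lambda>_. borel))"
    and f: "f \<in> borel_measurable (PiM {..<l} (\<lambda>_. borel))"
  shows "(\<integral>\<^sup>+w. \<integral>\<^sup>+v. f (\<lambda>i\<in>{..<l}. at_gains F g x w i + v i) \<partial>cgauss_vec l sv2 \<partial>cgauss_vec n sw2) =
    (\<integral>\<^sup>+y. ennreal (likelihood sv2 sw2 l n (at_gains F g) x y) * f y \<partial>PiM {..<l} (\<lambda>_. lborel))"
proof -
  let ?L = "PiM {..<l} (\<lambda>_. lborel :: complex measure)" and ?W = "cgauss_vec n sw2"
  interpret W: prob_space ?W using s by (intro prob_space_cgauss_vec)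
  interpret L: sigma_finite_measure ?L
    by (rule product_sigma_finite.sigma_finite[OF product_sigma_finite_lborel]) simp
  interpret WL: pair_sigma_finite ?W ?L ..
  have setsL [measurable_cong]: "sets ?L = sets (PiM {..<l} (\<lambda>_. borel))" by (intro sets_PiM_cong) auto
  let ?p = "\<lambda>w y. \<Prod>i<l. ennreal (cgauss_density sv2 (y i - at_gains F g x w i))"
  have Fm: "(\<lambda>\<omega>. at_gains F g x (fst \<omega>) i) \<in> borel_measurable (?W \<Otimes>\<^sub>M ?L)" if "i < l" for i
    by (rule measurable_scheme_compose[OF F that, of "\<lambda>_. g"])
       (use x in \<open>auto intro!: measurable_const measurable_compose[OF measurable_fst] measurable_ident_sets simp: space_pair_measure\<close>)
  have ym: "(\<lambda>\<omega>. snd \<omega> i) \<in> borel_measurable (?W \<Otimes>\<^sub>M ?L)" if "i < l" for i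
  proof -
    have "snd \<in> ?W \<Otimes>\<^sub>M ?L \<rightarrow>\<^sub>M PiM {..<l} (\<lambda>_. borel)" by measurable
    from measurable_compose[OF this measurable_component_singleton[of i]] that show ?thesis by simp
  qed
  have pm: "(\<lambda>(w, y). ?p w y * f y) \<in> borel_measurable (?W \<Otimes>\<^sub>M ?L)"
  proof -
    have "(\<lambda>\<omega>. ennreal (cgauss_density sv2 (snd \<omega> i - at_gains F g x (fst \<omega>) i))) \<in> borel_measurable (?W \<Otimes>\<^sub>M ?L)"
      if "i < l" for i
      by (rule measurable_compose[OF measurable_compose[OF borel_measurable_diff[OF ym[OF that] Fm[OF that]]
          borel_measurable_cgauss_density] measurable_ennreal])
    moreover have "snd \<in> ?W \<Otimes>\<^sub>M ?L \<rightarrow>\<^sub>M PiM {..<l} (\<lambda>_. borel)" by measurable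
    from measurable_compose[OF this f] have "(\<lambda>\<omega>. f (snd \<omega>)) \<in> borel_measurable (?W \<Otimes>\<^sub>M ?L)" .
    ultimately show ?thesis
      unfolding case_prod_beta' by (intro borel_measurable_times_ennreal borel_measurable_prod_ennreal) auto
  qed
  have "(\<integral>\<^sup>+v. f (\<lambda>i\<in>{..<l}. at_gains F g x w i + v i) \<partial>cgauss_vec l sv2) = (\<integral>\<^sup>+y. ?p w y * f y \<partial>?L)" for w
  proof -
    let ?T = "\<lambda>v. \<lambda>i\<in>{..<l}. at_gains F g x w i + v i"
    have T: "?T \<in> PiM {..<l} (\<lambda>_. borel) \<rightarrow>\<^sub>M PiM {..<l} (\<lambda>_. borel)" by (rule measurable_restrict) auto
    have "(\<integral>\<^sup>+v. f (?T v) \<partial>cgauss_vec l sv2) = (\<integral>\<^sup>+v. (\<Prod>i<l. ennreal (cgauss_density sv2 (v i))) * f (?T v) \<partial>?L)"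
      unfolding cgauss_vec_def by (rule nn_integral_PiM_cgauss[OF _ s(1) measurable_compose[OF T f]]) simp
    also have "\<dots> = (\<integral>\<^sup>+v. (\<lambda>y. ?p w y * f y) (?T v) \<partial>?L)"
      by (intro nn_integral_cong arg_cong2[where f="(*)"] prod.cong refl) auto
    also have "\<dots> = (\<integral>\<^sup>+y. ?p w y * f y \<partial>?L)"
      using f by (intro nn_integral_PiM_lborel_shift) auto
    finally show ?thesis .
  qed
  then have "(\<integral>\<^sup>+w. \<integral>\<^sup>+v. f (\<lambda>i\<in>{..<l}. at_gains F g x w i + v i) \<partial>cgauss_vec l sv2 \<partial>?W) =
      (\<integral>\<^sup>+w. \<integral>\<^sup>+y. ?p w y * f y \<partial>?L \<partial>?W)" by simp
  also have "\<dots> = (\<integral>\<^sup>+y. \<integral>\<^sup>+w. ?p w y * f y \<partial>?W \<partial>?L)"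
    using WL.Fubini'[OF pm] by simp
  also have "\<dots> = (\<integral>\<^sup>+y. ennreal (likelihood sv2 sw2 l n (at_gains F g) x y) * f y \<partial>?L)"
  proof (rule nn_integral_cong)
    fix y
    have Fm': "(\<lambda>w. at_gains F g x w i) \<in> borel_measurable ?W" if "i < l" for i
      by (rule measurable_scheme_compose[OF F that, of "\<lambda>_. g"])
         (use x in \<open>auto intro!: measurable_const measurable_ident_sets simp: space_pair_measure\<close>)
    have "(\<lambda>w. ?p w y) \<in> borel_measurable ?W"
    proof (rule borel_measurable_prod_ennreal)
      fix i assume "i \<in> {..<l}"
      then have "(\<lambda>w. y i - at_gains F g x w i) \<in> borel_measurable ?W"
        using Fm' by (intro borel_measurable_diff) auto
      from measurable_compose[OF measurable_compose[OF this borel_measurable_cgauss_density] measurable_ennreal]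
      show "(\<lambda>w. ennreal (cgauss_density sv2 (y i - at_gains F g x w i))) \<in> borel_measurable ?W" .
    qed
    then show "(\<integral>\<^sup>+w. ?p w y * f y \<partial>?W) = ennreal (likelihood sv2 sw2 l n (at_gains F g) x y) * f y"
      by (simp add: nn_integral_multc ennreal_likelihood[OF F s x])
  qed
  finally show ?thesis .
qed

text \<open>The probability that the observation falls into \<open>B\<close> when \<open>x\<close>
  is sent; \<open>B\<close> will consist of points nearer to the signal of another codeword, whence
  the name.\<close>

definition prefers ::
    "real \<Rightarrow> real \<Rightarrow> nat \<Rightarrow> nat \<Rightarrow> scheme \<Rightarrow> (nat \<Rightarrow> complex) \<Rightarrow> (nat \<Rightarrow> complex) set \<Rightarrow> ennreal" where
  "prefers sv2 sw2 l n F x B =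
     (\<integral>\<^sup>+w. \<integral>\<^sup>+v. indicator B (\<lambda>i\<in>{..<l}. F x w i + v i) \<partial>cgauss_vec l sv2 \<partial>cgauss_vec n sw2)"

text \<open>A union bound; each of the pairwise likelihood tests is optimal for the sum of the two
  error probabilities, so it may be replaced by an arbitrary test.\<close>

lemma decides_wrong_le:
  assumes F: "measurable_scheme l n F" and s: "sv2 > 0" "sw2 > 0" and m: "m < M"
    and c: "c \<in> space (codebook_space M l)"
    and B: "\<And>m'. B m' \<in> sets (PiM {..<l} (\<lambda>_. borel))"
  shows "decides sv2 sw2 l n (at_gains F g) M c m (- {m}) \<le>
    (\<Sum>m'\<in>{..<M} - {m}. prefers sv2 sw2 l n (at_gains F g) (c m) (B m') +
       prefers sv2 sw2 l n (at_gains F g) (c m') (space (PiM {..<l} (\<lambda>_. borel)) - B m'))"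
proof -
  let ?S = "PiM {..<l} (\<lambda>_. borel :: complex measure)" and ?L = "PiM {..<l} (\<lambda>_. lborel :: complex measure)"
  let ?D = "ml_decode sv2 sw2 l n (at_gains F g) M c"
  let ?p = "\<lambda>m y. ennreal (likelihood sv2 sw2 l n (at_gains F g) (c m) y)"
  have setsL [measurable_cong]: "sets ?L = sets ?S" by (intro sets_PiM_cong) auto
  have spL: "space ?L = space ?S" by (rule sets_eq_imp_space_eq[OF setsL])
  have cm: "c m \<in> space ?S" if "m < M" for m
    using measurable_space[OF measurable_codeword[OF that]] c by auto
  have D: "?D \<in> ?S \<rightarrow>\<^sub>M count_space UNIV"
  proof (rule measurable_ml_decode[OF F s(2)])
    show "(\<lambda>\<omega>. g) \<in> ?S \<rightarrow>\<^sub>M gain_space" "(\<lambda>\<omega>. c) \<in> ?S \<rightarrow>\<^sub>M codebook_space M l"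
      using c by (auto intro!: measurable_const simp: space_pair_measure)
  qed auto
  have lm: "?p k \<in> borel_measurable ?S" if "k < M" for k
    by (intro measurable_compose[OF borel_measurable_likelihood[OF F s(2), of "\<lambda>_. g"] measurable_ennreal])
       (use cm[OF that] in \<open>auto intro!: measurable_const simp: space_pair_measure\<close>)
  have "decides sv2 sw2 l n (at_gains F g) M c m (- {m}) =
      (\<integral>\<^sup>+w. \<integral>\<^sup>+v. indicator (- {m}) (?D (\<lambda>i\<in>{..<l}. at_gains F g (c m) w i + v i)) \<partial>cgauss_vec l sv2 \<partial>cgauss_vec n sw2)"
    unfolding decides_def
    by (intro nn_integral_cong arg_cong[where f = "indicator _"] ml_decode_cong) auto
  also have "\<dots> = (\<integral>\<^sup>+y. ?p m y * indicator (- {m}) (?D y) \<partial>?L)"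
    by (rule observation_distribution[OF F s cm[OF m] measurable_compose[OF D]]) simp
  also have "\<dots> \<le> (\<integral>\<^sup>+y. (\<Sum>m'\<in>{..<M} - {m}. ?p m y * indicator (B m') y + ?p m' y * indicator (space ?S - B m') y) \<partial>?L)"
  proof (rule nn_integral_mono)
    fix y assume y: "y \<in> space ?L"
    show "?p m y * indicator (- {m}) (?D y) \<le>
        (\<Sum>m'\<in>{..<M} - {m}. ?p m y * indicator (B m') y + ?p m' y * indicator (space ?S - B m') y)"
    proof (cases "?D y = m")
      case False
      let ?k = "?D y"
      have k: "?k \<in> {..<M} - {m}" using False ml_decode_less[of M] m by auto
      \<comment> \<open>The summand of the decoded message \<open>?k\<close> suffices: on
        \<open>B ?k\<close> it contains the likelihood of \<open>m\<close>, off \<open>B ?k\<close>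
        the one of \<open>?k\<close>, which is at least as large.\<close>
      have "?p m y \<le> ?p ?k y" by (intro ennreal_leI likelihood_le_ml_decode m)
      then have "?p m y \<le> ?p m y * indicator (B ?k) y + ?p ?k y * indicator (space ?S - B ?k) y"
        using y spL by (auto simp: indicator_def)
      also have "\<dots> \<le> (\<Sum>m'\<in>{..<M} - {m}. ?p m y * indicator (B m') y + ?p m' y * indicator (space ?S - B m') y)"
        using k by (intro member_le_sum) auto
      finally show ?thesis using False by simp
    qed simp
  qed
  also have "\<dots> = (\<Sum>m'\<in>{..<M} - {m}. (\<integral>\<^sup>+y. ?p m y * indicator (B m') y \<partial>?L) + (\<integral>\<^sup>+y. ?p m' y * indicator (space ?S - B m') y \<partial>?L))"
  proof -
    have 1: "(\<lambda>y. ?p m y * indicator (B m') y) \<in> borel_measurable ?L" for m'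
      using lm[OF m] B[of m'] by (simp add: measurable_cong_sets[OF setsL refl])
    have 2: "(\<lambda>y. ?p m' y * indicator (space ?S - B m') y) \<in> borel_measurable ?L" if "m' < M" for m'
      using lm[OF that] B[of m'] sets.compl_sets[OF B[of m']] by (simp add: measurable_cong_sets[OF setsL refl])
    show ?thesis
      using 1 2 by (subst nn_integral_sum) (auto intro!: sum.cong nn_integral_add)
  qed
  also have "\<dots> = (\<Sum>m'\<in>{..<M} - {m}. prefers sv2 sw2 l n (at_gains F g) (c m) (B m') +
       prefers sv2 sw2 l n (at_gains F g) (c m') (space ?S - B m'))"
    unfolding prefers_def using m B sets.compl_sets[OF B]
    by (intro sum.cong refl arg_cong2[where f="(+)"] observation_distribution[OF F s cm, symmetric]) auto
  finally show ?thesis .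
qed

section \<open>Pairwise errors of Gaussian codewords\<close>

lemma nn_integral_exp_norm_le:
  assumes I: "finite I" and E: "E > 0" and c: "c \<ge> 0"
  shows "(\<integral>\<^sup>+x. (\<Prod>i\<in>I. ennreal (exp (- c * (cmod (\<alpha> * x i + \<beta> i))\<^sup>2))) \<partial>PiM I (\<lambda>_. cgauss E)) \<le>
    ennreal ((1 / (1 + c * (cmod \<alpha>)\<^sup>2 * E)) ^ card I)"
proof -
  have "(\<integral>\<^sup>+x. (\<Prod>i\<in>I. ennreal (exp (- c * (cmod (\<alpha> * x i + \<beta> i))\<^sup>2))) \<partial>PiM I (\<lambda>_. cgauss E)) =
      (\<Prod>i\<in>I. \<integral>\<^sup>+z. ennreal (exp (- c * (cmod (\<alpha> * z + \<beta> i))\<^sup>2)) \<partial>cgauss E)"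
    by (rule product_sigma_finite.product_nn_integral_prod[OF product_sigma_finite_cgauss[OF E] I]) measurable
  also have "\<dots> \<le> (\<Prod>i\<in>I. ennreal (1 / (1 + c * (cmod \<alpha>)\<^sup>2 * E)))"
    using E c by (intro prod_mono_ennreal cgauss_exp_square_le)
  also have "\<dots> = ennreal ((1 / (1 + c * (cmod \<alpha>)\<^sup>2 * E)) ^ card I)"
    using E c by (simp add: ennreal_power)
  finally show ?thesis .
qed

text \<open>The symbols in \<open>U\<close> are those in which the relay transmits; there it repeats the noisy
  signal observed in the symbol \<open>\<sigma> i\<close>, where its noise is \<open>w (\<kappa> i)\<close>.\<close>

locale naf_layout =
  fixes l n :: nat and U :: "nat set" and \<sigma> \<kappa> :: "nat \<Rightarrow> nat"
  assumes U: "U \<subseteq> {..<l}"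
    and \<sigma>: "bij_betw \<sigma> U ({..<l} - U)"
    and \<kappa>: "bij_betw \<kappa> U {..<n}"
begin

lemma finite_U: "finite U" using U finite_subset by blast

lemma card_U: "card U = n" "card ({..<l} - U) = n" "l = 2 * n"
proof -
  show 1: "card U = n" using bij_betw_same_card[OF \<kappa>] by simp
  show 2: "card ({..<l} - U) = n" using bij_betw_same_card[OF \<sigma>] 1 by simp
  show "l = 2 * n" using 1 2 card_Diff_subset[OF finite_U U] card_mono[OF _ U] by simp
qed

lemma split_indices: "{..<l} = U \<union> ({..<l} - U)" "U \<inter> ({..<l} - U) = {}"
  using U by auto

definition signal :: "complex \<Rightarrow> complex \<Rightarrow> (nat \<Rightarrow> complex) \<Rightarrow> nat \<Rightarrow> complex" where
  "signal g q x i = (if i \<in> U then g * x i + q * x (\<sigma> i) else g * x i)"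

lemma \<sigma>_less: "i \<in> U \<Longrightarrow> \<sigma> i < l" "i \<in> U \<Longrightarrow> \<sigma> i \<notin> U"
  using bij_betwE[OF \<sigma>] by auto

lemma \<kappa>_less: "i \<in> U \<Longrightarrow> \<kappa> i < n"
  using bij_betwE[OF \<kappa>] by auto

lemma borel_measurable_signal:
  assumes "i < l"
  shows "(\<lambda>x. signal g q x i) \<in> borel_measurable (PiM {..<l} (\<lambda>_. borel))"
proof -
  have "(\<lambda>x. x j) \<in> borel_measurable (PiM {..<l} (\<lambda>_. borel :: complex measure))" if "j < l" for j
    using that by (intro measurable_component_singleton) auto
  then show ?thesis
    using assms \<sigma>_less(1)[of i] unfolding signal_def by (cases "i \<in> U") auto
qed

text \<open>Chernoff's bound for the minimum-distance test. The noise is stronger on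
  \<open>U\<close>, so this is not the likelihood test; in exchange it can be analysed with a common
  bound \<open>N\<close> on the noise variance per symbol.\<close>

lemma prefers_nearer_le:
  fixes F :: scheme and s s' :: "nat \<Rightarrow> complex"
  assumes sv: "sv2 > 0" and sw: "sw2 > 0" and N: "N \<ge> sv2 + (cmod p)\<^sup>2 * sw2"
    and F: "\<And>w i. i < l \<Longrightarrow> F x w i = s i + (if i \<in> U then p * w (\<kappa> i) else 0)"
    and B: "B \<subseteq> {y. (\<Sum>i<l. (cmod (y i - s' i))\<^sup>2) \<le> (\<Sum>i<l. (cmod (y i - s i))\<^sup>2)}"
  shows "prefers sv2 sw2 l n F x B \<le> ennreal (exp (- (\<Sum>i<l. (cmod (s i - s' i))\<^sup>2) / (4 * N)))"
proof -
  have N0: "N > 0"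
  proof -
    have "0 \<le> (cmod p)\<^sup>2 * sw2" using sw by simp
    then show ?thesis using N sv by linarith
  qed
  \<comment> \<open>This minimises the Chernoff exponent - t D + t^2 N D, with minimum - D / (4
    N).\<close>
  define t where "t = 1 / (2 * N)"
  have t: "t > 0" using N0 by (simp add: t_def)
  define d where "d i = s i - s' i" for i
  define D where "D = (\<Sum>i<l. (cmod (d i))\<^sup>2)"
  define a where "a i = - of_real (2 * t) * cnj (d i)" for i
  have norm_a: "(cmod (a i))\<^sup>2 = 4 * t\<^sup>2 * (cmod (d i))\<^sup>2" for i
    unfolding a_def by (simp add: norm_mult power_mult_distrib)
  have bound: "indicator B (\<lambda>i\<in>{..<l}. F x w i + v i) \<le>
      ennreal (exp (- t * D)) * (\<Prod>i<l. ennreal (exp (Re (a i * v i)))) * (\<Prod>i\<in>U. ennreal (exp (Re (a i * p * w (\<kappa> i)))))"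
    for w v
  proof (cases "(\<lambda>i\<in>{..<l}. F x w i + v i) \<in> B")
    case True
    define z where "z i = (if i \<in> U then p * w (\<kappa> i) else 0) + v i" for i
    have "(\<Sum>i<l. (cmod (d i + z i))\<^sup>2) \<le> (\<Sum>i<l. (cmod (z i))\<^sup>2)"
    proof -
      let ?y = "\<lambda>i\<in>{..<l}. F x w i + v i"
      have e: "?y i - s' i = d i + z i" "?y i - s i = z i" if "i < l" for i
        using F[OF that, of w] that by (simp_all add: d_def z_def)
      have "(\<Sum>i<l. (cmod (?y i - s' i))\<^sup>2) \<le> (\<Sum>i<l. (cmod (?y i - s i))\<^sup>2)"
        using True B by blast
      moreover have "(\<Sum>i<l. (cmod (?y i - s' i))\<^sup>2) = (\<Sum>i<l. (cmod (d i + z i))\<^sup>2)"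
        "(\<Sum>i<l. (cmod (?y i - s i))\<^sup>2) = (\<Sum>i<l. (cmod (z i))\<^sup>2)"
        using e by (auto intro!: sum.cong)
      ultimately show ?thesis by simp
    qed
    moreover have "(cmod (d i + z i))\<^sup>2 = (cmod (d i))\<^sup>2 + 2 * Re (cnj (d i) * z i) + (cmod (z i))\<^sup>2" for i
      by (simp add: cmod_power2) algebra
    ultimately have "D + (\<Sum>i<l. 2 * Re (cnj (d i) * z i)) \<le> 0"
      by (simp add: sum.distrib D_def)
    then have "0 \<le> t * - (D + (\<Sum>i<l. 2 * Re (cnj (d i) * z i)))"
      using t by (intro mult_nonneg_nonneg) auto
    also have "\<dots> = - t * D + (\<Sum>i<l. Re (a i * z i))"
      by (simp add: a_def sum_distrib_left sum_negf[symmetric] algebra_simps)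
    also have "(\<Sum>i<l. Re (a i * z i)) = (\<Sum>i<l. Re (a i * v i)) + (\<Sum>i<l. if i \<in> U then Re (a i * p * w (\<kappa> i)) else 0)"
      unfolding sum.distrib[symmetric] by (intro sum.cong) (auto simp: z_def algebra_simps)
    also have "(\<Sum>i<l. if i \<in> U then Re (a i * p * w (\<kappa> i)) else 0) = (\<Sum>i\<in>U. Re (a i * p * w (\<kappa> i)))"
      using U by (simp add: sum.If_cases Int_absorb1)
    finally have "1 \<le> exp (- t * D + ((\<Sum>i<l. Re (a i * v i)) + (\<Sum>i\<in>U. Re (a i * p * w (\<kappa> i)))))"
      by simp
    then have "ennreal 1 \<le> ennreal (exp (- t * D + ((\<Sum>i<l. Re (a i * v i)) + (\<Sum>i\<in>U. Re (a i * p * w (\<kappa> i))))))"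
      by (rule ennreal_leI)
    then show ?thesis
      using True finite_U
      by (simp only: exp_add exp_sum finite_lessThan indicator_simps ennreal_1 prod_ennreal ennreal_mult'[symmetric]
          ennreal_mult''[symmetric] exp_ge_zero prod_nonneg mult.assoc)
  qed simp
  have int_v: "(\<integral>\<^sup>+v. (\<Prod>i<l. ennreal (exp (Re (a i * v i)))) \<partial>cgauss_vec l sv2) = ennreal (exp (t\<^sup>2 * sv2 * D))"
  proof -
    have "(\<integral>\<^sup>+v. (\<Prod>i<l. ennreal (exp (Re (a i * v i)))) \<partial>cgauss_vec l sv2) =
        (\<Prod>i<l. \<integral>\<^sup>+z. ennreal (exp (Re (a i * z))) \<partial>cgauss sv2)"
      unfolding cgauss_vec_def
      by (rule product_sigma_finite.product_nn_integral_prod[OF product_sigma_finite_cgauss[OF sv]]) auto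
    also have "\<dots> = (\<Prod>i<l. ennreal (exp (t\<^sup>2 * sv2 * (cmod (d i))\<^sup>2)))"
      by (simp only: cgauss_mgf[OF sv] norm_a) (simp add: mult_ac)
    also have "\<dots> = ennreal (exp (t\<^sup>2 * sv2 * D))"
      by (simp add: prod_ennreal exp_sum[symmetric] D_def sum_distrib_left)
    finally show ?thesis .
  qed
  \<comment> \<open>Each relay noise sample enters exactly one symbol; indexing by samples makes the
    product factorise over \<open>cgauss_vec n sw2\<close>.\<close>
  define \<iota> where "\<iota> = inv_into U \<kappa>"
  have \<iota>: "bij_betw \<iota> {..<n} U" unfolding \<iota>_def by (rule bij_betw_inv_into[OF \<kappa>])
  have \<kappa>\<iota>: "k < n \<Longrightarrow> \<kappa> (\<iota> k) = k" for k
    unfolding \<iota>_def using \<kappa> by (intro f_inv_into_f) (auto simp: bij_betw_def)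
  have reindex: "(\<Prod>i\<in>U. ennreal (exp (Re (a i * p * w (\<kappa> i))))) = (\<Prod>k<n. ennreal (exp (Re (a (\<iota> k) * p * w k))))" for w
    by (subst prod.reindex_bij_betw[OF \<iota>, symmetric]) (auto simp: \<kappa>\<iota> intro!: prod.cong)
  have int_w: "(\<integral>\<^sup>+w. (\<Prod>k<n. ennreal (exp (Re (a (\<iota> k) * p * w k)))) \<partial>cgauss_vec n sw2) \<le>
      ennreal (exp (t\<^sup>2 * ((cmod p)\<^sup>2 * sw2) * D))"
  proof -
    have "(\<integral>\<^sup>+w. (\<Prod>k<n. ennreal (exp (Re (a (\<iota> k) * p * w k)))) \<partial>cgauss_vec n sw2) =
        (\<Prod>k<n. \<integral>\<^sup>+z. ennreal (exp (Re (a (\<iota> k) * p * z))) \<partial>cgauss sw2)"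
      unfolding cgauss_vec_def
      by (rule product_sigma_finite.product_nn_integral_prod[OF product_sigma_finite_cgauss[OF sw]]) auto
    also have "\<dots> = (\<Prod>k<n. ennreal (exp (t\<^sup>2 * ((cmod p)\<^sup>2 * sw2) * (cmod (d (\<iota> k)))\<^sup>2)))"
      by (simp only: cgauss_mgf[OF sw] norm_mult power_mult_distrib norm_a) (simp add: mult_ac)
    also have "\<dots> = (\<Prod>i\<in>U. ennreal (exp (t\<^sup>2 * ((cmod p)\<^sup>2 * sw2) * (cmod (d i))\<^sup>2)))"
      by (rule prod.reindex_bij_betw[OF \<iota>])
    also have "\<dots> = ennreal (exp (t\<^sup>2 * ((cmod p)\<^sup>2 * sw2) * (\<Sum>i\<in>U. (cmod (d i))\<^sup>2)))"
      using finite_U by (simp add: prod_ennreal exp_sum[symmetric] sum_distrib_left)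
    also have "\<dots> \<le> ennreal (exp (t\<^sup>2 * ((cmod p)\<^sup>2 * sw2) * D))"
    proof -
      have "(\<Sum>i\<in>U. (cmod (d i))\<^sup>2) \<le> D" unfolding D_def using U by (intro sum_mono2) auto
      then show ?thesis using sw by (intro ennreal_leI exp_le_cancel_iff[THEN iffD2] mult_left_mono) auto
    qed
    finally show ?thesis .
  qed
  have mv: "(\<lambda>v. \<Prod>i<l. ennreal (exp (Re (a i * v i)))) \<in> borel_measurable (cgauss_vec l sv2)"
    by measurable
  have mw: "(\<lambda>w. \<Prod>k<n. ennreal (exp (Re (a (\<iota> k) * p * w k)))) \<in> borel_measurable (cgauss_vec n sw2)"
    by measurable
  have "prefers sv2 sw2 l n F x B \<le>
      (\<integral>\<^sup>+w. \<integral>\<^sup>+v. ennreal (exp (- t * D)) * (\<Prod>i<l. ennreal (exp (Re (a i * v i)))) *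
        (\<Prod>k<n. ennreal (exp (Re (a (\<iota> k) * p * w k)))) \<partial>cgauss_vec l sv2 \<partial>cgauss_vec n sw2)"
    unfolding prefers_def reindex[symmetric] by (intro nn_integral_mono bound)
  also have "\<dots> = (\<integral>\<^sup>+w. ennreal (exp (- t * D)) * ennreal (exp (t\<^sup>2 * sv2 * D)) *
        (\<Prod>k<n. ennreal (exp (Re (a (\<iota> k) * p * w k)))) \<partial>cgauss_vec n sw2)"
    using mv by (simp add: nn_integral_multc nn_integral_cmult int_v del: times_complex.sel)
  also have "\<dots> = ennreal (exp (- t * D)) * ennreal (exp (t\<^sup>2 * sv2 * D)) *
      (\<integral>\<^sup>+w. (\<Prod>k<n. ennreal (exp (Re (a (\<iota> k) * p * w k)))) \<partial>cgauss_vec n sw2)"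
    by (rule nn_integral_cmult[OF mw])
  also have "\<dots> \<le> ennreal (exp (- t * D)) * ennreal (exp (t\<^sup>2 * sv2 * D)) * ennreal (exp (t\<^sup>2 * ((cmod p)\<^sup>2 * sw2) * D))"
    by (intro mult_left_mono int_w) auto
  also have "\<dots> = ennreal (exp (- t * D + t\<^sup>2 * (sv2 + (cmod p)\<^sup>2 * sw2) * D))"
    by (simp add: ennreal_mult'[symmetric] exp_add[symmetric] algebra_simps)
  also have "\<dots> \<le> ennreal (exp (- D / (4 * N)))"
  proof -
    have "D \<ge> 0" unfolding D_def by (intro sum_nonneg) auto
    then have "t\<^sup>2 * (sv2 + (cmod p)\<^sup>2 * sw2) * D \<le> t\<^sup>2 * N * D"
      using N by (intro mult_right_mono mult_left_mono) auto
    moreover have "- t * D + t\<^sup>2 * N * D = - D / (4 * N)"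
      using N0 by (simp add: t_def power2_eq_square field_simps)
    ultimately show ?thesis by (intro ennreal_leI) simp
  qed
  finally show ?thesis by (simp add: D_def d_def)
qed

text \<open>The channel is triangular. With the listened symbols fixed, each symbol in
  \<open>U\<close> is a scaled Gaussian plus an offset and yields a factor uniformly in the offset;
  the listened symbols then yield the same factor, n + n = l in all. For the second bound the
  factors of the listened symbols are estimated by 1, and these symbols are integrated through the
  relay path instead, with the source's own symbols in \<open>U\<close> as offsets.\<close>

lemma nn_integral_exp_signal_le:
  assumes E: "E > 0" and c: "c \<ge> 0"
  shows "(\<integral>\<^sup>+x. ennreal (exp (- c * (\<Sum>i<l. (cmod (signal g q x i + \<eta> i))\<^sup>2))) \<partial>cgauss_vec l E) \<le>
      ennreal ((1 / (1 + c * (cmod g)\<^sup>2 * E)) ^ l)" (is "?I \<le> ?b1")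
    and "(\<integral>\<^sup>+x. ennreal (exp (- c * (\<Sum>i<l. (cmod (signal g q x i + \<eta> i))\<^sup>2))) \<partial>cgauss_vec l E) \<le>
      ennreal ((1 / (1 + c * (cmod q)\<^sup>2 * E)) ^ n)" (is "_ \<le> ?b2")
proof -
  let ?T = "{..<l} - U"
  let ?U = "\<lambda>y x. \<Prod>i\<in>U. ennreal (exp (- c * (cmod (g * x i + (q * y (\<sigma> i) + \<eta> i)))\<^sup>2))"
  let ?V = "\<lambda>y. \<Prod>i\<in>?T. ennreal (exp (- c * (cmod (g * y i + \<eta> i))\<^sup>2))"
  let ?f = "\<lambda>x. ennreal (exp (- c * (\<Sum>i<l. (cmod (signal g q x i + \<eta> i))\<^sup>2)))"
  have f: "?f x = ?U x x * ?V x" for x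
  proof -
    have "?f x = (\<Prod>i<l. ennreal (exp (- c * (cmod (signal g q x i + \<eta> i))\<^sup>2)))"
      by (simp add: sum_distrib_left exp_sum prod_ennreal sum_negf[symmetric])
    also have "\<dots> = (\<Prod>i\<in>U. ennreal (exp (- c * (cmod (signal g q x i + \<eta> i))\<^sup>2))) *
        (\<Prod>i\<in>?T. ennreal (exp (- c * (cmod (signal g q x i + \<eta> i))\<^sup>2)))"
      by (subst split_indices(1)) (rule prod.union_disjoint, use finite_U in auto)
    also have "\<dots> = ?U x x * ?V x"
      by (intro arg_cong2[where f="(*)"] prod.cong) (auto simp: signal_def add.assoc)
    finally show ?thesis .
  qed
  have fm: "?f \<in> borel_measurable (PiM (U \<union> ?T) (\<lambda>_. cgauss E))" "?f \<in> borel_measurable (PiM (?T \<union> U) (\<lambda>_. cgauss E))"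
  proof -
    have "(\<lambda>x. signal g q x i) \<in> borel_measurable (PiM {..<l} (\<lambda>_. cgauss E))" if "i < l" for i
      using borel_measurable_signal[OF that] by (simp cong: measurable_cong_sets sets_PiM_cong)
    then have "?f \<in> borel_measurable (PiM {..<l} (\<lambda>_. cgauss E))" by measurable
    then show "?f \<in> borel_measurable (PiM (U \<union> ?T) (\<lambda>_. cgauss E))" "?f \<in> borel_measurable (PiM (?T \<union> U) (\<lambda>_. cgauss E))"
      using split_indices(1) by (simp_all add: Un_commute)
  qed
  note ps = product_sigma_finite_cgauss[OF E]
  let ?K = "ennreal ((1 / (1 + c * (cmod g)\<^sup>2 * E)) ^ n)"
  have "?I = (\<integral>\<^sup>+y. \<integral>\<^sup>+x. ?f (merge ?T U (y, x)) \<partial>PiM U (\<lambda>_. cgauss E) \<partial>PiM ?T (\<lambda>_. cgauss E))"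
    unfolding cgauss_vec_def
    using product_sigma_finite.product_nn_integral_fold[OF ps _ _ _ fm(2)] split_indices finite_U
    by (simp add: Un_commute Int_commute)
  also have "\<dots> = (\<integral>\<^sup>+y. \<integral>\<^sup>+x. ?V y * ?U y x \<partial>PiM U (\<lambda>_. cgauss E) \<partial>PiM ?T (\<lambda>_. cgauss E))"
  proof (intro nn_integral_cong)
    fix x y :: "nat \<Rightarrow> complex"
    have m: "merge ?T U (y, x) i = x i" "merge ?T U (y, x) (\<sigma> i) = y (\<sigma> i)" if "i \<in> U" for i
      using that \<sigma>_less[OF that] by (auto simp: merge_def)
    have m': "merge ?T U (y, x) i = y i" if "i \<in> ?T" for i
      using that by (auto simp: merge_def)
    show "?f (merge ?T U (y, x)) = ?V y * ?U y x"
      unfolding f by (subst mult.commute) (intro arg_cong2[where f="(*)"] prod.cong, auto simp: m m')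
  qed
  also have "\<dots> \<le> (\<integral>\<^sup>+y. ?V y * ?K \<partial>PiM ?T (\<lambda>_. cgauss E))"
  proof (rule nn_integral_mono)
    fix y :: "nat \<Rightarrow> complex"
    have "(\<lambda>x. ?U y x) \<in> borel_measurable (PiM U (\<lambda>_. cgauss E))" by measurable
    then have "(\<integral>\<^sup>+x. ?V y * ?U y x \<partial>PiM U (\<lambda>_. cgauss E)) = ?V y * (\<integral>\<^sup>+x. ?U y x \<partial>PiM U (\<lambda>_. cgauss E))"
      by (rule nn_integral_cmult)
    also have "\<dots> \<le> ?V y * ?K"
      using nn_integral_exp_norm_le[OF finite_U E c, of g "\<lambda>i. q * y (\<sigma> i) + \<eta> i"]
      by (intro mult_left_mono) (auto simp: card_U(1))
    finally show "(\<integral>\<^sup>+x. ?V y * ?U y x \<partial>PiM U (\<lambda>_. cgauss E)) \<le> ?V y * ?K" .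
  qed
  also have "\<dots> = (\<integral>\<^sup>+y. ?V y \<partial>PiM ?T (\<lambda>_. cgauss E)) * ?K"
    by (rule nn_integral_multc) measurable
  also have "\<dots> \<le> ?K * ?K"
    using nn_integral_exp_norm_le[of ?T, OF _ E c, of g \<eta>]
    by (intro mult_right_mono) (auto simp: card_U(2))
  also have "?K * ?K = ?b1"
  proof -
    have "l = n + n" using card_U by simp
    then show ?thesis using E c by (simp add: ennreal_mult[symmetric] power_add)
  qed
  finally show "?I \<le> ?b1" .
  define \<iota> where "\<iota> = inv_into U \<sigma>"
  have \<iota>: "bij_betw \<iota> ?T U" unfolding \<iota>_def by (rule bij_betw_inv_into[OF \<sigma>])
  have \<sigma>\<iota>: "j \<in> ?T \<Longrightarrow> \<sigma> (\<iota> j) = j" for j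
    unfolding \<iota>_def using \<sigma> by (intro f_inv_into_f) (auto simp: bij_betw_def)
  have "?I = (\<integral>\<^sup>+x. \<integral>\<^sup>+y. ?f (merge U ?T (x, y)) \<partial>PiM ?T (\<lambda>_. cgauss E) \<partial>PiM U (\<lambda>_. cgauss E))"
    unfolding cgauss_vec_def
    using product_sigma_finite.product_nn_integral_fold[OF ps _ _ _ fm(1)] split_indices finite_U
    by simp
  also have "\<dots> \<le> (\<integral>\<^sup>+x. ?b2 \<partial>PiM U (\<lambda>_. cgauss E))"
  proof (intro nn_integral_mono)
    fix x :: "nat \<Rightarrow> complex"
    have "?f (merge U ?T (x, y)) \<le> (\<Prod>j\<in>?T. ennreal (exp (- c * (cmod (q * y j + (g * x (\<iota> j) + \<eta> (\<iota> j))))\<^sup>2)))" for y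
    proof -
      have m: "merge U ?T (x, y) i = x i" "merge U ?T (x, y) (\<sigma> i) = y (\<sigma> i)" if "i \<in> U" for i
        using that \<sigma>_less[OF that] by (auto simp: merge_def)
      have "?V z \<le> 1" for z
        using c by (intro prod_le_1) auto
      then have "?f (merge U ?T (x, y)) \<le> ?U (merge U ?T (x, y)) (merge U ?T (x, y)) * 1"
        unfolding f by (intro mult_left_mono) auto
      also have "\<dots> = (\<Prod>i\<in>U. ennreal (exp (- c * (cmod (g * x i + (q * y (\<sigma> i) + \<eta> i)))\<^sup>2)))"
        by (simp add: m)
      also have "\<dots> = (\<Prod>j\<in>?T. ennreal (exp (- c * (cmod (g * x (\<iota> j) + (q * y (\<sigma> (\<iota> j)) + \<eta> (\<iota> j))))\<^sup>2)))"
        by (rule prod.reindex_bij_betw[OF \<iota>, symmetric])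
      also have "\<dots> = (\<Prod>j\<in>?T. ennreal (exp (- c * (cmod (q * y j + (g * x (\<iota> j) + \<eta> (\<iota> j))))\<^sup>2)))"
        by (intro prod.cong refl) (simp add: \<sigma>\<iota> algebra_simps)
      finally show ?thesis .
    qed
    then have "(\<integral>\<^sup>+y. ?f (merge U ?T (x, y)) \<partial>PiM ?T (\<lambda>_. cgauss E)) \<le>
      (\<integral>\<^sup>+y. (\<Prod>j\<in>?T. ennreal (exp (- c * (cmod (q * y j + (g * x (\<iota> j) + \<eta> (\<iota> j))))\<^sup>2))) \<partial>PiM ?T (\<lambda>_. cgauss E))"
      by (intro nn_integral_mono)
    also have "\<dots> \<le> ?b2"
      using nn_integral_exp_norm_le[of ?T, OF _ E c, of q "\<lambda>j. g * x (\<iota> j) + \<eta> (\<iota> j)"] by (simp add: card_U(2))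
    finally show "(\<integral>\<^sup>+y. ?f (merge U ?T (x, y)) \<partial>PiM ?T (\<lambda>_. cgauss E)) \<le> ?b2" .
  qed
  also have "\<dots> = ?b2"
    using prob_space.emeasure_space_1[OF prob_space_PiM_cgauss[OF E, of U]] by simp
  finally show "?I \<le> ?b2" .
qed

end

lemma product_sigma_finite_cgauss_vec: "E > 0 \<Longrightarrow> product_sigma_finite (\<lambda>_. cgauss_vec l E)"
  by (intro product_sigma_finite.intro prob_space_imp_sigma_finite prob_space_cgauss_vec)

lemma code_ensemble_gaussian:
  assumes "E > 0"
  shows "code_ensemble M l (gaussian_ensemble M l E)"
  unfolding code_ensemble_def gaussian_ensemble_def codebook_space_def
  using assms by (auto intro!: prob_space_PiM prob_space_cgauss_vec sets_PiM_cong)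

lemma mean_energy_gaussian:
  assumes E: "E > 0" and M: "M > 0" and i: "i < l"
  shows "mean_energy M (gaussian_ensemble M l E) (\<lambda>x. a * x i) = ennreal ((cmod a)\<^sup>2 * E)"
proof -
  have "(\<integral>\<^sup>+c. ennreal ((cmod (a * c m i))\<^sup>2) \<partial>gaussian_ensemble M l E) = ennreal ((cmod a)\<^sup>2 * E)" if m: "m < M" for m
  proof -
    have *: "(\<lambda>x. ennreal ((cmod (a * x i))\<^sup>2)) \<in> borel_measurable (PiM {..<l} (\<lambda>_. borel))"
      using i by (intro measurable_compose[OF measurable_component_singleton[of i]]) auto
    have "(\<integral>\<^sup>+c. ennreal ((cmod (a * c m i))\<^sup>2) \<partial>gaussian_ensemble M l E) =
        (\<integral>\<^sup>+x. ennreal ((cmod (a * x i))\<^sup>2) \<partial>distr (gaussian_ensemble M l E) (cgauss_vec l E) (\<lambda>c. c m))"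
      using m * unfolding gaussian_ensemble_def by (subst nn_integral_distr) auto
    also have "distr (gaussian_ensemble M l E) (cgauss_vec l E) (\<lambda>c. c m) = cgauss_vec l E"
      unfolding gaussian_ensemble_def using m E by (intro distr_PiM_component prob_space_cgauss_vec) auto
    also have "(\<integral>\<^sup>+x. ennreal ((cmod (a * x i))\<^sup>2) \<partial>cgauss_vec l E) = (\<integral>\<^sup>+z. ennreal ((cmod (a * z))\<^sup>2) \<partial>cgauss E)"
      unfolding cgauss_vec_def using i E by (intro nn_integral_PiM_component_cgauss) auto
    also have "\<dots> = (\<integral>\<^sup>+z. ennreal ((cmod a)\<^sup>2) * ennreal ((cmod z)\<^sup>2) \<partial>cgauss E)"
      by (simp add: norm_mult power_mult_distrib ennreal_mult')
    also have "\<dots> = ennreal ((cmod a)\<^sup>2 * E)"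
      using E by (subst nn_integral_cmult) (auto simp: nn_integral_cgauss_cmod_square ennreal_mult')
    finally show ?thesis .
  qed
  then show ?thesis
    using M E by (simp add: mean_energy_def ennreal_of_nat_eq_real_of_nat ennreal_mult[symmetric] divide_ennreal)
qed

context naf_layout
begin

text \<open>There are at most M competitors of each message and two errors in each pairwise test,
  hence 2 M. The codewords are independent, so codeword \<open>m\<close> can be averaged with its
  competitor fixed; the competitor is the offset \<eta>.\<close>

lemma conditional_error_gaussian_le:
  assumes F: "measurable_scheme l n F" and s: "sv2 > 0" "sw2 > 0" and E: "E > 0" and M: "M > 0"
    and form: "\<And>x w i. i < l \<Longrightarrow> at_gains F g x w i = signal g1 q x i + (if i \<in> U then p * w (\<kappa> i) else 0)"
    and N: "N \<ge> sv2 + (cmod p)\<^sup>2 * sw2" and K: "K \<ge> 0"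
    and avg: "\<And>\<eta>. (\<integral>\<^sup>+x. ennreal (exp (- (1 / (4 * N)) * (\<Sum>i<l. (cmod (signal g1 q x i + \<eta> i))\<^sup>2))) \<partial>cgauss_vec l E) \<le> ennreal K"
  shows "conditional_error sv2 sw2 l n (at_gains F g) M (gaussian_ensemble M l E) \<le> 2 * real M * K"
proof -
  let ?Q = "gaussian_ensemble M l E" and ?S = "PiM {..<l} (\<lambda>_. borel :: complex measure)"
  have Q: "code_ensemble M l ?Q" by (rule code_ensemble_gaussian[OF E])
  interpret Q: prob_space ?Q using Q by (simp add: code_ensemble_def)
  have setsQ [measurable_cong]: "sets ?Q = sets (codebook_space M l)" using Q by (simp add: code_ensemble_def)
  have spQ: "space ?Q = space (codebook_space M l)" by (rule sets_eq_imp_space_eq[OF setsQ])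
  let ?e = "\<lambda>x x'. ennreal (exp (- (1 / (4 * N)) * (\<Sum>i<l. (cmod (signal g1 q x i - signal g1 q x' i))\<^sup>2)))"
  have sig: "(\<lambda>x. signal g1 q x i) \<in> borel_measurable ?S" if "i < l" for i
    by (rule borel_measurable_signal[OF that])
  have em: "(\<lambda>c. ?e (c m) (c m')) \<in> borel_measurable ?Q" if "m < M" "m' < M" for m m'
  proof -
    have "(\<lambda>c. signal g1 q (c m) i - signal g1 q (c m') i) \<in> borel_measurable ?Q" if i: "i < l" for i
      using measurable_compose[OF measurable_codeword[OF \<open>m < M\<close>] sig[OF i]]
        measurable_compose[OF measurable_codeword[OF \<open>m' < M\<close>] sig[OF i]]
      by (simp add: measurable_cong_sets[OF setsQ refl])
    then show ?thesis by measurable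
  qed
  have pair: "(\<integral>\<^sup>+c. ?e (c m) (c m') \<partial>?Q) \<le> ennreal K" if m: "m < M" "m' < M" "m' \<noteq> m" for m m'
  proof -
    let ?I = "{..<M} - {m}"
    have I: "insert m ?I = {..<M}" using m by auto
    note ps = product_sigma_finite_cgauss_vec[OF E, of l]
    have "(\<integral>\<^sup>+c. ?e (c m) (c m') \<partial>?Q) =
        (\<integral>\<^sup>+c. \<integral>\<^sup>+x. ?e ((c(m := x)) m) ((c(m := x)) m') \<partial>cgauss_vec l E \<partial>PiM ?I (\<lambda>_. cgauss_vec l E))"
      using product_sigma_finite.product_nn_integral_insert[OF ps, of ?I m "\<lambda>c. ?e (c m) (c m')"] em[OF m(1,2)]
      unfolding gaussian_ensemble_def I by simp
    also have "\<dots> = (\<integral>\<^sup>+c. \<integral>\<^sup>+x. ?e x (c m') \<partial>cgauss_vec l E \<partial>PiM ?I (\<lambda>_. cgauss_vec l E))"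
      using m(3) by simp
    also have "\<dots> \<le> (\<integral>\<^sup>+c. ennreal K \<partial>PiM ?I (\<lambda>_. cgauss_vec l E))"
    proof (rule nn_integral_mono)
      fix c :: codebook
      show "(\<integral>\<^sup>+x. ?e x (c m') \<partial>cgauss_vec l E) \<le> ennreal K"
        using avg[of "\<lambda>i. - signal g1 q (c m') i"] by simp
    qed
    also have "\<dots> = ennreal K"
    proof -
      have "prob_space (PiM ?I (\<lambda>_. cgauss_vec l E))"
        using E by (intro prob_space_PiM prob_space_cgauss_vec)
      from prob_space.emeasure_space_1[OF this] show ?thesis by simp
    qed
    finally show ?thesis .
  qed
  have dec: "decides sv2 sw2 l n (at_gains F g) M c m (- {m}) \<le> (\<Sum>m'\<in>{..<M} - {m}. 2 * ?e (c m) (c m'))"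
    if c: "c \<in> space ?Q" and m: "m < M" for c m
  proof -
    define B where "B m' = {y \<in> space ?S. (\<Sum>i<l. (cmod (y i - signal g1 q (c m') i))\<^sup>2) \<le>
      (\<Sum>i<l. (cmod (y i - signal g1 q (c m) i))\<^sup>2)}" for m'
    have B: "B m' \<in> sets ?S" for m'
    proof -
      have "(\<lambda>y. y i) \<in> borel_measurable ?S" if "i < l" for i
        using that by (intro measurable_component_singleton) auto
      then have "(\<lambda>y. \<Sum>i<l. (cmod (y i - a i))\<^sup>2) \<in> borel_measurable ?S" for a
        by (intro borel_measurable_sum borel_measurable_power borel_measurable_norm borel_measurable_diff) auto
      then show ?thesis unfolding B_def by (intro borel_measurable_le)
    qed
    have 1: "prefers sv2 sw2 l n (at_gains F g) (c m) (B m') \<le> ?e (c m) (c m')" for m'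
    proof -
      have "B m' \<subseteq> {y. (\<Sum>i<l. (cmod (y i - signal g1 q (c m') i))\<^sup>2) \<le> (\<Sum>i<l. (cmod (y i - signal g1 q (c m) i))\<^sup>2)}"
        by (auto simp: B_def)
      from prefers_nearer_le[where F = "at_gains F g" and x = "c m" and s = "signal g1 q (c m)" and
          s' = "signal g1 q (c m')" and B = "B m'", OF s N form this] show ?thesis by simp
    qed
    have 2: "prefers sv2 sw2 l n (at_gains F g) (c m') (space ?S - B m') \<le> ?e (c m) (c m')" for m'
    proof -
      have "space ?S - B m' \<subseteq> {y. (\<Sum>i<l. (cmod (y i - signal g1 q (c m) i))\<^sup>2) \<le> (\<Sum>i<l. (cmod (y i - signal g1 q (c m') i))\<^sup>2)}"
        by (auto simp: B_def)
      from prefers_nearer_le[where F = "at_gains F g" and x = "c m'" and s = "signal g1 q (c m')" and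
          s' = "signal g1 q (c m)" and B = "space ?S - B m'", OF s N form this]
      show ?thesis by (simp add: norm_minus_commute)
    qed
    have "decides sv2 sw2 l n (at_gains F g) M c m (- {m}) \<le>
      (\<Sum>m'\<in>{..<M} - {m}. prefers sv2 sw2 l n (at_gains F g) (c m) (B m') +
         prefers sv2 sw2 l n (at_gains F g) (c m') (space ?S - B m'))"
      using c spQ by (intro decides_wrong_le[OF F s m _ B]) auto
    also have "\<dots> \<le> (\<Sum>m'\<in>{..<M} - {m}. ?e (c m) (c m') + ?e (c m) (c m'))"
      by (intro sum_mono add_mono 1 2)
    finally show ?thesis by (simp add: mult_2)
  qed
  have "ennreal (conditional_error sv2 sw2 l n (at_gains F g) M ?Q) =
      (\<integral>\<^sup>+c. (\<Sum>m<M. decides sv2 sw2 l n (at_gains F g) M c m (- {m})) / of_nat M \<partial>?Q)"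
    by (rule ennreal_conditional_error[OF F s Q M])
  also have "\<dots> \<le> (\<integral>\<^sup>+c. (\<Sum>m<M. \<Sum>m'\<in>{..<M} - {m}. 2 * ?e (c m) (c m')) / of_nat M \<partial>?Q)"
    by (intro nn_integral_mono divide_right_mono_ennreal sum_mono dec) auto
  also have "\<dots> = (\<Sum>m<M. \<Sum>m'\<in>{..<M} - {m}. 2 * (\<integral>\<^sup>+c. ?e (c m) (c m') \<partial>?Q)) / of_nat M"
  proof -
    have 1: "(\<lambda>c. 2 * ?e (c m) (c m')) \<in> borel_measurable ?Q" if "m < M" "m' < M" for m m'
      using em[OF that] by measurable
    have 2: "(\<lambda>c. \<Sum>m'\<in>{..<M} - {m}. 2 * ?e (c m) (c m')) \<in> borel_measurable ?Q" if "m < M" for m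
      by (intro borel_measurable_sum 1) (use that in auto)
    have "(\<integral>\<^sup>+c. (\<Sum>m<M. \<Sum>m'\<in>{..<M} - {m}. 2 * ?e (c m) (c m')) / of_nat M \<partial>?Q) =
        (\<integral>\<^sup>+c. (\<Sum>m<M. \<Sum>m'\<in>{..<M} - {m}. 2 * ?e (c m) (c m')) \<partial>?Q) / of_nat M"
      by (intro nn_integral_divide borel_measurable_sum 1) auto
    also have "(\<integral>\<^sup>+c. (\<Sum>m<M. \<Sum>m'\<in>{..<M} - {m}. 2 * ?e (c m) (c m')) \<partial>?Q) =
        (\<Sum>m<M. \<integral>\<^sup>+c. (\<Sum>m'\<in>{..<M} - {m}. 2 * ?e (c m) (c m')) \<partial>?Q)"
      by (intro nn_integral_sum 2) auto
    also have "\<dots> = (\<Sum>m<M. \<Sum>m'\<in>{..<M} - {m}. \<integral>\<^sup>+c. 2 * ?e (c m) (c m') \<partial>?Q)"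
      by (intro sum.cong refl nn_integral_sum 1) auto
    also have "\<dots> = (\<Sum>m<M. \<Sum>m'\<in>{..<M} - {m}. 2 * (\<integral>\<^sup>+c. ?e (c m) (c m') \<partial>?Q))"
      by (intro sum.cong refl nn_integral_cmult em) auto
    finally show ?thesis .
  qed
  also have "\<dots> \<le> (\<Sum>m<M. \<Sum>m'\<in>{..<M} - {m}. 2 * ennreal K) / of_nat M"
    by (intro divide_right_mono_ennreal sum_mono mult_left_mono pair) auto
  also have "\<dots> \<le> (\<Sum>m<M. \<Sum>m'<M. 2 * ennreal K) / of_nat M"
    by (intro divide_right_mono_ennreal sum_mono sum_mono2) auto
  also have "\<dots> = ennreal (2 * M * K)"
  proof -
    have "(\<Sum>m<M. \<Sum>m'<M. 2 * ennreal K) = ennreal (real M * (real M * (2 * K)))"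
      using K by (simp add: ennreal_of_nat_eq_real_of_nat ennreal_mult)
    then show ?thesis using M K by (simp add: ennreal_of_nat_eq_real_of_nat divide_ennreal mult_ac)
  qed
  finally show ?thesis using K by (subst (asm) ennreal_le_iff) auto
qed

lemma conditional_error_gaussian_le_power:
  assumes F: "measurable_scheme l n F" and s: "sv2 > 0" "sw2 > 0" and E: "E > 0" and M: "M > 0"
    and form: "\<And>x w i. i < l \<Longrightarrow> at_gains F g x w i = signal g1 q x i + (if i \<in> U then p * w (\<kappa> i) else 0)"
    and N: "N \<ge> sv2 + (cmod p)\<^sup>2 * sw2"
  shows "conditional_error sv2 sw2 l n (at_gains F g) M (gaussian_ensemble M l E) \<le>
      2 * real M * (1 / (1 + E * (cmod g1)\<^sup>2 / (4 * N))) ^ l"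
    and "conditional_error sv2 sw2 l n (at_gains F g) M (gaussian_ensemble M l E) \<le>
      2 * real M * (1 / (1 + E * (cmod q)\<^sup>2 / (4 * N))) ^ n"
proof -
  have "0 \<le> (cmod p)\<^sup>2 * sw2" using s by simp
  then have N0: "N > 0" using N s by linarith
  have "1 + 1 / (4 * N) * a * E = 1 + E * a / (4 * N)" for a by simp
  note * = nn_integral_exp_signal_le[OF E, of "1 / (4 * N)", unfolded this]
  show "conditional_error sv2 sw2 l n (at_gains F g) M (gaussian_ensemble M l E) \<le>
      2 * real M * (1 / (1 + E * (cmod g1)\<^sup>2 / (4 * N))) ^ l"
    by (rule conditional_error_gaussian_le[OF F s E M form N _ *(1)]) (use N0 E in simp_all)
  show "conditional_error sv2 sw2 l n (at_gains F g) M (gaussian_ensemble M l E) \<le>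
      2 * real M * (1 / (1 + E * (cmod q)\<^sup>2 / (4 * N))) ^ n"
    by (rule conditional_error_gaussian_le[OF F s E M form N _ *(2)]) (use N0 E in simp_all)
qed

end

section \<open>Averaging over the fading\<close>

lemma nn_integral_gains_product:
  assumes [measurable]: "f1 \<in> borel_measurable borel" "f2 \<in> borel_measurable borel" "f3 \<in> borel_measurable borel"
  shows "(\<integral>\<^sup>+g. f1 (fst g) * f2 (fst (snd g)) * f3 (snd (snd g)) \<partial>gains) =
    (\<integral>\<^sup>+z. f1 z \<partial>cgauss 1) * (\<integral>\<^sup>+z. f2 z \<partial>cgauss 1) * (\<integral>\<^sup>+z. f3 z \<partial>cgauss 1)"
proof -
  interpret C: prob_space "cgauss 1" by (rule prob_space_cgauss) simp
  interpret CC: prob_space "cgauss 1 \<Otimes>\<^sub>M cgauss 1" by (intro prob_space_pair C.prob_space_axioms)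
  have "(\<integral>\<^sup>+g. f1 (fst g) * f2 (fst (snd g)) * f3 (snd (snd g)) \<partial>gains) =
      (\<integral>\<^sup>+z1. \<integral>\<^sup>+z. f1 z1 * f2 (fst z) * f3 (snd z) \<partial>(cgauss 1 \<Otimes>\<^sub>M cgauss 1) \<partial>cgauss 1)"
    by (subst CC.nn_integral_fst[symmetric]) auto
  also have "\<dots> = (\<integral>\<^sup>+z1. \<integral>\<^sup>+z2. \<integral>\<^sup>+z3. f1 z1 * f2 z2 * f3 z3 \<partial>cgauss 1 \<partial>cgauss 1 \<partial>cgauss 1)"
    by (intro nn_integral_cong, subst C.nn_integral_fst[symmetric]) auto
  also have "\<dots> = (\<integral>\<^sup>+z. f1 z \<partial>cgauss 1) * (\<integral>\<^sup>+z. f2 z \<partial>cgauss 1) * (\<integral>\<^sup>+z. f3 z \<partial>cgauss 1)"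
    by (simp add: nn_integral_cmult nn_integral_multc)
  finally show ?thesis .
qed

text \<open>With exponent -1 the right-hand side would not be integrable against the fading density
  at 0; the exponent \<open>e - 1\<close> is, at the price of a factor
  \<open>\<rho> powr e\<close>.\<close>

lemma inverse_one_plus_le_powr:
  fixes x e :: real
  assumes x: "x > 0" and e: "0 < e" "e \<le> 1"
  shows "1 / (1 + x) \<le> x powr (e - 1)"
proof (cases "x \<le> 1")
  case True
  have "x powr 0 \<le> x powr (e - 1)" using True x e by (intro powr_mono') auto
  moreover have "1 / (1 + x) \<le> 1" using x by simp
  moreover have "x powr 0 = 1" using x by simp
  ultimately show ?thesis by linarith
next
  case False
  have "1 / (1 + x) \<le> x powr (-1)" using x by (simp add: powr_minus divide_simps)
  also have "\<dots> \<le> x powr (e - 1)" using False e by (intro powr_mono) auto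
  finally show ?thesis .
qed

text \<open>\<open>D\<close> collects the noise amplification and the reciprocal repetition gain;
  bounding \<open>D powr (1 - e)\<close> by \<open>D\<close> keeps them polynomial in the squared
  gains.\<close>

lemma inverse_one_plus_scaled_le:
  fixes \<rho> A D e :: real
  assumes "\<rho> > 0" "A > 0" "D \<ge> 1" and e: "0 < e" "e \<le> 1"
  shows "1 / (1 + \<rho> * A / D) \<le> D * \<rho> powr (e - 1) * A powr (e - 1)"
proof -
  have "1 / (1 + \<rho> * A / D) \<le> (\<rho> * A / D) powr (e - 1)"
    using assms by (intro inverse_one_plus_le_powr) auto
  also have "\<dots> = D powr (1 - e) * \<rho> powr (e - 1) * A powr (e - 1)"
  proof -
    have "D powr (1 - e) = 1 / D powr (e - 1)" using powr_minus_divide[of D "e - 1"] by simp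
    then show ?thesis using assms by (simp add: powr_mult powr_divide)
  qed
  also have "\<dots> \<le> D powr 1 * \<rho> powr (e - 1) * A powr (e - 1)"
    using assms by (intro mult_right_mono powr_mono) auto
  finally show ?thesis using assms by simp
qed

lemma le_powr_self:
  fixes x a :: real
  assumes "0 \<le> x" "x \<le> 1" "0 \<le> a" "a \<le> 1"
  shows "x \<le> x powr a"
  using powr_mono'[of a 1 x] assms by (cases "x = 0") auto

context naf_layout
begin

text \<open>Raising the two power bounds to 1 / l and 1 / n removes the block length. Since l = 2 n,
  their product bounds \<open>P powr (3 / l)\<close>, which is at least P because P is at most 1 and
  l at least 4. The noise factor N involves only g2 and the bound on 1 / |b|^2 only h, so the result
  splits into weights of single gains.\<close>

lemma conditional_error_naf_le:
  fixes \<rho> \<kappa>\<^sub>0 e c :: real and b :: "complex \<Rightarrow> complex" and g :: "complex \<times> complex \<times> complex"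
  assumes F: "measurable_scheme l n F" and s: "sv2 > 0" "sw2 > 0" and \<rho>: "\<rho> > 0" and M: "M > 0"
    and form: "\<And>g1 g2 h x w i. i < l \<Longrightarrow>
      F g1 g2 h x w i = signal g1 (g2 * b h * h) x i + (if i \<in> U then (g2 * b h) * w (\<kappa> i) else 0)"
    and \<kappa>\<^sub>0: "\<kappa>\<^sub>0 > 0" "sv2 = \<kappa>\<^sub>0 * sw2" and b: "\<And>h. (cmod (b h))\<^sup>2 \<le> 1" "\<And>h. 1 / ((cmod h)\<^sup>2 + 2) \<le> (cmod (b h))\<^sup>2"
    and e: "0 < e" "e \<le> 1" and c: "c \<ge> 1" "c \<ge> 1 / \<kappa>\<^sub>0" and n: "n \<ge> 2"
  defines "P \<equiv> conditional_error sv2 sw2 l n (at_gains F g) M (gaussian_ensemble M l (\<rho> * sv2))"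
  shows "ennreal P \<le> ennreal (32 * (2 * real M) powr (3 / l) * \<rho> powr (2 * (e - 1))) *
      (cgauss_weight e c (fst g) * cgauss_weight e c (fst (snd g)) * cgauss_weight e c (snd (snd g)))" (is ?th1)
    and "ennreal P \<le> ennreal (4 * (2 * real M) powr (1 / l) * \<rho> powr (e - 1)) *
      (cgauss_weight e c (fst g) * cgauss_weight 1 c (fst (snd g)) * 1)" (is ?th2)
proof -
  obtain g1 g2 h where g: "g = (g1, g2, h)" by (cases g) auto
  \<comment> \<open>Total noise variance in units of \<open>sv2\<close>: as |b| <= 1, the forwarded
    relay noise adds at most |g2|^2 sw2.\<close>
  define N where "N = 1 + (cmod g2)\<^sup>2 / \<kappa>\<^sub>0"
  have N1: "N \<ge> 1" unfolding N_def using \<kappa>\<^sub>0 by simp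
  have E: "\<rho> * sv2 > 0" using \<rho> s by simp
  have l: "l = 2 * n" "real l = 2 * real n" using card_U(3) by auto
  have noise: "sv2 * N \<ge> sv2 + (cmod (g2 * b h))\<^sup>2 * sw2"
  proof -
    have "(cmod (g2 * b h))\<^sup>2 * sw2 \<le> (cmod g2)\<^sup>2 * 1 * sw2"
      unfolding norm_mult power_mult_distrib using b(1)[of h] s by (intro mult_right_mono mult_left_mono) auto
    also have "\<dots> = sv2 * ((cmod g2)\<^sup>2 / \<kappa>\<^sub>0)" using \<kappa>\<^sub>0 by simp
    finally show ?thesis by (simp add: N_def distrib_left)
  qed
  have form': "at_gains F g x w i = signal g1 (g2 * b h * h) x i + (if i \<in> U then (g2 * b h) * w (\<kappa> i) else 0)"
    if "i < l" for x w i using form[OF that] by (simp add: g)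
  let ?P1 = "1 + \<rho> * (cmod g1)\<^sup>2 / (4 * N)" and ?P2 = "1 + \<rho> * (cmod (g2 * b h * h))\<^sup>2 / (4 * N)"
  have P1: "?P1 \<ge> 1" and P2: "?P2 \<ge> 1" using \<rho> N1 by auto
  have scale: "\<rho> * sv2 * a / (4 * (sv2 * N)) = \<rho> * a / (4 * N)" for a using s by simp
  have B1: "P \<le> 2 * real M * (1 / ?P1) ^ l" and B2: "P \<le> 2 * real M * (1 / ?P2) ^ n"
    using conditional_error_gaussian_le_power[OF F s E M form' noise] unfolding P_def scale by auto
  have P01: "0 \<le> P" "P \<le> 1"
    unfolding P_def using code_ensemble_gaussian[OF E]
    by (auto intro!: conditional_error_nonneg[OF F s _ M] conditional_error_le_1[OF F s _ M])
  have R1: "P powr (1 / l) \<le> (2 * real M) powr (1 / l) * (1 / ?P1)"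
  proof -
    have "P powr (1 / l) \<le> (2 * real M * (1 / ?P1) ^ l) powr (1 / l)"
      using P01 B1 by (intro powr_mono2) auto
    also have "\<dots> = (2 * real M) powr (1 / l) * ((1 / ?P1) ^ l) powr (1 / l)"
      by (rule powr_mult)
    also have "((1 / ?P1) ^ l) powr (1 / l) = 1 / ?P1"
      using P1 n l by (subst powr_realpow[symmetric]) (auto simp: powr_powr)
    finally show ?thesis .
  qed
  have R2: "P powr (1 / n) \<le> (2 * real M) powr (1 / n) * (1 / ?P2)"
  proof -
    have "P powr (1 / n) \<le> (2 * real M * (1 / ?P2) ^ n) powr (1 / n)"
      using P01 B2 by (intro powr_mono2) auto
    also have "\<dots> = (2 * real M) powr (1 / n) * ((1 / ?P2) ^ n) powr (1 / n)"
      by (rule powr_mult)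
    also have "((1 / ?P2) ^ n) powr (1 / n) = 1 / ?P2"
      using P2 n by (subst powr_realpow[symmetric]) (auto simp: powr_powr)
    finally show ?thesis .
  qed
  have S1: "1 / ?P1 \<le> 4 * N * \<rho> powr (e - 1) * ((cmod g1)\<^sup>2) powr (e - 1)" if "g1 \<noteq> 0"
    using N1 \<rho> e that by (intro inverse_one_plus_scaled_le) auto
  have S2: "1 / ?P2 \<le> 4 * N * ((cmod h)\<^sup>2 + 2) * \<rho> powr (e - 1) * (((cmod g2)\<^sup>2) powr (e - 1) * ((cmod h)\<^sup>2) powr (e - 1))"
    if "g2 \<noteq> 0" "h \<noteq> 0"
  proof -
    have "(cmod g2)\<^sup>2 * (cmod h)\<^sup>2 * (1 / ((cmod h)\<^sup>2 + 2)) \<le> (cmod g2)\<^sup>2 * (cmod h)\<^sup>2 * (cmod (b h))\<^sup>2"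
      using b(2)[of h] by (intro mult_left_mono) auto
    then have "\<rho> * ((cmod g2)\<^sup>2 * (cmod h)\<^sup>2 / ((cmod h)\<^sup>2 + 2)) / (4 * N) \<le> \<rho> * (cmod (g2 * b h * h))\<^sup>2 / (4 * N)"
      using \<rho> N1 by (intro divide_right_mono mult_left_mono) (auto simp: norm_mult power_mult_distrib mult_ac)
    then have "1 / ?P2 \<le> 1 / (1 + \<rho> * ((cmod g2)\<^sup>2 * (cmod h)\<^sup>2) / (4 * N * ((cmod h)\<^sup>2 + 2)))"
      using \<rho> N1 P2 by (intro divide_left_mono mult_pos_pos) (auto simp: add_pos_nonneg mult_ac)
    also have "\<dots> \<le> 4 * N * ((cmod h)\<^sup>2 + 2) * \<rho> powr (e - 1) * ((cmod g2)\<^sup>2 * (cmod h)\<^sup>2) powr (e - 1)"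
    proof (rule inverse_one_plus_scaled_le)
      have "1 * 1 \<le> (4 * N) * ((cmod h)\<^sup>2 + 2)" using N1 by (intro mult_mono) auto
      then show "4 * N * ((cmod h)\<^sup>2 + 2) \<ge> 1" by simp
    qed (use \<rho> e that in auto)
    finally show ?thesis by (simp add: powr_mult)
  qed
  let ?w = "\<lambda>e z. (1 + c * (cmod z)\<^sup>2)\<^sup>2 * ((cmod z)\<^sup>2) powr (e - 1)"
  have w: "cgauss_weight e c z = ennreal (?w e z)" if "z \<noteq> 0" for z e
    using that by (simp add: cgauss_weight_def)
  have one: "1 \<le> (1 + c * (cmod z)\<^sup>2)\<^sup>2" for z :: complex using c by (intro one_le_power) auto
  have Nle: "N \<le> 1 + c * (cmod g2)\<^sup>2"
    unfolding N_def using mult_right_mono[OF c(2), of "(cmod g2)\<^sup>2"] by simp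
  have w0: "cgauss_weight e c z \<noteq> 0" for z e
  proof (cases "z = 0")
    case False
    have "?w e z > 0" using False one[of z] by (intro mult_pos_pos) (auto intro: less_le_trans[OF zero_less_one])
    then show ?thesis using w[OF False] by (simp add: ennreal_eq_0_iff not_le)
  qed (simp add: cgauss_weight_def)
  have wtop: "cgauss_weight e c 0 = \<infinity>" for e by (simp add: cgauss_weight_def)
  have K0: "(2 * real M) powr a > 0" "\<rho> powr a > 0" for a using M \<rho> by auto
  show ?th1
  proof (cases "g1 = 0 \<or> g2 = 0 \<or> h = 0")
    case True
    then have "cgauss_weight e c (fst g) * cgauss_weight e c (fst (snd g)) * cgauss_weight e c (snd (snd g)) = \<infinity>"
      using w0 wtop by (auto simp: g ennreal_mult_eq_top_iff)
    then show ?thesis using K0 by (simp add: ennreal_mult_top)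
  next
    case False
    then have nz: "g1 \<noteq> 0" "g2 \<noteq> 0" "h \<noteq> 0" by auto
    have "3 / real l \<le> 1" using n l by simp
    then have "P \<le> P powr (3 / l)" using P01 by (intro le_powr_self) auto
    also have "3 / l = 1 / l + 1 / n" using n l by (simp add: field_simps)
    also have "P powr (1 / l + 1 / n) = P powr (1 / l) * P powr (1 / n)" by (rule powr_add)
    also have "\<dots> \<le> ((2 * real M) powr (1 / l) * (1 / ?P1)) * ((2 * real M) powr (1 / n) * (1 / ?P2))"
      using P1 by (intro mult_mono R1 R2) auto
    also have "\<dots> = (2 * real M) powr (1 / l + 1 / n) * ((1 / ?P1) * (1 / ?P2))"
      by (simp add: powr_add)
    also have "1 / l + 1 / n = 3 / l" using n l by (simp add: field_simps)
    also have "(1 / ?P1) * (1 / ?P2) \<le> (4 * N * \<rho> powr (e - 1) * ((cmod g1)\<^sup>2) powr (e - 1)) *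
       (4 * N * ((cmod h)\<^sup>2 + 2) * \<rho> powr (e - 1) * (((cmod g2)\<^sup>2) powr (e - 1) * ((cmod h)\<^sup>2) powr (e - 1)))"
      using P1 P2 N1 nz by (intro mult_mono S1 S2) auto
    also have "\<dots> = 16 * \<rho> powr (2 * (e - 1)) * ((1 * ((cmod g1)\<^sup>2) powr (e - 1)) * (N\<^sup>2 * ((cmod g2)\<^sup>2) powr (e - 1)) *
        (((cmod h)\<^sup>2 + 2) * ((cmod h)\<^sup>2) powr (e - 1)))"
    proof -
      have "\<rho> powr (2 * (e - 1)) = \<rho> powr (e - 1) * \<rho> powr (e - 1)" unfolding mult_2 by (rule powr_add)
      then show ?thesis by (simp add: power2_eq_square)
    qed
    also have "\<dots> \<le> 16 * \<rho> powr (2 * (e - 1)) * (?w e g1 * ?w e g2 * (2 * ?w e h))"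
    proof -
      have "(cmod h)\<^sup>2 \<le> c * (cmod h)\<^sup>2" using c(1) by (simp add: mult_le_cancel_right1)
      then have "(cmod h)\<^sup>2 + 2 \<le> 2 * (1 + c * (cmod h)\<^sup>2)"
        using zero_le_power2[of "cmod h"] unfolding distrib_left by linarith
      also have "\<dots> \<le> 2 * (1 + c * (cmod h)\<^sup>2)\<^sup>2"
        using c by (intro mult_left_mono self_le_power) auto
      finally have "((cmod h)\<^sup>2 + 2) * ((cmod h)\<^sup>2) powr (e - 1) \<le> (2 * (1 + c * (cmod h)\<^sup>2)\<^sup>2) * ((cmod h)\<^sup>2) powr (e - 1)"
        by (intro mult_right_mono) auto
      then have C: "((cmod h)\<^sup>2 + 2) * ((cmod h)\<^sup>2) powr (e - 1) \<le> 2 * ?w e h"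
        by (simp only: mult.assoc)
      have B: "N\<^sup>2 * ((cmod g2)\<^sup>2) powr (e - 1) \<le> ?w e g2"
        using Nle N1 by (intro mult_right_mono power_mono) auto
      have A: "1 * ((cmod g1)\<^sup>2) powr (e - 1) \<le> ?w e g1"
        using one by (intro mult_right_mono) auto
      show ?thesis
        by (intro mult_left_mono mult_mono[OF mult_mono[OF A B] C]) auto
    qed
    also have "\<dots> = 32 * \<rho> powr (2 * (e - 1)) * (?w e g1 * ?w e g2 * ?w e h)" by simp
    finally have "P \<le> (2 * real M) powr (3 / l) * (32 * \<rho> powr (2 * (e - 1)) * (?w e g1 * ?w e g2 * ?w e h))"
      by (blast intro: mult_left_mono powr_ge_zero)
    then have "ennreal P \<le> ennreal ((32 * (2 * real M) powr (3 / l) * \<rho> powr (2 * (e - 1))) * (?w e g1 * ?w e g2 * ?w e h))"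
      by (intro ennreal_leI) (simp add: mult_ac)
    also have "\<dots> = ennreal (32 * (2 * real M) powr (3 / l) * \<rho> powr (2 * (e - 1))) * (ennreal (?w e g1) * ennreal (?w e g2) * ennreal (?w e h))"
    proof -
      have "ennreal (k * (a * b * d)) = ennreal k * (ennreal a * ennreal b * ennreal d)"
        if "a \<ge> 0" "b \<ge> 0" "d \<ge> 0" for k a b d :: real
        using that by (simp add: ennreal_mult'' ennreal_mult)
      from this[of "?w e g1" "?w e g2" "?w e h"] show ?thesis by simp
    qed
    finally show ?thesis
      by (simp only: g w[OF nz(1)] w[OF nz(2)] w[OF nz(3)] fst_conv snd_conv)
  qed
  \<comment> \<open>Only the direct path is used; g2 enters through N alone, without a negative
    power, hence its weight has exponent parameter 1, and h has no weight.\<close>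
  show ?th2
  proof (cases "g1 = 0 \<or> g2 = 0")
    case True
    then have "cgauss_weight e c (fst g) * cgauss_weight 1 c (fst (snd g)) * 1 = \<infinity>"
      using w0 wtop by (auto simp: g ennreal_mult_eq_top_iff)
    then show ?thesis using K0 by (simp add: ennreal_mult_top)
  next
    case False
    then have nz: "g1 \<noteq> 0" "g2 \<noteq> 0" by auto
    have "P \<le> P powr (1 / l)" using P01 n l by (intro le_powr_self) auto
    also have "\<dots> \<le> (2 * real M) powr (1 / l) * (1 / ?P1)" by (rule R1)
    also have "\<dots> \<le> (2 * real M) powr (1 / l) * (4 * N * \<rho> powr (e - 1) * ((cmod g1)\<^sup>2) powr (e - 1))"
      by (intro mult_left_mono S1 nz) auto
    also have "\<dots> = 4 * (2 * real M) powr (1 / l) * \<rho> powr (e - 1) * ((1 * ((cmod g1)\<^sup>2) powr (e - 1)) * N)"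
      by simp
    also have "\<dots> \<le> 4 * (2 * real M) powr (1 / l) * \<rho> powr (e - 1) * (?w e g1 * ?w 1 g2)"
    proof (intro mult_left_mono mult_mono)
      have "N \<le> (1 + c * (cmod g2)\<^sup>2)\<^sup>2"
        using Nle self_le_power[of "1 + c * (cmod g2)\<^sup>2" 2] c by fastforce
      then show "N \<le> ?w 1 g2" using nz by simp
    qed (use one[of g1] N1 in auto)
    finally have "ennreal P \<le> ennreal (4 * (2 * real M) powr (1 / l) * \<rho> powr (e - 1) * (?w e g1 * ?w 1 g2))"
      by (rule ennreal_leI)
    also have "\<dots> = ennreal (4 * (2 * real M) powr (1 / l) * \<rho> powr (e - 1)) * (ennreal (?w e g1) * ennreal (?w 1 g2))"
    proof -
      have "ennreal (k * (a * b)) = ennreal k * (ennreal a * ennreal b)" if "a \<ge> 0" "b \<ge> 0" for k a b :: real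
        using that by (simp add: ennreal_mult'' ennreal_mult)
      from this[of "?w e g1" "?w 1 g2"] show ?thesis by simp
    qed
    finally show ?thesis by (simp only: g w[OF nz(1)] w[OF nz(2)] fst_conv snd_conv mult_1_right)
  qed
qed

text \<open>By independence the weights integrate to constants that do not depend on \<rho>; all the
  decay stands in front of them.\<close>

lemma error_probability_naf_le:
  fixes \<rho> \<kappa>\<^sub>0 e c :: real and b :: "complex \<Rightarrow> complex"
  assumes F: "measurable_scheme l n F" and s: "sv2 > 0" "sw2 > 0" and \<rho>: "\<rho> > 0" and M: "M > 0"
    and form: "\<And>g1 g2 h x w i. i < l \<Longrightarrow>
      F g1 g2 h x w i = signal g1 (g2 * b h * h) x i + (if i \<in> U then (g2 * b h) * w (\<kappa> i) else 0)"
    and \<kappa>\<^sub>0: "\<kappa>\<^sub>0 > 0" "sv2 = \<kappa>\<^sub>0 * sw2" and b: "\<And>h. (cmod (b h))\<^sup>2 \<le> 1" "\<And>h. 1 / ((cmod h)\<^sup>2 + 2) \<le> (cmod (b h))\<^sup>2"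
    and e: "0 < e" "e \<le> 1" and c: "c \<ge> 1" "c \<ge> 1 / \<kappa>\<^sub>0" and n: "n \<ge> 2"
  defines "P \<equiv> error_probability sv2 sw2 l n F M (gaussian_ensemble M l (\<rho> * sv2))"
  shows "P \<le> 32 * (2 * real M) powr (3 / l) * \<rho> powr (2 * (e - 1)) * weight_integral e c ^ 3"
    and "P \<le> 4 * (2 * real M) powr (1 / l) * \<rho> powr (e - 1) * (weight_integral e c * weight_integral 1 c)"
proof -
  let ?Q = "gaussian_ensemble M l (\<rho> * sv2)"
  have E: "\<rho> * sv2 > 0" using \<rho> s by simp
  note Q = code_ensemble_gaussian[OF E, of M l]
  let ?e = "\<lambda>g. conditional_error sv2 sw2 l n (at_gains F g) M ?Q"
  interpret G: prob_space gains by (rule prob_space_gains)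
  have m: "?e \<in> borel_measurable gains"
    using borel_measurable_conditional_error[OF F s Q] by (simp add: measurable_cong_sets[OF sets_gains refl])
  have int: "integrable gains ?e"
    using m by (rule G.integrable_const_bound[where B = 1, rotated])
      (auto simp: conditional_error_nonneg[OF F s Q M] conditional_error_le_1[OF F s Q M])
  have P: "ennreal P = (\<integral>\<^sup>+g. ennreal (?e g) \<partial>gains)"
    unfolding P_def error_probability_eq[OF F s Q]
    using int conditional_error_nonneg[OF F s Q M] by (intro nn_integral_eq_integral[symmetric]) auto
  have c0: "c \<ge> 0" using c by simp
  have J: "(\<integral>\<^sup>+z. cgauss_weight e c z \<partial>cgauss 1) = ennreal (weight_integral e c)" if "e > 0" for e
    unfolding weight_integral_def using nn_integral_cgauss_weight_finite[OF that c0] by simp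
  have J0: "weight_integral e c \<ge> 0" for e by (simp add: weight_integral_def)
  note bounds = conditional_error_naf_le[OF F s \<rho> M form \<kappa>\<^sub>0 b e c n]
  have mw: "(\<lambda>g. cgauss_weight a c (fst g) * cgauss_weight a' c (fst (snd g)) * k (snd (snd g))) \<in> borel_measurable gains"
    if [measurable]: "k \<in> borel_measurable borel" for a a' k by measurable
  have "ennreal P \<le> (\<integral>\<^sup>+g. ennreal (32 * (2 * real M) powr (3 / l) * \<rho> powr (2 * (e - 1))) *
      (cgauss_weight e c (fst g) * cgauss_weight e c (fst (snd g)) * cgauss_weight e c (snd (snd g))) \<partial>gains)"
    unfolding P by (intro nn_integral_mono bounds)
  also have "\<dots> = ennreal (32 * (2 * real M) powr (3 / l) * \<rho> powr (2 * (e - 1))) *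
      (ennreal (weight_integral e c) * ennreal (weight_integral e c) * ennreal (weight_integral e c))"
    using mw[of "cgauss_weight e c"] e by (simp add: nn_integral_cmult nn_integral_gains_product J)
  also have "\<dots> = ennreal (32 * (2 * real M) powr (3 / l) * \<rho> powr (2 * (e - 1)) * weight_integral e c ^ 3)"
    using J0 by (simp add: ennreal_mult[symmetric] power3_eq_cube)
  finally show "P \<le> 32 * (2 * real M) powr (3 / l) * \<rho> powr (2 * (e - 1)) * weight_integral e c ^ 3"
    using J0 by (subst (asm) ennreal_le_iff) auto
  have "ennreal P \<le> (\<integral>\<^sup>+g. ennreal (4 * (2 * real M) powr (1 / l) * \<rho> powr (e - 1)) *
      (cgauss_weight e c (fst g) * cgauss_weight 1 c (fst (snd g)) * (\<lambda>_. 1) (snd (snd g))) \<partial>gains)"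
    unfolding P by (intro nn_integral_mono bounds)
  also have "\<dots> = ennreal (4 * (2 * real M) powr (1 / l) * \<rho> powr (e - 1)) *
      (\<integral>\<^sup>+g. cgauss_weight e c (fst g) * cgauss_weight 1 c (fst (snd g)) * (\<lambda>_. 1) (snd (snd g)) \<partial>gains)"
    by (rule nn_integral_cmult[OF mw]) simp
  also have "(\<integral>\<^sup>+g. cgauss_weight e c (fst g) * cgauss_weight 1 c (fst (snd g)) * (\<lambda>_. 1) (snd (snd g)) \<partial>gains) =
      ennreal (weight_integral e c) * ennreal (weight_integral 1 c) * (\<integral>\<^sup>+z. 1 \<partial>cgauss 1)"
    using e by (subst nn_integral_gains_product) (auto simp: J)
  also have "(\<integral>\<^sup>+z. 1 \<partial>cgauss 1) = 1"
    using prob_space.emeasure_space_1[OF prob_space_cgauss[of 1]] by simp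
  also have "ennreal (4 * (2 * real M) powr (1 / l) * \<rho> powr (e - 1)) * (ennreal (weight_integral e c) * ennreal (weight_integral 1 c) * 1) =
      ennreal (4 * (2 * real M) powr (1 / l) * \<rho> powr (e - 1) * (weight_integral e c * weight_integral 1 c))"
    using J0 by (simp add: ennreal_mult[symmetric])
  finally show "P \<le> 4 * (2 * real M) powr (1 / l) * \<rho> powr (e - 1) * (weight_integral e c * weight_integral 1 c)"
    using J0 by (subst (asm) ennreal_le_iff) auto
qed

end

section \<open>Diversity and multiplexing gains\<close>

lemma diversity_value_le:
  assumes "\<rho> > 1" "\<rho> powr - a \<le> p"
  shows "(if p = 0 then \<infinity> else ereal (- log 2 p / log 2 \<rho>)) \<le> ereal a"
proof -
  have p: "p > 0" using assms by (auto intro: less_le_trans[of 0 "\<rho> powr - a"])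
  have "log 2 (\<rho> powr - a) \<le> log 2 p" using assms p by simp
  then have "- log 2 p \<le> a * log 2 \<rho>" using assms by (simp add: log_powr)
  moreover have "log 2 \<rho> > 0" using assms by simp
  ultimately have "- log 2 p / log 2 \<rho> \<le> a" by (simp only: pos_divide_le_eq)
  then show ?thesis using p by simp
qed

lemma diversity_value_ge:
  assumes "\<rho> > 1" "0 \<le> p" "p \<le> \<rho> powr - a"
  shows "ereal a \<le> (if p = 0 then \<infinity> else ereal (- log 2 p / log 2 \<rho>))"
proof (cases "p = 0")
  case False
  then have p: "p > 0" using assms by simp
  have "log 2 p \<le> log 2 (\<rho> powr - a)" using assms p by simp
  then have "a * log 2 \<rho> \<le> - log 2 p" using assms by (simp add: log_powr)
  moreover have "log 2 \<rho> > 0" using assms by simp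
  ultimately have "a \<le> - log 2 p / log 2 \<rho>" by (simp only: pos_le_divide_eq)
  then show ?thesis using False by simp
qed simp

lemma has_diversity_gain_le:
  assumes lower: "\<And>\<epsilon>. \<epsilon> > 0 \<Longrightarrow> \<forall>\<^sub>F \<rho> in at_top. \<rho> powr - (d + \<epsilon>) \<le> PE \<rho>"
    and D: "has_diversity_gain PE D"
  shows "D \<le> ereal d"
proof (rule ereal_le_epsilon2)
  fix \<epsilon> :: real assume \<epsilon>: "\<epsilon> > 0"
  have "D \<le> ereal (d + \<epsilon>)"
  proof (rule tendsto_upperbound[OF D[unfolded has_diversity_gain_def]])
    show "\<forall>\<^sub>F \<rho> in at_top. (if PE \<rho> = 0 then \<infinity> else ereal (- log 2 (PE \<rho>) / log 2 \<rho>)) \<le> ereal (d + \<epsilon>)"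
      using lower[OF \<epsilon>] eventually_gt_at_top[of 1] by eventually_elim (rule diversity_value_le)
  qed simp
  then show "D \<le> ereal d + ereal \<epsilon>" by simp
qed

lemma has_diversity_gainI:
  assumes lower: "\<And>\<epsilon>. \<epsilon> > 0 \<Longrightarrow> \<forall>\<^sub>F \<rho> in at_top. \<rho> powr - (d + \<epsilon>) \<le> PE \<rho>"
    and upper: "\<And>\<epsilon>. \<epsilon> > 0 \<Longrightarrow> \<forall>\<^sub>F \<rho> in at_top. PE \<rho> \<le> \<rho> powr - (d - \<epsilon>)"
  shows "has_diversity_gain PE (ereal d)"
  unfolding has_diversity_gain_def
proof (rule order_tendstoI)
  let ?f = "\<lambda>\<rho>. if PE \<rho> = 0 then \<infinity> else ereal (- log 2 (PE \<rho>) / log 2 \<rho>)"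
  fix a assume "a < ereal d"
  then obtain z where z: "a < ereal z" "ereal z < ereal d" using ereal_dense2 by blast
  then have "d - z > 0" by simp
  from upper[OF this] show "\<forall>\<^sub>F \<rho> in at_top. a < ?f \<rho>"
    using lower[OF zero_less_one] eventually_gt_at_top[of 1]
  proof eventually_elim
    case (elim \<rho>)
    have "0 \<le> PE \<rho>" by (rule order_trans[OF powr_ge_zero elim(2)])
    then have "ereal z \<le> ?f \<rho>" using elim by (intro diversity_value_ge) auto
    with z(1) show ?case by (rule less_le_trans)
  qed
next
  let ?f = "\<lambda>\<rho>. if PE \<rho> = 0 then \<infinity> else ereal (- log 2 (PE \<rho>) / log 2 \<rho>)"
  fix a assume "ereal d < a"
  then obtain z where z: "ereal d < ereal z" "ereal z < a" using ereal_dense2 by blast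
  then have "z - d > 0" by simp
  from lower[OF this] show "\<forall>\<^sub>F \<rho> in at_top. ?f \<rho> < a"
    using eventually_gt_at_top[of 1]
  proof (eventually_elim)
    case (elim \<rho>)
    then have "?f \<rho> \<le> ereal z" by (intro diversity_value_le) auto
    then show ?case using z(2) by (rule le_less_trans)
  qed
qed

lemma multiplexing_gain_ge_2:
  assumes "has_multiplexing_gain l M r" "\<rho> > 0"
  shows "M \<rho> \<ge> 2"
proof (rule ccontr)
  assume "\<not> M \<rho> \<ge> 2"
  then have "M \<rho> = 0 \<or> M \<rho> = 1" by auto
  \<comment> \<open>\<open>M \<rho> = 0\<close> gives rate 0 as well, by the convention
    \<open>ln 0 = 0\<close>.\<close>
  then have "rate l (M \<rho>) = 0" by (auto simp: rate_def log_def)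
  then show False using assms by (auto simp: has_multiplexing_gain_def)
qed

lemma multiplexing_gain_bounds:
  assumes M: "has_multiplexing_gain l M r" and l: "l > 0" and \<delta>: "\<delta> > 0"
  shows "\<forall>\<^sub>F \<rho> in at_top. \<rho> powr (real l * (r - \<delta>)) \<le> real (M \<rho>) \<and> real (M \<rho>) \<le> \<rho> powr (real l * (r + \<delta>))"
proof -
  have lim: "((\<lambda>\<rho>. rate l (M \<rho>) / log 2 \<rho>) \<longlongrightarrow> r) at_top" using M by (simp add: has_multiplexing_gain_def)
  have "\<forall>\<^sub>F \<rho> in at_top. r - \<delta> < rate l (M \<rho>) / log 2 \<rho>" "\<forall>\<^sub>F \<rho> in at_top. rate l (M \<rho>) / log 2 \<rho> < r + \<delta>"
    using order_tendstoD[OF lim] \<delta> by auto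
  then show ?thesis using eventually_gt_at_top[of 1]
  proof eventually_elim
    case (elim \<rho>)
    have M2: "real (M \<rho>) \<ge> 2" using multiplexing_gain_ge_2[OF M, of \<rho>] elim by simp
    have log0: "log 2 \<rho> > 0" using elim by simp
    have "(r - \<delta>) * log 2 \<rho> < log 2 (real (M \<rho>)) / l" "log 2 (real (M \<rho>)) / l < (r + \<delta>) * log 2 \<rho>"
      using elim(1,2) unfolding rate_def by (simp_all only: pos_less_divide_eq[OF log0] pos_divide_less_eq[OF log0])
    moreover have "real l > 0" using l by simp
    ultimately have "(r - \<delta>) * log 2 \<rho> * l < log 2 (real (M \<rho>))" "log 2 (real (M \<rho>)) < (r + \<delta>) * log 2 \<rho> * l"
      by (simp_all only: pos_less_divide_eq pos_divide_less_eq)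
    then have "log 2 (\<rho> powr (real l * (r - \<delta>))) \<le> log 2 (real (M \<rho>))"
      "log 2 (real (M \<rho>)) \<le> log 2 (\<rho> powr (real l * (r + \<delta>)))"
      using elim by (simp_all add: log_powr mult_ac)
    then show ?case using elim M2 by simp
  qed
qed

lemma eventually_le_powr:
  assumes "\<epsilon> > (0::real)"
  shows "\<forall>\<^sub>F \<rho> in at_top. K \<le> \<rho> powr \<epsilon>"
proof -
  have "filterlim (\<lambda>\<rho>. \<rho> powr \<epsilon>) at_top (at_top :: real filter)" using assms by real_asymp
  then show ?thesis by (simp add: filterlim_at_top)
qed

lemma error_probability_outage:
  fixes X a p \<rho> :: real
  assumes F: "measurable_scheme l n F" and s: "sv2 > 0" "sw2 > 0" and Q: "code_ensemble M l Q" and M: "M > 0"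
    and \<rho>: "\<rho> > 0" and E: "E = \<rho> * sv2" and lin: "relay_linear E l F M Q"
    and a: "a > 0" and p: "p \<ge> 0"
    and X: "X \<ge> 1" and le: "p \<le> 1 - ((3 * real l ^ 2 + 10 * real l) / a + X ^ l * exp a / real M)"
  shows "p * (exp (-1) * min 1 (X / \<rho>)) * (exp (-1) * min 1 (X\<^sup>2 / \<rho>)) \<le> error_probability sv2 sw2 l n F M Q"
proof (rule error_probability_ge[OF F s Q M _ _ p])
  have region: "E * y \<le> x * sv2" if "y \<le> x / \<rho>" for x y
  proof -
    have "\<rho> * y \<le> x" using that \<rho> by (simp add: le_divide_eq mult.commute)
    then have "\<rho> * y * sv2 \<le> x * sv2" using s by (intro mult_right_mono) auto
    then show ?thesis by (simp add: E mult_ac)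
  qed
  have E0: "E > 0" using E \<rho> s by simp
  fix g :: "complex \<times> complex \<times> complex"
  assume "(cmod (fst g))\<^sup>2 \<le> X / \<rho>" "(cmod (fst (snd g)))\<^sup>2 \<le> X\<^sup>2 / \<rho>"
  from conditional_success_outage[OF F s Q M E0 lin X a region[OF this(1)] region[OF this(2)]]
  have "1 - conditional_error sv2 sw2 l n (at_gains F g) M Q \<le> (3 * real l ^ 2 + 10 * real l) / a + X ^ l * exp a / real M"
    by simp
  then show "p \<le> conditional_error sv2 sw2 l n (at_gains F g) M Q" using le by linarith
qed (use X \<rho> in auto)

lemma error_probability_silence:
  fixes \<eta> \<delta> a p \<rho> :: real
  assumes F: "measurable_scheme l n F" and s: "sv2 > 0" "sw2 > 0" and Q: "code_ensemble M l Q" and M: "M > 0"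
    and \<rho>: "\<rho> > 0" and E: "E = \<rho> * sv2" and lin: "relay_linear E l F M Q"
    and a: "a > 0" and p: "p \<ge> 0"
    and \<eta>: "\<eta> > 0" and \<delta>: "\<delta> \<ge> 0"
    and le: "p \<le> 1 - ((\<eta> * real l + (1 + 1 / \<eta>) * 4 * \<delta> * real l) / a + exp a / real M)"
  shows "p * (exp (-1) * min 1 (\<delta> / \<rho>)) * (exp (-1) * min 1 (\<delta> / \<rho>)) \<le> error_probability sv2 sw2 l n F M Q"
proof (rule error_probability_ge[OF F s Q M _ _ p])
  have region: "E * y \<le> \<delta> * sv2" if "y \<le> \<delta> / \<rho>" for y
  proof -
    have "\<rho> * y \<le> \<delta>" using that \<rho> by (simp add: le_divide_eq mult.commute)
    then have "\<rho> * y * sv2 \<le> \<delta> * sv2" using s by (intro mult_right_mono) auto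
    then show ?thesis by (simp add: E mult_ac)
  qed
  have E0: "E > 0" using E \<rho> s by simp
  fix g :: "complex \<times> complex \<times> complex"
  assume "(cmod (fst g))\<^sup>2 \<le> \<delta> / \<rho>" "(cmod (fst (snd g)))\<^sup>2 \<le> \<delta> / \<rho>"
  from conditional_success_silence[OF F s Q M E0 lin a \<eta> \<delta> region[OF this(1)] region[OF this(2)]]
  show "p \<le> conditional_error sv2 sw2 l n (at_gains F g) M Q" using le by linarith
qed (use \<delta> \<rho> in auto)

definition af_tradeoff :: "real \<Rightarrow> real" where
  "af_tradeoff r = (1 - r) + max (1 - 2 * r) 0"

text \<open>At \<open>r = 0\<close> the number of messages may be bounded, so that a factor \<open>K > 1\<close> is too much; there
  both the direct and the relayed signal have to be drowned in noise instead.\<close>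

lemma relay_linear_lower_bound:
  fixes l :: nat and \<epsilon> r :: real
  assumes l: "l > 0" and r: "r \<in> {0..1}" and M: "has_multiplexing_gain l M r" and \<epsilon>: "\<epsilon> > 0"
    and pos: "\<And>\<rho>. \<rho> > 0 \<Longrightarrow> sv2 \<rho> > 0 \<and> sw2 \<rho> > 0 \<and> E \<rho> = \<rho> * sv2 \<rho>"
    and F: "\<And>\<rho>. \<rho> > 0 \<Longrightarrow> measurable_scheme l (n \<rho>) (F \<rho>) \<and> code_ensemble (M \<rho>) l (Q \<rho>) \<and>
      relay_linear (E \<rho>) l (F \<rho>) (M \<rho>) (Q \<rho>)"
  shows "\<forall>\<^sub>F \<rho> in at_top. \<rho> powr - (af_tradeoff r + \<epsilon>) \<le>
    error_probability (sv2 \<rho>) (sw2 \<rho>) l (n \<rho>) (F \<rho>) (M \<rho>) (Q \<rho>)"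
proof -
  let ?PE = "\<lambda>\<rho>. error_probability (sv2 \<rho>) (sw2 \<rho>) l (n \<rho>) (F \<rho>) (M \<rho>) (Q \<rho>)"
  have M2: "real (M \<rho>) \<ge> 2" if "\<rho> > 0" for \<rho> using multiplexing_gain_ge_2[OF M that] by simp
  note F' = F[THEN conjunct1] F[THEN conjunct2, THEN conjunct1] F[THEN conjunct2, THEN conjunct2]
  note pos' = pos[THEN conjunct1] pos[THEN conjunct2, THEN conjunct1] pos[THEN conjunct2, THEN conjunct2]
  have M0: "M \<rho> > 0" if "\<rho> > 0" for \<rho> using multiplexing_gain_ge_2[OF M that] by simp
  show ?thesis
  proof (cases "r = 0")
    case False
    then have r0: "r > 0" "r \<le> 1" using r by auto
    \<comment> \<open>The margins add up to \<epsilon>: half of it pays for constant factors, and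
      \<delta> + 2 \<delta> for taking X = \<rho> powr (r - \<delta>) in the two thresholds. The
      bound \<open>r / 2\<close> keeps X at least 1.\<close>
    define \<delta> where "\<delta> = min (\<epsilon> / 6) (r / 2)"
    have \<delta>: "\<delta> > 0" "\<delta> \<le> \<epsilon> / 6" "\<delta> < r" using \<epsilon> r0 by (auto simp: \<delta>_def)
    \<comment> \<open>A constant independent of \<rho> that makes the Markov term 1/4; the term with
      \<open>M \<rho>\<close> also falls below 1/4 eventually, so the conditional error is at least
      1/2 on the outage region.\<close>
    define a where "a = 4 * (3 * real l ^ 2 + 10 * real l)"
    have a: "a > 0" using l by (simp add: a_def add_nonneg_pos)
    have "\<delta> / 2 > 0" using \<delta> by simp
    note ev = multiplexing_gain_bounds[OF M l this]
    have "real l * (\<delta> / 2) > 0" using l \<delta> by simp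
    note ev2 = eventually_le_powr[OF this, of "4 * exp a"]
    have "\<epsilon> / 2 > 0" using \<epsilon> by simp
    note ev3 = eventually_le_powr[OF this, of "2 * exp 2"]
    show ?thesis using ev ev2 ev3 eventually_ge_at_top[of 1]
    proof eventually_elim
      case (elim \<rho>)
      then have \<rho>: "\<rho> \<ge> 1" "\<rho> > 0" by auto
      define X where "X = \<rho> powr (r - \<delta>)"
      have X: "X \<ge> 1" unfolding X_def using \<rho> \<delta> by (intro ge_one_powr_ge_zero) auto
      have "X ^ l * exp a / real (M \<rho>) \<le> X ^ l * exp a / \<rho> powr (real l * (r - \<delta> / 2))"
        using elim X M2[OF \<rho>(2)] \<rho> by (intro divide_left_mono mult_pos_pos) auto
      also have "\<dots> = exp a / \<rho> powr (real l * (\<delta> / 2))"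
      proof -
        have "X ^ l = \<rho> powr (real l * (r - \<delta>))"
          unfolding X_def using \<rho> by (simp add: powr_powr mult.commute flip: powr_realpow)
        moreover have "\<rho> powr (real l * (r - \<delta> / 2)) = \<rho> powr (real l * (r - \<delta>)) * \<rho> powr (real l * (\<delta> / 2))"
          by (simp add: powr_add[symmetric] algebra_simps)
        ultimately show ?thesis using \<rho> by simp
      qed
      also have "\<dots> \<le> exp a / (4 * exp a)"
        using elim \<rho> by (intro divide_left_mono mult_pos_pos) auto
      finally have "X ^ l * exp a / real (M \<rho>) \<le> 1 / 4" by simp
      moreover have "(3 * real l ^ 2 + 10 * real l) / a \<le> 1 / 4" using l by (simp add: a_def divide_simps)
      moreover have "1 / 2 \<le> 1 - (x + y)" if "y \<le> 1 / 4" "x \<le> 1 / 4" for x y :: real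
        using that by simp
      ultimately have p: "1 / 2 \<le> 1 - ((3 * real l ^ 2 + 10 * real l) / a + X ^ l * exp a / real (M \<rho>))"
        by blast
      have PE: "1 / 2 * (exp (-1) * min 1 (X / \<rho>)) * (exp (-1) * min 1 (X\<^sup>2 / \<rho>)) \<le> ?PE \<rho>"
        by (rule error_probability_outage[OF F'(1)[OF \<rho>(2)] pos'(1)[OF \<rho>(2)] pos'(2)[OF \<rho>(2)] F'(2)[OF \<rho>(2)] M0[OF \<rho>(2)] \<rho>(2) pos'(3)[OF \<rho>(2)] F'(3)[OF \<rho>(2)] a _ X p]) simp
      have 1: "\<rho> powr - (1 - r + \<delta>) \<le> min 1 (X / \<rho>)"
      proof -
        have "X / \<rho> = \<rho> powr (r - \<delta>) / \<rho> powr 1" using \<rho> by (simp add: X_def)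
        then have "X / \<rho> = \<rho> powr - (1 - r + \<delta>)" unfolding powr_diff[symmetric] by (simp add: algebra_simps)
        moreover have "\<rho> powr - (1 - r + \<delta>) \<le> \<rho> powr 0" using \<rho> \<delta> r0 by (intro powr_mono) auto
        ultimately show ?thesis using \<rho> by simp
      qed
      \<comment> \<open>Once 2 (r - \<delta>) >= 1, the threshold on |g2|^2 is at least 1 and the
        relay path no longer has to be weak: this is the positive part in the tradeoff.\<close>
      have 2: "\<rho> powr - (max (1 - 2 * r) 0 + 2 * \<delta>) \<le> min 1 (X\<^sup>2 / \<rho>)"
      proof -
        have "X\<^sup>2 / \<rho> = \<rho> powr (r - \<delta>) * \<rho> powr (r - \<delta>) / \<rho> powr 1"
          using \<rho> by (simp add: X_def power2_eq_square)
        then have "X\<^sup>2 / \<rho> = \<rho> powr (2 * r - 2 * \<delta> - 1)"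
          unfolding powr_add[symmetric] powr_diff[symmetric] by (simp add: algebra_simps)
        moreover have "\<rho> powr - (max (1 - 2 * r) 0 + 2 * \<delta>) \<le> \<rho> powr 0" using \<rho> \<delta> r0 by (intro powr_mono) auto
        moreover have "\<rho> powr - (max (1 - 2 * r) 0 + 2 * \<delta>) \<le> \<rho> powr (2 * r - 2 * \<delta> - 1)" using \<rho> \<delta> r0 by (intro powr_mono) auto
        ultimately show ?thesis using \<rho> by simp
      qed
      have "\<rho> powr - (af_tradeoff r + \<epsilon>) \<le> \<rho> powr (- (\<epsilon> / 2) + (- (1 - r + \<delta>) + - (max (1 - 2 * r) 0 + 2 * \<delta>)))"
        using \<rho> \<delta> by (intro powr_mono) (auto simp: af_tradeoff_def)
      also have "\<dots> = \<rho> powr - (\<epsilon> / 2) * (\<rho> powr - (1 - r + \<delta>) * \<rho> powr - (max (1 - 2 * r) 0 + 2 * \<delta>))"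
        by (simp only: powr_add)
      also have "\<dots> \<le> (1 / 2 * exp (-2)) * (min 1 (X / \<rho>) * min 1 (X\<^sup>2 / \<rho>))"
      proof (intro mult_mono 1 2)
        have "\<rho> powr - (\<epsilon> / 2) = 1 / \<rho> powr (\<epsilon> / 2)" by (rule powr_minus_divide)
        also have "\<dots> \<le> 1 / (2 * exp 2)" using elim \<rho> by (intro divide_left_mono mult_pos_pos) auto
        finally show "\<rho> powr - (\<epsilon> / 2) \<le> 1 / 2 * exp (-2)" by (simp add: exp_minus field_simps)
      qed (use \<rho> X in auto)
      also have "\<dots> = 1 / 2 * (exp (-1) * min 1 (X / \<rho>)) * (exp (-1) * min 1 (X\<^sup>2 / \<rho>))"
      proof -
        have "exp (-2) = exp (-1) * exp (-1 :: real)" by (simp add: exp_add[symmetric])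
        then show ?thesis by simp
      qed
      finally show ?case using PE by linarith
    qed
  next
    case True
    \<comment> \<open>With \<eta> = 1 / (32 l) and a = 1 / 4 the Markov terms are 1/8 and 1/16, and
      exp (1 / 4) / 2 is at most 21/32. The total 27/32 leaves a conditional error of at least
      1/8.\<close>
    define \<delta> where "\<delta> = 1 / (256 * real l * (1 + 32 * real l))"
    have \<delta>: "\<delta> > 0" "\<delta> \<le> 1"
    proof -
      have "1 * 1 \<le> (256 * real l) * (1 + 32 * real l)" using l by (intro mult_mono) auto
      then show "\<delta> \<le> 1" "\<delta> > 0" using l by (auto simp: \<delta>_def divide_le_eq_1)
    qed
    define K where "K = 1 / 8 * exp (-2) * \<delta>\<^sup>2"
    have K: "K > 0" using \<delta> by (simp add: K_def)
    note ev = eventually_le_powr[OF \<epsilon>, of "1 / K"]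
    show ?thesis using ev eventually_ge_at_top[of 1]
    proof eventually_elim
      case (elim \<rho>)
      then have \<rho>: "\<rho> \<ge> 1" "\<rho> > 0" by auto
      have "(1 / (32 * real l) * real l + (1 + 1 / (1 / (32 * real l))) * 4 * \<delta> * real l) / (1 / 4) = 1 / 8 + 1 / 16"
      proof -
        have "256 * real l * (1 + 32 * real l) * \<delta> = 1" using l by (simp add: \<delta>_def)
        then show ?thesis using l by (simp add: algebra_simps)
      qed
      moreover have "exp (1 / 4 :: real) / M \<rho> \<le> 21 / 32"
      proof -
        have "exp (1 / 4 :: real) \<le> 1 + 1 / 4 + (1 / 4)\<^sup>2" by (rule exp_bound) auto
        then have "exp (1 / 4 :: real) \<le> 21 / 32 * 2" by (simp add: power2_eq_square)
        also have "\<dots> \<le> 21 / 32 * M \<rho>" using M2[OF \<rho>(2)] by (intro mult_left_mono) auto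
        finally show ?thesis using M2[OF \<rho>(2)] by (simp add: divide_le_eq)
      qed
      ultimately have p: "1 / 8 \<le> 1 - ((1 / (32 * real l) * real l + (1 + 1 / (1 / (32 * real l))) * 4 * \<delta> * real l) / (1 / 4) + exp (1 / 4) / real (M \<rho>))"
        by simp
      have "1 / 8 * (exp (-1) * min 1 (\<delta> / \<rho>)) * (exp (-1) * min 1 (\<delta> / \<rho>)) \<le> ?PE \<rho>"
        by (rule error_probability_silence[OF F'(1)[OF \<rho>(2)] pos'(1)[OF \<rho>(2)] pos'(2)[OF \<rho>(2)] F'(2)[OF \<rho>(2)] M0[OF \<rho>(2)] \<rho>(2) pos'(3)[OF \<rho>(2)] F'(3)[OF \<rho>(2)] _ _ _ _ p])
           (use l \<delta> in auto)
      moreover have "min 1 (\<delta> / \<rho>) = \<delta> / \<rho>" using \<delta> \<rho> by (simp add: min_def)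
      moreover have "exp (-2) = exp (-1) * exp (-1 :: real)" by (simp add: exp_add[symmetric])
      ultimately have "K / \<rho>\<^sup>2 \<le> ?PE \<rho>" by (simp add: K_def power2_eq_square field_simps)
      moreover have "\<rho> powr - (af_tradeoff r + \<epsilon>) \<le> K / \<rho>\<^sup>2"
      proof -
        have "\<rho> powr - (af_tradeoff r + \<epsilon>) = 1 / (\<rho> powr 2 * \<rho> powr \<epsilon>)"
        proof -
          have "af_tradeoff r = 2" using True by (simp add: af_tradeoff_def)
          then show ?thesis by (simp only: powr_minus_divide powr_add)
        qed
        also have "\<rho> powr 2 = \<rho>\<^sup>2" using \<rho> by simp
        also have "1 / (\<rho>\<^sup>2 * \<rho> powr \<epsilon>) \<le> 1 / (\<rho>\<^sup>2 * (1 / K))"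
          using elim K \<rho> by (intro divide_left_mono mult_left_mono mult_pos_pos) auto
        finally show ?thesis by simp
      qed
      ultimately show ?case by simp
    qed
  qed
qed

lemma af_tradeoff_upper_bound:
  fixes l :: nat and r \<epsilon> :: real and K1 K2 :: "real \<Rightarrow> real"
  assumes l: "l > 0" and M: "has_multiplexing_gain l M r" and \<epsilon>: "\<epsilon> > 0"
    and K: "\<And>e. K1 e \<ge> 0" "\<And>e. K2 e \<ge> 0"
    and bounds: "\<And>e. 0 < e \<Longrightarrow> e \<le> 1 \<Longrightarrow> \<forall>\<^sub>F \<rho> in at_top.
       PE \<rho> \<le> K1 e * (2 * real (M \<rho>)) powr (3 / l) * \<rho> powr (2 * (e - 1)) \<and>
       PE \<rho> \<le> K2 e * (2 * real (M \<rho>)) powr (1 / l) * \<rho> powr (e - 1)"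
  shows "\<forall>\<^sub>F \<rho> in at_top. PE \<rho> \<le> \<rho> powr - (af_tradeoff r - \<epsilon>)"
proof -
  \<comment> \<open>The exponents lose at most 3 e through the rate and 2 e through the fading
    averages; the other half of \<epsilon> absorbs the constants.\<close>
  define e where "e = min 1 (\<epsilon> / 10)"
  have e: "0 < e" "e \<le> 1" "5 * e \<le> \<epsilon> / 2" using \<epsilon> by (auto simp: e_def)
  have power: "(2 * real (M \<rho>)) powr (k / l) \<le> 2 powr (k / l) * \<rho> powr (k * (r + e))"
    if "real (M \<rho>) \<le> \<rho> powr (real l * (r + e))" "k \<ge> 0" for k \<rho>
  proof -
    have "(2 * real (M \<rho>)) powr (k / l) \<le> (2 * \<rho> powr (real l * (r + e))) powr (k / l)"
      using that by (intro powr_mono2 mult_left_mono) auto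
    also have "\<dots> = 2 powr (k / l) * \<rho> powr (real l * (r + e) * (k / l))"
      by (simp add: powr_mult powr_powr)
    also have "real l * (r + e) * (k / l) = k * (r + e)" using l by simp
    finally show ?thesis .
  qed
  have half: "\<epsilon> / 2 > 0" using \<epsilon> by simp
  show ?thesis
    using multiplexing_gain_bounds[OF M l e(1)] bounds[OF e(1,2)] eventually_ge_at_top[of 1]
      eventually_le_powr[OF half, of "K1 e * 2 powr (3 / l)"] eventually_le_powr[OF half, of "K2 e * 2 powr (1 / l)"]
  proof eventually_elim
    case (elim \<rho>)
    have \<rho>: "\<rho> \<ge> 1" and M': "real (M \<rho>) \<le> \<rho> powr (real l * (r + e))" using elim by auto
    have "PE \<rho> \<le> K1 e * (2 * real (M \<rho>)) powr (3 / l) * \<rho> powr (2 * (e - 1))" using elim by blast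
    also have "\<dots> \<le> K1 e * (2 powr (3 / l) * \<rho> powr (3 * (r + e))) * \<rho> powr (2 * (e - 1))"
      using K by (intro mult_right_mono mult_left_mono power M') auto
    also have "\<dots> = (K1 e * 2 powr (3 / l)) * \<rho> powr (3 * (r + e) + 2 * (e - 1))"
      unfolding powr_add by (simp only: mult.assoc)
    also have "\<dots> \<le> \<rho> powr (\<epsilon> / 2) * \<rho> powr (3 * (r + e) + 2 * (e - 1))"
      using elim by (intro mult_right_mono) auto
    also have "\<dots> = \<rho> powr (\<epsilon> / 2 + (3 * (r + e) + 2 * (e - 1)))" by (rule powr_add[symmetric])
    also have "\<dots> \<le> \<rho> powr - (2 - 3 * r - \<epsilon>)" using \<rho> e by (intro powr_mono) auto
    finally have 1: "PE \<rho> \<le> \<rho> powr - (2 - 3 * r - \<epsilon>)" .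
    have "PE \<rho> \<le> K2 e * (2 * real (M \<rho>)) powr (1 / l) * \<rho> powr (e - 1)" using elim by blast
    also have "\<dots> \<le> K2 e * (2 powr (1 / l) * \<rho> powr (1 * (r + e))) * \<rho> powr (e - 1)"
      using K by (intro mult_right_mono mult_left_mono power M') auto
    also have "\<dots> = (K2 e * 2 powr (1 / l)) * \<rho> powr (1 * (r + e) + (e - 1))"
      unfolding powr_add by (simp only: mult.assoc)
    also have "\<dots> \<le> \<rho> powr (\<epsilon> / 2) * \<rho> powr (1 * (r + e) + (e - 1))"
      using elim by (intro mult_right_mono) auto
    also have "\<dots> = \<rho> powr (\<epsilon> / 2 + (1 * (r + e) + (e - 1)))" by (rule powr_add[symmetric])
    also have "\<dots> \<le> \<rho> powr - (1 - r - \<epsilon>)" using \<rho> e by (intro powr_mono) auto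
    finally have 2: "PE \<rho> \<le> \<rho> powr - (1 - r - \<epsilon>)" .
    have "af_tradeoff r = 2 - 3 * r \<or> af_tradeoff r = 1 - r" by (auto simp: af_tradeoff_def max_def)
    then show ?case using 1 2 by auto
  qed
qed

section \<open>The AF and NAF schemes as linear relaying\<close>

lemma measurable_scheme_components:
  fixes l n :: nat
  defines "N \<equiv> gain_space \<Otimes>\<^sub>M (PiM {..<l} (\<lambda>_. borel :: complex measure) \<Otimes>\<^sub>M PiM {..<n} (\<lambda>_. borel :: complex measure))"
  shows "(\<lambda>\<omega>. fst (fst \<omega>)) \<in> borel_measurable N" "(\<lambda>\<omega>. fst (snd (fst \<omega>))) \<in> borel_measurable N"
    "(\<lambda>\<omega>. snd (snd (fst \<omega>))) \<in> borel_measurable N"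
    "j < l \<Longrightarrow> (\<lambda>\<omega>. fst (snd \<omega>) j) \<in> borel_measurable N"
    "k < n \<Longrightarrow> (\<lambda>\<omega>. snd (snd \<omega>) k) \<in> borel_measurable N"
proof -
  show "(\<lambda>\<omega>. fst (fst \<omega>)) \<in> borel_measurable N" "(\<lambda>\<omega>. fst (snd (fst \<omega>))) \<in> borel_measurable N"
    "(\<lambda>\<omega>. snd (snd (fst \<omega>))) \<in> borel_measurable N" unfolding N_def by measurable
  have "(\<lambda>\<omega>. fst (snd \<omega>)) \<in> N \<rightarrow>\<^sub>M PiM {..<l} (\<lambda>_. borel :: complex measure)" unfolding N_def by measurable
  from measurable_compose[OF this measurable_component_singleton[of j]]
  show "j < l \<Longrightarrow> (\<lambda>\<omega>. fst (snd \<omega>) j) \<in> borel_measurable N" by simp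
  have "(\<lambda>\<omega>. snd (snd \<omega>)) \<in> N \<rightarrow>\<^sub>M PiM {..<n} (\<lambda>_. borel :: complex measure)" unfolding N_def by measurable
  from measurable_compose[OF this measurable_component_singleton[of k]]
  show "k < n \<Longrightarrow> (\<lambda>\<omega>. snd (snd \<omega>) k) \<in> borel_measurable N" by simp
qed

lemma measurable_af_scheme:
  assumes "af_admissible E sw2 l p M Q"
  shows "measurable_scheme l (listen p) (af_scheme p)"
  unfolding measurable_scheme_def
proof (intro allI impI)
  fix i assume i: "i < l"
  let ?N = "gain_space \<Otimes>\<^sub>M (PiM {..<l} (\<lambda>_. borel :: complex measure) \<Otimes>\<^sub>M PiM {..<listen p} (\<lambda>_. borel :: complex measure))"
  have lp: "listen p \<le> l" using assms by (simp add: af_admissible_def)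
  note c = measurable_scheme_components[where l = l and n = "listen p"]
  have B: "(\<lambda>\<omega>. matB p (snd (snd (fst \<omega>))) (i - listen p) k) \<in> borel_measurable ?N"
    if "\<not> i < listen p" "k < listen p" for k
  proof -
    have "(\<lambda>h. matB p h (i - listen p) k) \<in> borel_measurable borel"
      using assms that i lp by (auto simp: af_admissible_def)
    from measurable_compose[OF c(3) this] show ?thesis .
  qed
  have x: "(\<lambda>\<omega>. fst (snd \<omega>) k) \<in> borel_measurable ?N" if "k < l" for k by (rule c(4)[OF that])
  have w: "(\<lambda>\<omega>. snd (snd \<omega>) k) \<in> borel_measurable ?N" if "k < listen p" for k by (rule c(5)[OF that])
  have "(\<lambda>\<omega>. af_scheme p (fst (fst \<omega>)) (fst (snd (fst \<omega>))) (snd (snd (fst \<omega>))) (fst (snd \<omega>)) (snd (snd \<omega>)) i) \<in> borel_measurable ?N"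
  proof (cases "i < listen p")
    case True
    have "(\<lambda>\<omega>. fst (fst \<omega>) * matA1 p i * fst (snd \<omega>) i) \<in> borel_measurable ?N"
      by (intro borel_measurable_times borel_measurable_const c(1) x i)
    then show ?thesis using True by (simp add: af_scheme_def)
  next
    case False
    have "(\<lambda>\<omega>. fst (snd (fst \<omega>)) * snd (snd (fst \<omega>)) * (\<Sum>k<listen p. matB p (snd (snd (fst \<omega>))) (i - listen p) k * matA1 p k * fst (snd \<omega>) k)
        + fst (fst \<omega>) * matA2 p (i - listen p) * fst (snd \<omega>) i
        + fst (snd (fst \<omega>)) * (\<Sum>k<listen p. matB p (snd (snd (fst \<omega>))) (i - listen p) k * snd (snd \<omega>) k)) \<in> borel_measurable ?N"
      by (intro borel_measurable_add borel_measurable_times borel_measurable_sum borel_measurable_const c(1,2,3) x w B)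
         (use i lp False in auto)
    then show ?thesis using False by (simp add: af_scheme_def Let_def)
  qed
  then show "(\<lambda>((g1, g2, h), x, w). af_scheme p g1 g2 h x w i) \<in> borel_measurable ?N"
    by (simp add: case_prod_beta')
qed

lemma relay_linear_af:
  assumes adm: "af_admissible E sw2 l p M Q"
  shows "relay_linear E l (af_scheme p) M Q"
proof -
  let ?n = "listen p"
  have lp: "?n \<le> l" using adm by (simp add: af_admissible_def)
  define u where "u i x = (if i < ?n then matA1 p i else matA2 p (i - ?n)) * x i" for i and x :: "nat \<Rightarrow> complex"
  have um: "u i \<in> borel_measurable (PiM {..<l} (\<lambda>_. borel))" if "i < l" for i
    unfolding u_def using that
    by (intro borel_measurable_times borel_measurable_const measurable_component_singleton) auto
  have uE: "mean_energy M Q (u i) \<le> ennreal E" if i: "i < l" for i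
  proof (cases "i < ?n")
    case True
    then show ?thesis using adm by (simp add: u_def[abs_def] af_admissible_def)
  next
    case False
    then have "i - ?n < l - ?n" "?n + (i - ?n) = i" using i by auto
    with adm have "mean_energy M Q (\<lambda>x. matA2 p (i - ?n) * x i) \<le> ennreal E"
      unfolding af_admissible_def by metis
    then show ?thesis using False by (simp add: u_def[abs_def])
  qed
  have "\<exists>\<beta> \<nu>. relay_form l {..<?n} u \<beta> g1 g2 \<nu> (af_scheme p g1 g2 h) \<and>
     (\<forall>i\<in>{..<l} - {..<?n}. mean_energy M Q (\<lambda>x. \<Sum>k<?n. \<beta> i k * u k x) \<le> ennreal E)" for g1 g2 h
  proof (intro exI conjI ballI)
    \<comment> \<open>\<open>u\<close> already contains \<open>matA1\<close>, and \<open>h\<close>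
      moves into the coefficients, so that the combination is the signal part of what the relay
      sends.\<close>
    let ?\<beta> = "\<lambda>i k. matB p h (i - ?n) k * h"
    let ?\<nu> = "\<lambda>w i. if i < ?n then 0 else g2 * (\<Sum>k<?n. matB p h (i - ?n) k * w k)"
    show "relay_form l {..<?n} u ?\<beta> g1 g2 ?\<nu> (af_scheme p g1 g2 h)"
    proof -
      have "(\<Sum>k<?n. ?\<beta> i k * u k x) = h * (\<Sum>k<?n. matB p h (i - ?n) k * matA1 p k * x k)" for i x
        unfolding sum_distrib_left by (intro sum.cong refl) (simp add: u_def mult_ac)
      then show ?thesis
        unfolding relay_form_def by (auto simp: af_scheme_def Let_def) (auto simp: u_def mult.assoc)
    qed
    fix i assume "i \<in> {..<l} - {..<?n}"
    then have "i - ?n < l - ?n" by auto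
    with adm have "mean_energy M Q (\<lambda>x. \<Sum>k<?n. matB p h (i - ?n) k * (h * matA1 p k * x k))
        + ennreal (sw2 * (\<Sum>k<?n. (cmod (matB p h (i - ?n) k))\<^sup>2)) \<le> ennreal E"
      unfolding af_admissible_def by blast
    then have "mean_energy M Q (\<lambda>x. \<Sum>k<?n. matB p h (i - ?n) k * (h * matA1 p k * x k)) \<le> ennreal E"
      by (rule order_trans[rotated]) simp
    moreover have "mean_energy M Q (\<lambda>x. \<Sum>k<?n. ?\<beta> i k * u k x) \<le> ennreal E"
      if "mean_energy M Q (\<lambda>x. \<Sum>k<?n. matB p h (i - ?n) k * (h * matA1 p k * x k)) \<le> ennreal E"
    proof -
      have "(\<Sum>k<?n. ?\<beta> i k * u k x) = (\<Sum>k<?n. matB p h (i - ?n) k * (h * matA1 p k * x k))" for x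
        by (intro sum.cong refl) (simp add: u_def mult_ac)
      then show ?thesis using that by simp
    qed
    ultimately show "mean_energy M Q (\<lambda>x. \<Sum>k<?n. ?\<beta> i k * u k x) \<le> ennreal E" by blast
  qed
  then show ?thesis
    unfolding relay_linear_def using lp um uE by (intro exI[of _ "{..<?n}"] exI[of _ u]) auto
qed

context naf_layout
begin

lemma measurable_scheme_naf:
  assumes form: "\<And>g1 g2 h x w i. i < l \<Longrightarrow>
      F g1 g2 h x w i = signal g1 (g2 * b h * h) x i + (if i \<in> U then (g2 * b h) * w (\<kappa> i) else 0)"
    and b: "b \<in> borel_measurable borel"
  shows "measurable_scheme l n F"
  unfolding measurable_scheme_def
proof (intro allI impI)
  fix i assume i: "i < l"
  let ?N = "gain_space \<Otimes>\<^sub>M (PiM {..<l} (\<lambda>_. borel :: complex measure) \<Otimes>\<^sub>M PiM {..<n} (\<lambda>_. borel :: complex measure))"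
  note c = measurable_scheme_components[where l = l and n = n]
  have bm: "(\<lambda>\<omega>. b (snd (snd (fst \<omega>)))) \<in> borel_measurable ?N" by (rule measurable_compose[OF c(3) b])
  have "(\<lambda>\<omega>. F (fst (fst \<omega>)) (fst (snd (fst \<omega>))) (snd (snd (fst \<omega>))) (fst (snd \<omega>)) (snd (snd \<omega>)) i) \<in> borel_measurable ?N"
  proof (cases "i \<in> U")
    case True
    have "(\<lambda>\<omega>. fst (fst \<omega>) * fst (snd \<omega>) i + fst (snd (fst \<omega>)) * b (snd (snd (fst \<omega>))) * snd (snd (fst \<omega>)) * fst (snd \<omega>) (\<sigma> i)
        + fst (snd (fst \<omega>)) * b (snd (snd (fst \<omega>))) * snd (snd \<omega>) (\<kappa> i)) \<in> borel_measurable ?N"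
      by (intro borel_measurable_add borel_measurable_times bm c(1,2,3) c(4)[OF i] c(4)[OF \<sigma>_less(1)[OF True]] c(5)[OF \<kappa>_less[OF True]])
    then show ?thesis using True by (simp add: form[OF i] signal_def)
  next
    case False
    have "(\<lambda>\<omega>. fst (fst \<omega>) * fst (snd \<omega>) i) \<in> borel_measurable ?N"
      by (intro borel_measurable_times c(1) c(4)[OF i])
    then show ?thesis using False by (simp add: form[OF i] signal_def)
  qed
  then show "(\<lambda>((g1, g2, h), x, w). F g1 g2 h x w i) \<in> borel_measurable ?N"
    by (simp add: case_prod_beta')
qed

text \<open>A diversity gain is a limit, so the NAF error probability needs a lower bound too; this
  makes the converse apply to it.\<close>

lemma relay_linear_naf:
  assumes form: "\<And>g1 g2 h x w i. i < l \<Longrightarrow>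
      F g1 g2 h x w i = signal g1 (g2 * b h * h) x i + (if i \<in> U then (g2 * b h) * w (\<kappa> i) else 0)"
    and b: "\<And>h. (cmod (b h * h))\<^sup>2 \<le> 1" and E: "E > 0" and M: "M > 0"
  shows "relay_linear E l F M (gaussian_ensemble M l E)"
proof -
  let ?T = "{..<l} - U" and ?Q = "gaussian_ensemble M l E"
  have "\<exists>\<beta> \<nu>. relay_form l ?T (\<lambda>i x. x i) \<beta> g1 g2 \<nu> (F g1 g2 h) \<and>
     (\<forall>i\<in>{..<l} - ?T. mean_energy M ?Q (\<lambda>x. \<Sum>k\<in>?T. \<beta> i k * x k) \<le> ennreal E)" for g1 g2 h
  proof (intro exI conjI ballI)
    let ?\<beta> = "\<lambda>i k. if k = \<sigma> i then b h * h else 0"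
    let ?\<nu> = "\<lambda>w i. if i \<in> U then (g2 * b h) * w (\<kappa> i) else 0"
    have sum: "(\<Sum>k\<in>?T. ?\<beta> i k * x k) = b h * h * x (\<sigma> i)" if "i \<in> U" for i and x :: "nat \<Rightarrow> complex"
      using \<sigma>_less[OF that] by (simp add: if_distrib[of "\<lambda>a. a * _"] cong: if_cong)
    show "relay_form l ?T (\<lambda>i x. x i) ?\<beta> g1 g2 ?\<nu> (F g1 g2 h)"
      unfolding relay_form_def
    proof (intro allI impI)
      fix x w i assume i: "i < l"
      show "F g1 g2 h x w i = (if i \<in> ?T then g1 * x i else g1 * x i + g2 * (\<Sum>k\<in>?T. ?\<beta> i k * x k)) + ?\<nu> w i"
        using i sum[of i x] by (cases "i \<in> U") (simp_all add: form signal_def mult.assoc)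
    qed
    fix i assume "i \<in> {..<l} - ?T"
    then have i: "i \<in> U" by auto
    have "mean_energy M ?Q (\<lambda>x. b h * h * x (\<sigma> i)) = ennreal ((cmod (b h * h))\<^sup>2 * E)"
      by (rule mean_energy_gaussian[OF E M \<sigma>_less(1)[OF i]])
    also have "\<dots> \<le> ennreal E" using mult_right_mono[OF b[of h], of E] E by (intro ennreal_leI) simp
    finally show "mean_energy M ?Q (\<lambda>x. \<Sum>k\<in>?T. ?\<beta> i k * x k) \<le> ennreal E"
      by (simp only: sum[OF i])
  qed
  moreover have "mean_energy M ?Q (\<lambda>x. x i) \<le> ennreal E" if "i < l" for i
    using mean_energy_gaussian[OF E M that, of 1] by simp
  moreover have "(\<lambda>x. x i) \<in> borel_measurable (PiM {..<l} (\<lambda>_. borel :: complex measure))" if "i < l" for i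
    using that by (intro measurable_component_singleton) auto
  ultimately show ?thesis
    unfolding relay_linear_def by (intro exI[of _ ?T] exI[of _ "\<lambda>i x. x i"]) auto
qed

end

text \<open>The order of symbols in the NAF protocol, frame after frame.\<close>

lemma naf_layout_interleaved: "naf_layout (2 * n) n {i. i < 2 * n \<and> odd i} (\<lambda>i. i - 1) (\<lambda>i. i div 2)"
proof
  show "bij_betw (\<lambda>i. i - 1) {i. i < 2 * n \<and> odd i} ({..<2 * n} - {i. i < 2 * n \<and> odd i})"
    by (rule bij_betw_byWitness[where f' = Suc]; auto elim!: oddE evenE; presburger)
  show "bij_betw (\<lambda>i. i div 2) {i. i < 2 * n \<and> odd i} {..<n}"
    by (rule bij_betw_byWitness[where f' = "\<lambda>k. 2 * k + 1"]) auto
qed auto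

text \<open>The reordering in which NAF is literally an AF protocol: the relay first listens to n
  symbols, then repeats them one by one.\<close>

lemma naf_layout_blocks: "naf_layout (2 * n) n {n..<2 * n} (\<lambda>i. i - n) (\<lambda>i. i - n)"
proof
  show "bij_betw (\<lambda>i. i - n) {n..<2 * n} ({..<2 * n} - {n..<2 * n})"
    "bij_betw (\<lambda>i. i - n) {n..<2 * n} {..<n}"
    by (rule bij_betw_byWitness[where f' = "\<lambda>k. k + n"]; auto)+
qed auto

text \<open>Slightly smaller than the largest admissible gain, so that \<open>|b| \<le> 1\<close> and the relay noise
  is not amplified when \<open>h\<close> is small.\<close>

definition repetition_gain :: "real \<Rightarrow> real \<Rightarrow> complex \<Rightarrow> complex" where
  "repetition_gain E sw2 h = of_real (sqrt (E / (((cmod h)\<^sup>2 + 1) * E + sw2)))"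

lemma borel_measurable_repetition_gain: "repetition_gain E sw2 \<in> borel_measurable borel"
  unfolding repetition_gain_def by measurable

lemma cmod_repetition_gain:
  assumes "E > 0" "sw2 > 0"
  shows "(cmod (repetition_gain E sw2 h))\<^sup>2 = E / (((cmod h)\<^sup>2 + 1) * E + sw2)"
  using assms by (simp add: repetition_gain_def add_nonneg_nonneg)

text \<open>The items serve, in order, the AF energy constraint including relay noise, the bound N
  on the noise, the signal energy in the converse, the strength of the relay path, and the NAF
  energy constraint. The extra E in the denominator only turns 1 / (|h|^2 + 1) into 1 / (|h|^2 + 2)
  in the fourth one.\<close>

lemma repetition_gain_bounds:
  assumes E: "E > 0" and s: "sw2 > 0"
  shows "(cmod (repetition_gain E sw2 h))\<^sup>2 * ((cmod h)\<^sup>2 * E + sw2) \<le> E"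
    and "(cmod (repetition_gain E sw2 h))\<^sup>2 \<le> 1"
    and "(cmod (repetition_gain E sw2 h * h))\<^sup>2 \<le> 1"
    and "sw2 \<le> E \<Longrightarrow> 1 / ((cmod h)\<^sup>2 + 2) \<le> (cmod (repetition_gain E sw2 h))\<^sup>2"
    and "cmod (repetition_gain E sw2 h) \<le> sqrt (E / ((cmod h)\<^sup>2 * E + sw2))"
proof -
  let ?H = "(cmod h)\<^sup>2"
  have HE: "?H * E \<ge> 0" using E by simp
  have d: "(?H + 1) * E + sw2 > 0" "?H * E + sw2 > 0" using HE E s unfolding distrib_right by linarith+
  note b = cmod_repetition_gain[OF E s, of h]
  have "E * (?H * E + sw2) \<le> E * ((?H + 1) * E + sw2)" using E by (intro mult_left_mono) (auto simp: distrib_right)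
  then show 1: "(cmod (repetition_gain E sw2 h))\<^sup>2 * (?H * E + sw2) \<le> E"
    unfolding b using d by (simp add: divide_le_eq)
  show "(cmod (repetition_gain E sw2 h))\<^sup>2 \<le> 1"
    unfolding b using d HE s E by (simp add: divide_le_eq distrib_right)
  show "(cmod (repetition_gain E sw2 h * h))\<^sup>2 \<le> 1"
  proof -
    have "?H * E \<le> (?H + 1) * E + sw2" using HE s E unfolding distrib_right by linarith
    then have "?H * E / ((?H + 1) * E + sw2) \<le> 1" using d by (simp only: divide_le_eq_1_pos)
    then show ?thesis unfolding norm_mult power_mult_distrib b by (simp add: mult.commute)
  qed
  show "1 / (?H + 2) \<le> (cmod (repetition_gain E sw2 h))\<^sup>2" if "sw2 \<le> E"
  proof -
    have "1 / (?H + 2) = E / ((?H + 2) * E)" using E by simp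
    also have "\<dots> \<le> E / ((?H + 1) * E + sw2)"
      using that d E by (intro divide_left_mono mult_pos_pos) (auto simp: distrib_right add_nonneg_pos)
    finally show ?thesis unfolding b .
  qed
  have "(cmod (repetition_gain E sw2 h))\<^sup>2 \<le> E / (?H * E + sw2)"
    using 1 d by (simp add: le_divide_eq)
  then show "cmod (repetition_gain E sw2 h) \<le> sqrt (E / (?H * E + sw2))"
    by (rule real_le_rsqrt)
qed

text \<open>Stated for an arbitrary layout because it is needed twice: for the NAF protocol in frame
  order, and for its block form, a competitor in the supremum over AF protocols.\<close>

lemma (in naf_layout) naf_achieves_tradeoff:
  fixes E sv2 sw2 :: "real \<Rightarrow> real" and \<kappa>\<^sub>0 r :: real
  assumes pos: "\<And>\<rho>. \<rho> > 0 \<Longrightarrow> sv2 \<rho> > 0" "\<And>\<rho>. \<rho> > 0 \<Longrightarrow> sw2 \<rho> > 0"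
    and \<kappa>\<^sub>0: "\<kappa>\<^sub>0 > 0" "\<And>\<rho>. \<rho> > 0 \<Longrightarrow> sv2 \<rho> = \<kappa>\<^sub>0 * sw2 \<rho>" and E: "\<And>\<rho>. \<rho> > 0 \<Longrightarrow> E \<rho> = \<rho> * sv2 \<rho>"
    and n: "n \<ge> 2" and r: "r \<in> {0..1}" and M: "has_multiplexing_gain l M r"
    and form: "\<And>\<rho> g1 g2 h x w i. i < l \<Longrightarrow> F \<rho> g1 g2 h x w i =
      signal g1 (g2 * repetition_gain (E \<rho>) (sw2 \<rho>) h * h) x i +
      (if i \<in> U then (g2 * repetition_gain (E \<rho>) (sw2 \<rho>) h) * w (\<kappa> i) else 0)"
  shows "has_diversity_gain (\<lambda>\<rho>. error_probability (sv2 \<rho>) (sw2 \<rho>) l n (F \<rho>) (M \<rho>)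
    (gaussian_ensemble (M \<rho>) l (E \<rho>))) (ereal (af_tradeoff r))"
proof (rule has_diversity_gainI)
  have l: "l > 0" using n card_U(3) by simp
  have E0: "E \<rho> > 0" if "\<rho> > 0" for \<rho> using E[OF that] pos[OF that] that by simp
  have M0: "M \<rho> > 0" if "\<rho> > 0" for \<rho> using multiplexing_gain_ge_2[OF M that] by simp
  have F: "measurable_scheme l n (F \<rho>)" for \<rho>
    by (rule measurable_scheme_naf[where F = "F \<rho>" and b = "repetition_gain (E \<rho>) (sw2 \<rho>)",
        OF form borel_measurable_repetition_gain])
  fix \<epsilon> :: real assume \<epsilon>: "\<epsilon> > 0"
  show "\<forall>\<^sub>F \<rho> in at_top. \<rho> powr - (af_tradeoff r + \<epsilon>) \<le> error_probability (sv2 \<rho>) (sw2 \<rho>) l n (F \<rho>) (M \<rho>)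
    (gaussian_ensemble (M \<rho>) l (E \<rho>))"
  proof (rule relay_linear_lower_bound[OF l r M \<epsilon>])
    fix \<rho> :: real assume \<rho>: "\<rho> > 0"
    show "sv2 \<rho> > 0 \<and> sw2 \<rho> > 0 \<and> E \<rho> = \<rho> * sv2 \<rho>" using pos E \<rho> by simp
    have "relay_linear (E \<rho>) l (F \<rho>) (M \<rho>) (gaussian_ensemble (M \<rho>) l (E \<rho>))"
      by (rule relay_linear_naf[where F = "F \<rho>" and b = "repetition_gain (E \<rho>) (sw2 \<rho>)", OF form repetition_gain_bounds(3)[OF E0[OF \<rho>] pos(2)[OF \<rho>]] E0[OF \<rho>] M0[OF \<rho>]])
    then show "measurable_scheme l n (F \<rho>) \<and> code_ensemble (M \<rho>) l (gaussian_ensemble (M \<rho>) l (E \<rho>)) \<and>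
      relay_linear (E \<rho>) l (F \<rho>) (M \<rho>) (gaussian_ensemble (M \<rho>) l (E \<rho>))"
      using F code_ensemble_gaussian[OF E0[OF \<rho>]] by blast
  qed
  define c where "c = 1 + 1 / \<kappa>\<^sub>0"
  have c: "c \<ge> 1" "c \<ge> 1 / \<kappa>\<^sub>0" using \<kappa>\<^sub>0 by (auto simp: c_def)
  have J: "weight_integral e c \<ge> 0" for e by (simp add: weight_integral_def)
  show "\<forall>\<^sub>F \<rho> in at_top. error_probability (sv2 \<rho>) (sw2 \<rho>) l n (F \<rho>) (M \<rho>)
    (gaussian_ensemble (M \<rho>) l (E \<rho>)) \<le> \<rho> powr - (af_tradeoff r - \<epsilon>)"
  proof (rule af_tradeoff_upper_bound[OF l M \<epsilon>, where ?K1.0 = "\<lambda>e. 32 * weight_integral e c ^ 3" and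
      ?K2.0 = "\<lambda>e. 4 * (weight_integral e c * weight_integral 1 c)"])
    fix e :: real assume e: "0 < e" "e \<le> 1"
    show "\<forall>\<^sub>F \<rho> in at_top. error_probability (sv2 \<rho>) (sw2 \<rho>) l n (F \<rho>) (M \<rho>) (gaussian_ensemble (M \<rho>) l (E \<rho>))
         \<le> 32 * weight_integral e c ^ 3 * (2 * real (M \<rho>)) powr (3 / l) * \<rho> powr (2 * (e - 1)) \<and>
       error_probability (sv2 \<rho>) (sw2 \<rho>) l n (F \<rho>) (M \<rho>) (gaussian_ensemble (M \<rho>) l (E \<rho>))
         \<le> 4 * (weight_integral e c * weight_integral 1 c) * (2 * real (M \<rho>)) powr (1 / l) * \<rho> powr (e - 1)"
      \<comment> \<open>From this SNR on, \<open>sw2 \<rho> \<le> E \<rho>\<close>, so the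
        repetition gain is bounded below independently of \<rho>.\<close>
      using eventually_ge_at_top[of "1 / \<kappa>\<^sub>0"] eventually_gt_at_top[of 0]
    proof eventually_elim
      case (elim \<rho>)
      then have \<rho>: "\<rho> > 0" by simp
      have "1 \<le> \<rho> * \<kappa>\<^sub>0" using elim \<kappa>\<^sub>0(1) by (simp add: divide_le_eq)
      then have "1 * sw2 \<rho> \<le> \<rho> * \<kappa>\<^sub>0 * sw2 \<rho>" using pos(2)[OF \<rho>] by (intro mult_right_mono) auto
      then have sE: "sw2 \<rho> \<le> E \<rho>" using E[OF \<rho>] \<kappa>\<^sub>0(2)[OF \<rho>] by (simp add: mult.assoc)
      note g = repetition_gain_bounds[OF E0[OF \<rho>] pos(2)[OF \<rho>]]
      show ?case
        using error_probability_naf_le[where F = "F \<rho>" and b = "repetition_gain (E \<rho>) (sw2 \<rho>)", OF F pos(1)[OF \<rho>] pos(2)[OF \<rho>] \<rho> M0[OF \<rho>] form \<kappa>\<^sub>0(1) \<kappa>\<^sub>0(2)[OF \<rho>]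
            g(2) g(4)[OF sE] e c n]
        by (simp add: E[OF \<rho>] mult_ac)
    qed
  qed (use J in auto)
qed

text \<open>Without such a family the supremum could not be shown to be attained. The summand 2 in
  \<open>M\<close> keeps the rate positive even at r = 0, and costs at most a factor 3, invisible
  after division by \<open>log 2 \<rho>\<close>.\<close>

lemma multiplexing_gain_exists:
  assumes l: "l > 0" and r: "r \<ge> 0"
  shows "\<exists>M. has_multiplexing_gain l M r"
proof -
  define M where "M \<rho> = 2 + nat \<lfloor>\<rho> powr (real l * r)\<rfloor>" for \<rho> :: real
  have M2: "M \<rho> \<ge> 2" for \<rho> by (simp add: M_def)
  have pos: "rate l (M \<rho>) > 0" for \<rho>
    using M2[of \<rho>] l by (simp add: rate_def)
  have bounds: "r \<le> rate l (M \<rho>) / log 2 \<rho> \<and> rate l (M \<rho>) / log 2 \<rho> \<le> r + log 2 3 / l * (1 / log 2 \<rho>)"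
    if \<rho>: "\<rho> > 1" for \<rho>
  proof -
    let ?x = "\<rho> powr (real l * r)"
    have x: "?x \<ge> 1" using \<rho> r by (intro ge_one_powr_ge_zero) auto
    have Mx: "?x \<le> real (M \<rho>)" "real (M \<rho>) \<le> 3 * ?x" using x unfolding M_def by linarith+
    have L: "log 2 \<rho> > 0" using \<rho> by simp
    have "0 < ?x" "0 < real (M \<rho>)" using \<rho> M2[of \<rho>] by simp_all
    then have "log 2 ?x \<le> log 2 (real (M \<rho>))" "log 2 (real (M \<rho>)) \<le> log 2 (3 * ?x)"
      using Mx by (subst log_le_cancel_iff; simp)+
    then have "real l * r * log 2 \<rho> \<le> log 2 (real (M \<rho>))" "log 2 (real (M \<rho>)) \<le> log 2 3 + real l * r * log 2 \<rho>"
      using \<rho> x by (simp_all add: log_powr log_mult)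
    note lower = this(1) and upper = this(2)
    have P: "real l * log 2 \<rho> > 0" using L l by simp
    have "r \<le> log 2 (real (M \<rho>)) / (real l * log 2 \<rho>)"
      using lower unfolding pos_le_divide_eq[OF P] by (simp only: mult_ac)
    moreover have "(log 2 3 + real l * r * log 2 \<rho>) / (real l * log 2 \<rho>) = r + log 2 3 / l * (1 / log 2 \<rho>)"
      using L l by (simp add: add_divide_distrib)
    with divide_right_mono[OF upper less_imp_le[OF P]]
    have "log 2 (real (M \<rho>)) / (real l * log 2 \<rho>) \<le> r + log 2 3 / l * (1 / log 2 \<rho>)" by simp
    ultimately show ?thesis by (simp add: rate_def)
  qed
  have "((\<lambda>\<rho>. 1 / log 2 \<rho>) \<longlongrightarrow> 0) at_top" by real_asymp
  from tendsto_add[OF tendsto_const[of r] tendsto_mult[OF tendsto_const[of "log 2 3 / l"] this]]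
  have lim: "((\<lambda>\<rho>. r + log 2 3 / l * (1 / log 2 \<rho>)) \<longlongrightarrow> r) at_top" by simp
  have "((\<lambda>\<rho>. rate l (M \<rho>) / log 2 \<rho>) \<longlongrightarrow> r) at_top"
    by (rule tendsto_sandwich[OF _ _ tendsto_const lim]; rule eventually_mono[OF eventually_gt_at_top[of 1]])
       (use bounds in blast)+
  then show ?thesis using pos by (auto simp: has_multiplexing_gain_def)
qed

lemma af_admissible_naf:
  fixes b :: "complex \<Rightarrow> complex"
  assumes E: "E > 0" and s: "sw2 > 0" and M: "M > 0" and b: "b \<in> borel_measurable borel"
    and energy: "\<And>h. (cmod (b h))\<^sup>2 * ((cmod h)\<^sup>2 * E + sw2) \<le> E"
  shows "af_admissible E sw2 (2 * n) \<lparr>listen = n, matA1 = \<lambda>_. 1, matA2 = \<lambda>_. 1, matB = \<lambda>h j k. if j = k then b h else 0\<rparr>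
    M (gaussian_ensemble M (2 * n) E)"
proof -
  let ?Q = "gaussian_ensemble M (2 * n) E"
  have e: "mean_energy M ?Q (\<lambda>x. x i) \<le> ennreal E" if "i < 2 * n" for i
    using mean_energy_gaussian[OF E M that, of 1] by simp
  have "mean_energy M ?Q (\<lambda>x. \<Sum>k<n. (if j = k then b h else 0) * (h * x k)) +
      ennreal (sw2 * (\<Sum>k<n. (cmod (if j = k then b h else 0))\<^sup>2)) \<le> ennreal E" if j: "j < n" for h j
  proof -
    have 1: "(\<Sum>k<n. (if j = k then b h else 0) * (h * x k)) = b h * h * x j" for x
      using j by (simp add: if_distrib[of "\<lambda>a. a * _"] cong: if_cong)
    have 2: "(\<Sum>k<n. (cmod (if j = k then b h else 0))\<^sup>2) = (cmod (b h))\<^sup>2"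
      using j by (simp add: if_distrib[of cmod] if_distrib[of "\<lambda>a. a\<^sup>2"] cong: if_cong)
    have "mean_energy M ?Q (\<lambda>x. b h * h * x j) + ennreal (sw2 * (cmod (b h))\<^sup>2) =
        ennreal ((cmod (b h * h))\<^sup>2 * E + sw2 * (cmod (b h))\<^sup>2)"
      using mean_energy_gaussian[OF E M, of j "2 * n" "b h * h"] j E s by simp
    also have "\<dots> \<le> ennreal E"
      using energy[of h] by (intro ennreal_leI) (simp add: norm_mult power_mult_distrib algebra_simps)
    finally show ?thesis unfolding 1 2 .
  qed
  then show ?thesis
    using e b by (auto simp: af_admissible_def)
qed

theorem theorem2:
  fixes E sv2 sw2 :: "real \<Rightarrow> real" and \<kappa> :: real
  assumes "\<And>\<rho>. \<rho> > 0 \<Longrightarrow> sv2 \<rho> > 0"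
    and "\<And>\<rho>. \<rho> > 0 \<Longrightarrow> sw2 \<rho> > 0"
    and "\<And>\<rho>. \<rho> > 0 \<Longrightarrow> sv2 \<rho> / sw2 \<rho> = \<kappa>"
    and "\<And>\<rho>. \<rho> > 0 \<Longrightarrow> E \<rho> / sv2 \<rho> = \<rho>"
  shows "\<exists>b. (\<forall>\<rho>>0. naf_gain_admissible (E \<rho>) (sw2 \<rho>) (b \<rho>)) \<and>
           (\<forall>r\<in>{0..1}.
              naf_diversity_gain E sv2 sw2 b r (af_optimal_diversity E sv2 sw2 r) \<and>
              af_optimal_diversity E sv2 sw2 r = ereal ((1 - r) + max (1 - 2 * r) 0))"
proof -
  note pos = assms(1,2)
  have E: "E \<rho> = \<rho> * sv2 \<rho>" if "\<rho> > 0" for \<rho>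
    using assms(4)[OF that] pos(1)[OF that] by (simp add: divide_eq_eq)
  have E0: "E \<rho> > 0" if "\<rho> > 0" for \<rho> using E[OF that] pos(1)[OF that] that by simp
  have \<kappa>_pos: "\<kappa> > 0" using assms(3)[of 1] pos[of 1] by (simp add: divide_pos_pos flip: assms(3)[of 1])
  have sv: "sv2 \<rho> = \<kappa> * sw2 \<rho>" if "\<rho> > 0" for \<rho>
    using assms(3)[OF that] pos(2)[OF that] by (simp add: divide_eq_eq)
  define b where "b \<rho> = repetition_gain (E \<rho>) (sw2 \<rho>)" for \<rho>
  have "naf_gain_admissible (E \<rho>) (sw2 \<rho>) (b \<rho>)" if "\<rho> > 0" for \<rho>
    unfolding naf_gain_admissible_def b_def
    using borel_measurable_repetition_gain repetition_gain_bounds(5)[OF E0[OF that] pos(2)[OF that]] by blast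
  moreover have naf: "naf_diversity_gain E sv2 sw2 b r (ereal (af_tradeoff r))" if r: "r \<in> {0..1}" for r
    \<comment> \<open>Length 4 gives n >= 2 and hence 3 / l <= 1, as the interpolation between the
      two error bounds requires.\<close>
    unfolding naf_diversity_gain_def using eventually_ge_at_top[of 4]
  proof (eventually_elim, intro impI allI)
    fix l M assume l: "4 \<le> l" "even l" and M: "has_multiplexing_gain l M r"
    define n where "n = l div 2"
    have n: "l = 2 * n" "n \<ge> 2" using l by (auto simp: n_def)
    interpret naf_layout l n "{i. i < l \<and> odd i}" "\<lambda>i. i - 1" "\<lambda>i. i div 2"
      unfolding n(1) by (rule naf_layout_interleaved)
    have "has_diversity_gain (\<lambda>\<rho>. error_probability (sv2 \<rho>) (sw2 \<rho>) l n (naf_scheme (b \<rho>)) (M \<rho>)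
      (gaussian_ensemble (M \<rho>) l (E \<rho>))) (ereal (af_tradeoff r))"
      by (rule naf_achieves_tradeoff[OF pos \<kappa>_pos sv E n(2) r M])
         (unfold signal_def, auto simp: naf_scheme_def b_def algebra_simps)
    then show "has_diversity_gain (\<lambda>\<rho>. error_probability (sv2 \<rho>) (sw2 \<rho>) l (l div 2) (naf_scheme (b \<rho>)) (M \<rho>)
      (gaussian_ensemble (M \<rho>) l (E \<rho>))) (ereal (af_tradeoff r))"
      by (simp only: n_def)
  qed
  moreover have opt: "af_optimal_diversity E sv2 sw2 r = ereal (af_tradeoff r)" if r: "r \<in> {0..1}" for r
    unfolding af_optimal_diversity_def
  proof (rule antisym)
    show "Sup {d. af_achieves E sv2 sw2 r d} \<le> ereal (af_tradeoff r)"
    proof (rule Sup_least)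
      fix d assume "d \<in> {d. af_achieves E sv2 sw2 r d}"
      then obtain l p M Q where l: "l > 0"
        and adm: "\<forall>\<rho>>0. code_ensemble (M \<rho>) l (Q \<rho>) \<and> af_admissible (E \<rho>) (sw2 \<rho>) l (p \<rho>) (M \<rho>) (Q \<rho>)"
        and M: "has_multiplexing_gain l M r"
        and d: "has_diversity_gain (\<lambda>\<rho>. error_probability (sv2 \<rho>) (sw2 \<rho>) l (listen (p \<rho>)) (af_scheme (p \<rho>)) (M \<rho>) (Q \<rho>)) d"
        unfolding af_achieves_def by blast
      show "d \<le> ereal (af_tradeoff r)"
      proof (rule has_diversity_gain_le[OF _ d])
        fix \<epsilon> :: real assume \<epsilon>: "\<epsilon> > 0"
        show "\<forall>\<^sub>F \<rho> in at_top. \<rho> powr - (af_tradeoff r + \<epsilon>) \<le>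
            error_probability (sv2 \<rho>) (sw2 \<rho>) l (listen (p \<rho>)) (af_scheme (p \<rho>)) (M \<rho>) (Q \<rho>)"
        proof (rule relay_linear_lower_bound[OF l r M \<epsilon>])
          fix \<rho> :: real assume \<rho>: "\<rho> > 0"
          show "sv2 \<rho> > 0 \<and> sw2 \<rho> > 0 \<and> E \<rho> = \<rho> * sv2 \<rho>" using pos E \<rho> by simp
          show "measurable_scheme l (listen (p \<rho>)) (af_scheme (p \<rho>)) \<and> code_ensemble (M \<rho>) l (Q \<rho>) \<and>
              relay_linear (E \<rho>) l (af_scheme (p \<rho>)) (M \<rho>) (Q \<rho>)"
            using adm \<rho> measurable_af_scheme relay_linear_af by blast
        qed
      qed
    qed
    obtain M where M: "has_multiplexing_gain (2 * 2) M r"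
      using multiplexing_gain_exists[of "2 * 2" r] r by auto
    define p where "p \<rho> = \<lparr>listen = 2, matA1 = \<lambda>_. 1, matA2 = \<lambda>_. 1, matB = \<lambda>h j k. if j = k then b \<rho> h else 0\<rparr>" for \<rho>
    interpret naf_layout "2 * 2" 2 "{2..<2 * 2}" "\<lambda>i. i - 2" "\<lambda>i. i - 2"
      by (rule naf_layout_blocks)
    have "has_diversity_gain (\<lambda>\<rho>. error_probability (sv2 \<rho>) (sw2 \<rho>) (2 * 2) 2 (af_scheme (p \<rho>)) (M \<rho>)
      (gaussian_ensemble (M \<rho>) (2 * 2) (E \<rho>))) (ereal (af_tradeoff r))"
    proof (rule naf_achieves_tradeoff[OF pos \<kappa>_pos sv E order_refl r M])
      fix \<rho> g1 g2 h x w and i :: nat assume i: "i < 2 * 2"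
      have "(\<Sum>k<2. (if j = k then b \<rho> h else 0) * f k) = b \<rho> h * f j" if "j < 2" for j and f :: "nat \<Rightarrow> complex"
        using that by (simp add: if_distrib[of "\<lambda>a. a * _"] cong: if_cong)
      then show "af_scheme (p \<rho>) g1 g2 h x w i =
          signal g1 (g2 * repetition_gain (E \<rho>) (sw2 \<rho>) h * h) x i +
          (if i \<in> {2..<2 * 2} then (g2 * repetition_gain (E \<rho>) (sw2 \<rho>) h) * w (i - 2) else 0)"
        unfolding signal_def using i by (auto simp: af_scheme_def p_def b_def Let_def algebra_simps)
    qed
    moreover have "code_ensemble (M \<rho>) (2 * 2) (gaussian_ensemble (M \<rho>) (2 * 2) (E \<rho>)) \<and>
        af_admissible (E \<rho>) (sw2 \<rho>) (2 * 2) (p \<rho>) (M \<rho>) (gaussian_ensemble (M \<rho>) (2 * 2) (E \<rho>))" if \<rho>: "\<rho> > 0" for \<rho>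
    proof
      have M0: "M \<rho> > 0" using multiplexing_gain_ge_2[OF M \<rho>] by simp
      show "code_ensemble (M \<rho>) (2 * 2) (gaussian_ensemble (M \<rho>) (2 * 2) (E \<rho>))"
        by (rule code_ensemble_gaussian[OF E0[OF \<rho>]])
      show "af_admissible (E \<rho>) (sw2 \<rho>) (2 * 2) (p \<rho>) (M \<rho>) (gaussian_ensemble (M \<rho>) (2 * 2) (E \<rho>))"
        unfolding p_def b_def
        by (rule af_admissible_naf[OF E0[OF \<rho>] pos(2)[OF \<rho>] M0 borel_measurable_repetition_gain
            repetition_gain_bounds(1)[OF E0[OF \<rho>] pos(2)[OF \<rho>]]])
    qed
    moreover have "listen (p \<rho>) = 2" for \<rho> by (simp add: p_def)
    ultimately have "af_achieves E sv2 sw2 r (ereal (af_tradeoff r))"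
      unfolding af_achieves_def using M
      by (intro exI[of _ "2 * 2 :: nat"] exI[of _ p] exI[of _ M] exI[of _ "\<lambda>\<rho>. gaussian_ensemble (M \<rho>) (2 * 2) (E \<rho>)"]) simp
    then show "ereal (af_tradeoff r) \<le> Sup {d. af_achieves E sv2 sw2 r d}"
      by (intro Sup_upper) simp
  qed
  ultimately show ?thesis
    by (intro exI[of _ b]) (simp add: opt naf af_tradeoff_def)
qed

end
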